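(* Let $G$ be a Polish group. There exists a closed set $F \subseteq \mathbb{U}$ (where $\mathbb{U}$ is the Urysohn space) such that $G$ is topologically isomorphic to $\mathrm{Iso}(F)$, and every isometry of $F$ is the restriction of a unique isometry of $\mathbb{U}$; in particular, $G$ is (topologically) isomorphic to $\mathrm{Iso}(\mathbb{U},F)=\{\varphi\in \mathrm{Iso}(\mathbb{U}) : \varphi(F)=F\}$.
   Context: A Polish metric space is a complete separable metric space. A Polish group is a topological group whose topology is Polish (separable and completely metrizable). A map $f$ between metric spaces $(X,d)$ and $(X',d')$ is an isometric map if $d(x,y)=d'(f(x),f(y))$ for all $x,y\in X$; it is an isometry if moreover it is onto. For a separable metric space $X$, $\mathrm{Iso}(X)$ denotes the group of isometries of $X$ onto itself, endowed with the product topology (the topology of pointwise convergence, induced from $X^X$); it is a Polish group when $X$ is a Polish metric space. A subset $F\subseteq\mathbb{U}$ is viewed as a metric space with the induced metric, and $\mathrm{Iso}(\mathbb{U},F)$ carries the topology induced from $\mathrm{Iso}(\mathbb{U})$. "Topologically isomorphic" means isomorphic as topological groups. A metric space $X$ is finitely injective if for any finite metric spaces $K\subseteq L$ and any isometric map $\varphi\colon K\to X$ there is an isometric map $\tilde\varphi\colon L\to X$ with $\tilde\varphi|_K=\varphi$. The Urysohn space $\mathbb{U}$ is the unique (up to isometry) finitely injective Polish metric space. *)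

theory Defs
  imports "HOL-Analysis.Analysis" "HOL-Algebra.Bij"
begin

section \<open>Topological groups and Polish groups\<close>

locale topological_group = group G for G (structure) +
  fixes T
  assumes topspace_eq_carrier: "topspace T = carrier G"
    and continuous_mult: "continuous_map (prod_topology T T) T (\<lambda>(x, y). x \<otimes> y)"
    and continuous_inv: "continuous_map T T (\<lambda>x. inv x)"

locale polish_group = topological_group +
  assumes completely_metrizable: "completely_metrizable_space T"
    and separable: "separable_space T"

definition topologically_isomorphic ::
    "('a, 'm) monoid_scheme \<Rightarrow> 'a topology \<Rightarrow> ('b, 'n) monoid_scheme \<Rightarrow> 'b topology \<Rightarrow> bool"
  where "topologically_isomorphic G S H T \<longleftrightarrow> (\<exists>h \<in> Group.iso G H. homeomorphic_map S T h)"


section \<open>Isometric maps, isometries and isometry groups\<close>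

definition isometric_map :: "'a metric \<Rightarrow> 'b metric \<Rightarrow> ('a \<Rightarrow> 'b) \<Rightarrow> bool"
  where "isometric_map X Y f \<longleftrightarrow>
    f \<in> mspace X \<rightarrow> mspace Y \<and>
    (\<forall>x \<in> mspace X. \<forall>y \<in> mspace X. mdist X x y = mdist Y (f x) (f y))"

definition isometry :: "'a metric \<Rightarrow> 'b metric \<Rightarrow> ('a \<Rightarrow> 'b) \<Rightarrow> bool"
  where "isometry X Y f \<longleftrightarrow> isometric_map X Y f \<and> f ` mspace X = mspace Y"

text \<open>As for \<^const>\<open>Bij\<close>, a self-map of the space is represented by a function that is
  \<^const>\<open>undefined\<close> outside the space, so that equal maps are equal as functions.\<close>

definition Iso :: "'a metric \<Rightarrow> ('a \<Rightarrow> 'a) set"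
  where "Iso X = {f \<in> extensional (mspace X). isometry X X f}"

definition Iso_group :: "'a metric \<Rightarrow> ('a \<Rightarrow> 'a) monoid"
  where "Iso_group X = BijGroup (mspace X) \<lparr>carrier := Iso X\<rparr>"

definition Iso_topology :: "'a metric \<Rightarrow> ('a \<Rightarrow> 'a) topology"
  where "Iso_topology X =
    subtopology (product_topology (\<lambda>_. mtopology_of X) (mspace X)) (Iso X)"

definition Iso_stab :: "'a metric \<Rightarrow> 'a set \<Rightarrow> ('a \<Rightarrow> 'a) set"
  where "Iso_stab X F = {f \<in> Iso X. f ` F = F}"

definition Iso_stab_group :: "'a metric \<Rightarrow> 'a set \<Rightarrow> ('a \<Rightarrow> 'a) monoid"
  where "Iso_stab_group X F = (Iso_group X) \<lparr>carrier := Iso_stab X F\<rparr>"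

definition Iso_stab_topology :: "'a metric \<Rightarrow> 'a set \<Rightarrow> ('a \<Rightarrow> 'a) topology"
  where "Iso_stab_topology X F = subtopology (Iso_topology X) (Iso_stab X F)"

lemma Iso_subset_Bij: "Iso X \<subseteq> Bij (mspace X)"
proof
  fix f assume f: "f \<in> Iso X"
  have "inj_on f (mspace X)"
  proof (rule inj_onI)
    fix x y assume xy: "x \<in> mspace X" "y \<in> mspace X" "f x = f y"
    then have "mdist X x y = mdist X (f x) (f y)" "f x \<in> mspace X"
      using f by (auto simp: Iso_def isometry_def isometric_map_def)
    with xy show "x = y" by (metis mdist_zero)
  qed
  then show "f \<in> Bij (mspace X)"
    using f by (auto simp: Iso_def isometry_def Bij_def bij_betw_def)
qed

lemma compose_Iso:
  assumes "f \<in> Iso X" "g \<in> Iso X"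
  shows "compose (mspace X) f g \<in> Iso X"
proof -
  have "compose (mspace X) f g ` mspace X = f ` (g ` mspace X)"
    by (auto simp: compose_def)
  then show ?thesis
    using assms by (auto simp: Iso_def isometry_def isometric_map_def compose_def Pi_iff)
qed

lemma inv_Iso:
  assumes "f \<in> Iso X"
  shows "restrict (inv_into (mspace X) f) (mspace X) \<in> Iso X"
proof -
  let ?g = "inv_into (mspace X) f"
  have im: "f ` mspace X = mspace X"
    and eq: "\<And>x y. x \<in> mspace X \<Longrightarrow> y \<in> mspace X \<Longrightarrow> mdist X (f x) (f y) = mdist X x y"
    using assms by (auto simp: Iso_def isometry_def isometric_map_def)
  have g: "?g x \<in> mspace X" "f (?g x) = x" if "x \<in> mspace X" for x
    using that im by (auto intro: inv_into_into f_inv_into_f)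
  have "bij_betw ?g (mspace X) (mspace X)"
    using Iso_subset_Bij assms by (auto simp: Bij_def intro: bij_betw_inv_into)
  moreover have "mdist X x y = mdist X (?g x) (?g y)" if "x \<in> mspace X" "y \<in> mspace X" for x y
    using that g eq[of "?g x" "?g y"] by simp
  ultimately show ?thesis
    using g by (auto simp: Iso_def isometry_def isometric_map_def bij_betw_def)
qed

lemma subgroup_Iso: "subgroup (Iso X) (BijGroup (mspace X))"
proof (rule subgroup.intro)
  show "Iso X \<subseteq> carrier (BijGroup (mspace X))"
    using Iso_subset_Bij by (simp add: BijGroup_def)
  show "f \<otimes>\<^bsub>BijGroup (mspace X)\<^esub> g \<in> Iso X" if "f \<in> Iso X" "g \<in> Iso X" for f g
    using that Iso_subset_Bij compose_Iso by (auto simp: BijGroup_def subset_iff)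
  show "\<one>\<^bsub>BijGroup (mspace X)\<^esub> \<in> Iso X"
    by (auto simp: BijGroup_def Iso_def isometry_def isometric_map_def)
  show "inv\<^bsub>BijGroup (mspace X)\<^esub> f \<in> Iso X" if "f \<in> Iso X" for f
    using that Iso_subset_Bij[of X] inv_Iso[OF that] by (simp add: inv_BijGroup subset_iff)
qed

lemma group_Iso_group: "group (Iso_group X)"
  unfolding Iso_group_def
  by (rule subgroup.subgroup_is_group[OF subgroup_Iso group_BijGroup])

lemma subgroup_Iso_stab:
  assumes "F \<subseteq> mspace X"
  shows "subgroup (Iso_stab X F) (Iso_group X)"
proof -
  have "subgroup (Iso_stab X F) (BijGroup (mspace X))"
  proof (rule subgroup.intro)
    show "Iso_stab X F \<subseteq> carrier (BijGroup (mspace X))"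
      using Iso_subset_Bij by (auto simp: BijGroup_def Iso_stab_def)
    show "\<one>\<^bsub>BijGroup (mspace X)\<^esub> \<in> Iso_stab X F"
      using subgroup.one_closed[OF subgroup_Iso[of X]] assms
      by (auto simp: Iso_stab_def BijGroup_def subset_iff)
  next
    fix f g assume fg: "f \<in> Iso_stab X F" "g \<in> Iso_stab X F"
    have "compose (mspace X) f g ` F = f ` (g ` F)"
      using assms by (force simp: compose_def)
    with fg show "f \<otimes>\<^bsub>BijGroup (mspace X)\<^esub> g \<in> Iso_stab X F"
      using Iso_subset_Bij compose_Iso by (auto simp: Iso_stab_def BijGroup_def subset_iff)
  next
    fix f assume f: "f \<in> Iso_stab X F"
    then have bij: "f \<in> Bij (mspace X)" and fF: "f ` F = F"
      using Iso_subset_Bij by (auto simp: Iso_stab_def)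
    have inj: "inj_on f (mspace X)"
      using bij by (simp add: Bij_def bij_betw_def)
    have "restrict (inv_into (mspace X) f) (mspace X) ` F = inv_into (mspace X) f ` (f ` F)"
      using assms fF by (auto simp: image_def subset_iff)
    also have "\<dots> = F"
      using inv_into_image_cancel[OF inj assms] .
    finally show "inv\<^bsub>BijGroup (mspace X)\<^esub> f \<in> Iso_stab X F"
      using f inv_Iso by (auto simp: inv_BijGroup[OF bij] Iso_stab_def)
  qed
  then show ?thesis
    unfolding Iso_group_def
    by (rule group.subgroup_incl[OF group_BijGroup _ subgroup_Iso]) (auto simp: Iso_stab_def)
qed

lemma group_Iso_stab_group: "F \<subseteq> mspace X \<Longrightarrow> group (Iso_stab_group X F)"
  unfolding Iso_stab_group_def
  by (rule subgroup.subgroup_is_group[OF subgroup_Iso_stab group_Iso_group])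


section \<open>The Urysohn space\<close>

text \<open>Quantifying over metrics on finite subsets of \<^typ>\<open>nat\<close> covers all finite metric
  spaces; see the lemma \<open>finitely_injective_extension\<close> below. The subspace may be empty,
  so a finitely injective space is nonempty.\<close>

definition finitely_injective :: "'a metric \<Rightarrow> bool"
  where "finitely_injective X \<longleftrightarrow>
    (\<forall>(L :: nat metric) K f.
       finite (mspace L) \<and> K \<subseteq> mspace L \<and> isometric_map (submetric L K) X f \<longrightarrow>
       (\<exists>g. isometric_map L X g \<and> (\<forall>x \<in> K. g x = f x)))"

definition urysohn_space :: "'a metric \<Rightarrow> bool"
  where "urysohn_space U \<longleftrightarrow>
    mcomplete_of U \<and> separable_space (mtopology_of U) \<and> finitely_injective U"

lemma finitely_injective_extension:
  fixes L :: "'b metric"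
  assumes X: "finitely_injective X" and fin: "finite (mspace L)" and K: "K \<subseteq> mspace L"
    and f: "isometric_map (submetric L K) X f"
  shows "\<exists>g. isometric_map L X g \<and> (\<forall>x \<in> K. g x = f x)"
proof -
  obtain e :: "'b \<Rightarrow> nat" where e: "inj_on e (mspace L)"
    using fin finite_imp_inj_to_nat_seg by blast
  define i where "i = inv_into (mspace L) e"
  have ie: "i (e x) = x" if "x \<in> mspace L" for x
    using that e by (simp add: i_def)
  define N where "N = e ` mspace L"
  define d where "d = (\<lambda>m n. mdist L (i m) (i n))"
  interpret N: Metric_space N d
    by unfold_locales (auto simp: N_def d_def ie mdist_commute mdist_triangle)
  define L' where "L' = metric (N, d)"
  have L': "mspace L' = N" "mdist L' = d"
    by (simp_all add: L'_def)
  have eK: "e ` K \<subseteq> N" "finite N"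
    using K fin by (auto simp: N_def)
  have "isometric_map (submetric L' (e ` K)) X (f \<circ> i)"
    using f K ie by (auto simp: isometric_map_def L' d_def Pi_iff subset_iff)
  then obtain g where g: "isometric_map L' X g" "\<forall>n \<in> e ` K. g n = (f \<circ> i) n"
    using X eK unfolding finitely_injective_def by (metis L'(1))
  have "isometric_map L X (g \<circ> e)"
    using g(1) by (auto simp: isometric_map_def L' d_def ie Pi_iff N_def)
  moreover have "\<forall>x \<in> K. (g \<circ> e) x = f x"
    using g(2) K ie by (auto simp: subset_iff)
  ultimately show ?thesis by blast
qed

end

theory Submission
  imports Defs
begin

text \<open>Let \<open>d \<le> 1\<close> be a compatible left-invariant metric on \<open>G\<close>. A left-invariant metric \<open>D\<close> on
  \<open>G \<times> \<nat>\<close> is built one layer \<open>G \<times> {n}\<close> at a time: the new point \<open>(1, n)\<close> realises a Katetov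
  function \<open>x \<mapsto> min\<^sub>s (r\<^sub>s + D s x)\<close> with finite support in the earlier layers, and its orbit
  realises the translates. Every rational Katetov function on a finite subset of a countable dense part
  is treated, so \<open>G \<times> \<nat>\<close> embeds isometrically and densely into \<open>\<bbbU>\<close> by a back-and-forth
  argument, and left translation extends to an action of \<open>G\<close> on \<open>\<bbbU>\<close>.

  Infinitely many layers are markers: all \<open>r\<^sub>s\<close> equal a constant \<open>c\<^sub>n\<close> that is huge compared
  with the distances occurring before stage \<open>n\<close>. The set \<open>F\<close> is the closure of the marker layers. A
  marker over \<open>{z}\<close> records the distance to \<open>z\<close>, so a point of \<open>\<bbbU>\<close> is determined by its
  distances to \<open>F\<close>. Because of the sizes of the \<open>c\<^sub>n\<close>, an isometry of \<open>F\<close> preserves every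
  marker layer, and markers over finite sets force it to act on all layers by approximately the same
  element \<open>h\<^sub>i\<close> of \<open>G\<close>. The \<open>h\<^sub>i\<close> form a Cauchy sequence for the two-sided uniformity, which is
  complete since \<open>G\<close> is Polish, so the isometry is the action of their limit.\<close>

section \<open>Left-invariant metrics on topological groups\<close>

text \<open>Two obstacles shape the proof. A left-invariant metric on a Polish group need not be
  complete, so the closure of a layer in U may contain points outside the image of G, and an
  isometry of F might a priori move a base point to such a limit. Statements about isometries of F
  are therefore first proved up to small errors, with approximating elements \<open>h i\<close>.
  Convergence of the images of one base point makes \<open>h i\<close> Cauchy; surjectivity of the
  isometry, through a preimage of the base point, makes \<open>inv (h i)\<close> Cauchy. Both are
  needed to find a limit inside G. The other obstacle is to extend the action to U. Adding a whole
  orbit at each step keeps every stage invariant under left translation, so that density and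
  completeness suffice for the extension. All layers stay uniformly equivalent to G, so the motion
  of a single point of F recovers the topology of G. Tasks recur infinitely often, because supports
  must lie in layers built already and because comparing two points by a marker needs a marker later
  than both.\<close>

text \<open>The pivot is the entry at which the prefix weights first reach \<open>c\<close>:
  everything before it weighs less than \<open>c\<close>, and since the total is below
  \<open>c + c\<close>, so does everything after it. This is the halving step of the chain argument
  below.\<close>

lemma list_split_weight:
  fixes w :: "'a \<Rightarrow> real"
  assumes "sum_list (map w xs) < c + c" "0 < c" "xs \<noteq> []" and nonneg: "\<And>x. 0 \<le> w x"
  shows "\<exists>ys x zs. xs = ys @ x # zs \<and> sum_list (map w ys) < c \<and> sum_list (map w zs) < c"
proof (cases xs rule: rev_cases)
  case Nil
  then show ?thesis using assms(3) by simp
next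
  case (snoc us x)
  have lt: "sum_list (map w (us @ [x])) < c + c" using assms(1) snoc by simp
  have "\<exists>ys y zs. us @ [x] = ys @ y # zs \<and> sum_list (map w ys) < c \<and> sum_list (map w zs) < c"
  proof (cases "sum_list (map w us) < c")
    case True
    then show ?thesis
      using \<open>0 < c\<close> by (intro exI[of _ us] exI[of _ x] exI[of _ "[]"]) simp
  next
    case False
    define j where "j = (LEAST j. c \<le> sum_list (map w (take j us)))"
    have ex: "c \<le> sum_list (map w (take (length us) us))" using False by simp
    have j: "c \<le> sum_list (map w (take j us))" unfolding j_def by (rule LeastI, rule ex)
    have jle: "j \<le> length us" unfolding j_def by (rule Least_le, rule ex)
    have "j \<noteq> 0" using j \<open>0 < c\<close> by (metis list.map(1) not_less sum_list.Nil take_0)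
    then obtain i where i: "j = Suc i" by (cases j) auto
    have "\<not> c \<le> sum_list (map w (take i us))"
      using not_less_Least[of i "\<lambda>j. c \<le> sum_list (map w (take j us))"] i unfolding j_def by auto
    moreover have "sum_list (map w (drop j us @ [x])) < c"
    proof -
      have "sum_list (map w (take j us)) + sum_list (map w (drop j us)) = sum_list (map w us)"
        by (metis append_take_drop_id map_append sum_list_append)
      then show ?thesis using j lt by simp
    qed
    moreover have "us @ [x] = take i us @ us ! i # (drop j us @ [x])"
      using jle i by (simp add: Suc_le_eq id_take_nth_drop)
    ultimately show ?thesis by (metis not_le)
  qed
  then show ?thesis using snoc by simp
qed

text \<open>The chain lemma of Birkhoff and Kakutani, by induction on the length: split the chain at
  a pivot into two parts of less than half the allowed weight. Both parts and the pivot then lie in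
  \<open>V (Suc n)\<close>, and \<open>cube\<close> absorbs the three factors into
  \<open>V n\<close>.\<close>

lemma (in group) chain_in_nbhd:
  assumes carr: "\<And>n. V n \<subseteq> carrier G" and one: "\<And>n. \<one> \<in> V n"
    and cube: "\<And>n x y z. \<lbrakk>x \<in> V (Suc n); y \<in> V (Suc n); z \<in> V (Suc n)\<rbrakk> \<Longrightarrow> x \<otimes> y \<otimes> z \<in> V n"
    and "\<forall>(x, n) \<in> set xs. x \<in> V n" "(\<Sum>(x, n)\<leftarrow>xs. (1/2::real) ^ n) < (1/2) ^ n"
  shows "foldr (\<lambda>(x, n) y. x \<otimes> y) xs \<one> \<in> V n"
  using assms(4-5)
proof (induction "length xs" arbitrary: xs n rule: less_induct)
  case less
  show ?case
  proof (cases "xs = []")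
    case True
    then show ?thesis using one by simp
  next
    case False
    let ?w = "\<lambda>(x::'a, n). (1/2::real) ^ n"
    let ?P = "\<lambda>xs. foldr (\<lambda>(x, n) y. x \<otimes> y) xs \<one>"
    have anti: "V (Suc k) \<subseteq> V k" for k
      using cube[of _ k \<one> \<one>] one[of "Suc k"] carr[of "Suc k"] by (auto simp: subset_iff)
    have anti': "V l \<subseteq> V k" if "k \<le> l" for k l
      by (rule lift_Suc_antimono_le[of V]) (use anti that in auto)
    have half: "(1/2::real) ^ n = (1/2) ^ Suc n + (1/2) ^ Suc n" by simp
    obtain ys x zs where s: "xs = ys @ x # zs"
      "sum_list (map ?w ys) < (1/2) ^ Suc n" "sum_list (map ?w zs) < (1/2) ^ Suc n"
      using list_split_weight[of ?w xs "(1/2) ^ Suc n"] less.prems(2) False unfolding half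
      by (auto simp: case_prod_unfold)
    obtain a k where x: "x = (a, k)" by (cases x)
    have ys: "?P ys \<in> V (Suc n)" using less.hyps[of ys "Suc n"] s less.prems(1) by auto
    have zs: "?P zs \<in> V (Suc n)" using less.hyps[of zs "Suc n"] s less.prems(1) by auto
    have nn: "0 \<le> sum_list (map ?w us)" for us :: "('a \<times> nat) list"
      by (rule sum_list_nonneg) auto
    \<comment> \<open>The weight of the pivot alone is below \<open>(1/2) ^ n\<close>; being a power
      of 1/2 it is at most \<open>(1/2) ^ Suc n\<close>, which puts the pivot into
      \<open>V (Suc n)\<close>.\<close>
    have "n < k"
    proof (rule ccontr)
      assume "\<not> n < k"
      then have "(1/2::real) ^ n \<le> (1/2) ^ k" by (intro power_decreasing) auto
      moreover have "(1/2) ^ k \<le> sum_list (map ?w xs)"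
        using nn[of ys] nn[of zs] unfolding s(1) x by simp
      ultimately show False using less.prems(2) by linarith
    qed
    then have a: "a \<in> V (Suc n)" using anti'[of "Suc n" k] less.prems(1) s(1) x by auto
    have P: "?P (us @ vs) = ?P us \<otimes> ?P vs" if "\<forall>(x, n) \<in> set (us @ vs). x \<in> V n" for us vs
    proof -
      have c: "?P us \<in> carrier G" if "\<forall>(x, n) \<in> set us. x \<in> V n" for us
        using that by (induction us) (use carr in \<open>auto simp: subset_iff\<close>)
      show ?thesis using that
      proof (induction us)
        case Nil
        then show ?case using c by simp
      next
        case (Cons u us)
        then show ?case using c[of us] c[of vs] carr by (auto simp: m_assoc subset_iff split: prod.splits)
      qed
    qed
    have "?P xs = ?P ys \<otimes> (a \<otimes> ?P zs)"
      using P[of ys "x # zs"] less.prems(1) unfolding s(1) by (simp add: x)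
    also have "\<dots> = ?P ys \<otimes> a \<otimes> ?P zs"
      using ys zs a carr[of "Suc n"] by (simp add: m_assoc subset_iff)
    finally show ?thesis using cube[OF ys a zs] by simp
  qed
qed

text \<open>A group seminorm with values in [0,1]. That only \<open>\<one>\<close> has length 0 is a
  matter of the topology and follows from the T1 property in
  \<open>birkhoff_kakutani\<close>.\<close>

definition (in group) length_function :: "('a \<Rightarrow> real) \<Rightarrow> bool"
  where "length_function N \<longleftrightarrow>
    (\<forall>g. 0 \<le> N g \<and> N g \<le> 1) \<and> N \<one> = 0 \<and> (\<forall>g \<in> carrier G. N (inv g) = N g) \<and>
    (\<forall>g \<in> carrier G. \<forall>h \<in> carrier G. N (g \<otimes> h) \<le> N g + N h)"

text \<open>\<open>N g\<close> is the infimum of the weights of all chains with product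
  \<open>g\<close>. Reversing and inverting chains gives symmetry, concatenation gives
  subadditivity, one-element chains give the upper bound on \<open>V n\<close>, and
  \<open>chain_in_nbhd\<close> gives the lower bound.\<close>

lemma (in group) length_function_of_nbhds:
  assumes carr: "\<And>n. V n \<subseteq> carrier G" and one: "\<And>n. \<one> \<in> V n"
    and inv: "\<And>n x. x \<in> V n \<Longrightarrow> inv x \<in> V n"
    and cube: "\<And>n x y z. \<lbrakk>x \<in> V (Suc n); y \<in> V (Suc n); z \<in> V (Suc n)\<rbrakk> \<Longrightarrow> x \<otimes> y \<otimes> z \<in> V n"
  shows "\<exists>N. length_function N \<and> (\<forall>n. V n \<subseteq> {g. N g \<le> (1/2) ^ n}) \<and>
    (\<forall>n. {g \<in> carrier G. N g < (1/2) ^ n} \<subseteq> V n)"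
proof -
  let ?w = "\<lambda>xs :: ('a \<times> nat) list. \<Sum>(x, n)\<leftarrow>xs. (1/2::real) ^ n"
  let ?P = "\<lambda>xs. foldr (\<lambda>(x, n :: nat) y. x \<otimes> y) xs \<one>"
  define C where "C = {xs :: ('a \<times> nat) list. \<forall>(x, n) \<in> set xs. x \<in> V n}"
  \<comment> \<open>The extra element 1 caps \<open>N\<close> and keeps the set nonempty when
    \<open>g\<close> is not a product of elements of the \<open>V n\<close>.\<close>
  define A where "A g = insert 1 {?w xs | xs. xs \<in> C \<and> ?P xs = g}" for g
  define N where "N g = Inf (A g)" for g
  have w0: "0 \<le> ?w xs" for xs by (rule sum_list_nonneg) auto
  have A0: "0 \<le> r" if "r \<in> A g" for r g using that w0 by (auto simp: A_def)
  have bdd: "bdd_below (A g)" for g using A0 by (meson bdd_belowI)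
  have ne: "A g \<noteq> {}" for g by (simp add: A_def)
  have le: "N g \<le> r" if "r \<in> A g" for r g
    unfolding N_def by (rule cInf_lower[OF that bdd])
  have nonneg: "0 \<le> N g" for g
    unfolding N_def by (rule cInf_greatest[OF ne A0])
  have le1: "N g \<le> 1" for g by (rule le) (simp add: A_def)
  have approx: "\<exists>xs \<in> C. ?P xs = g \<and> ?w xs < r" if lt: "N g < r" and r: "r \<le> 1" for g r
  proof -
    obtain s where "s \<in> A g" "s < r"
      using cInf_lessD[OF ne lt[unfolded N_def]] by blast
    then show ?thesis using r by (auto simp: A_def)
  qed
  have Pc: "?P xs \<in> carrier G" if "xs \<in> C" for xs
    using that unfolding C_def by (induction xs) (use carr in \<open>auto simp: subset_iff\<close>)
  have wle: "N (?P xs) \<le> ?w xs" if "xs \<in> C" for xs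
    by (rule le) (use that in \<open>auto simp: A_def\<close>)
  have Papp: "?P (us @ vs) = ?P us \<otimes> ?P vs" if "us \<in> C" "vs \<in> C" for us vs
    using that(1)
  proof (induction us)
    case Nil
    then show ?case using Pc[OF that(2)] by simp
  next
    case (Cons u us)
    then have us: "us \<in> C" "fst u \<in> carrier G" using carr by (auto simp: C_def subset_iff)
    then show ?case using Cons.IH Pc[OF us(1)] Pc[OF that(2)]
      by (auto simp: m_assoc split: prod.splits)
  qed
  have inv_le: "N (inv g) \<le> N g" if g: "g \<in> carrier G" for g
  proof (rule field_le_epsilon)
    fix e :: real assume "0 < e"
    show "N (inv g) \<le> N g + e"
    \<comment> \<open>\<open>approx\<close> yields a chain only for thresholds up to the cap 1;
      above it the bound \<open>le1\<close> is enough.\<close>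
    proof (cases "N g + e \<le> 1")
      case True
      then obtain xs where xs: "xs \<in> C" "?P xs = g" "?w xs < N g + e"
        using approx[of g "N g + e"] \<open>0 < e\<close> by auto
      define ys where "ys = rev (map (\<lambda>(x, n). (inv x, n)) xs)"
      have ys: "ys \<in> C" using xs(1) inv by (auto simp: C_def ys_def)
      have "?w ys = ?w xs"
        by (simp add: ys_def rev_map[symmetric] o_def case_prod_unfold)
      moreover have "?P ys = inv (?P xs)"
        using xs(1) unfolding ys_def
      proof (induction xs)
        case Nil
        then show ?case by simp
      next
        case (Cons u us)
        obtain x n where u: "u = (x, n)" by (cases u)
        have us: "us \<in> C" and x: "x \<in> V n" using Cons.prems u by (auto simp: C_def)
        have r: "rev (map (\<lambda>(x, n). (inv x, n)) us) \<in> C" "[(inv x, n)] \<in> C"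
          using us x inv by (auto simp: C_def)
        have xc: "x \<in> carrier G" using x carr by auto
        show ?case using Papp[OF r] Cons.IH[OF us] Pc[OF us] xc
          by (simp add: u inv_mult_group)
      qed
      ultimately show ?thesis using wle[OF ys] xs by simp
    next
      case False
      then show ?thesis using le1[of "inv g"] by linarith
    qed
  qed
  have "N \<one> \<le> 0" using wle[of "[]"] by (simp add: C_def)
  then have "N \<one> = 0" using nonneg[of \<one>] by simp
  moreover have "N (inv g) = N g" if "g \<in> carrier G" for g
      using inv_le[OF that] inv_le[of "inv g"] that by simp
  moreover have "N (g \<otimes> h) \<le> N g + N h" if gh: "g \<in> carrier G" "h \<in> carrier G" for g h
    proof (rule field_le_epsilon)
      fix e :: real assume "0 < e"
      show "N (g \<otimes> h) \<le> N g + N h + e"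
      proof (cases "N g + N h + e \<le> 1")
        case True
        obtain xs where xs: "xs \<in> C" "?P xs = g" "?w xs < N g + e/2"
          using approx[of g "N g + e/2"] \<open>0 < e\<close> True nonneg[of h] by auto
        obtain ys where ys: "ys \<in> C" "?P ys = h" "?w ys < N h + e/2"
          using approx[of h "N h + e/2"] \<open>0 < e\<close> True nonneg[of g] by auto
        have "xs @ ys \<in> C" using xs ys by (auto simp: C_def)
        from wle[OF this] show ?thesis using Papp[OF xs(1) ys(1)] xs ys by simp
      next
        case False
        then show ?thesis using le1[of "g \<otimes> h"] by linarith
      qed
    qed
  ultimately have "length_function N" using nonneg le1 by (simp add: length_function_def)
  moreover have "N g \<le> (1/2) ^ n" if "g \<in> V n" for n g
      using wle[of "[(g, n)]"] that carr[of n] by (auto simp: C_def)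
  moreover have "g \<in> V n" if g: "g \<in> carrier G" "N g < (1/2) ^ n" for n g
    proof -
      obtain xs where "xs \<in> C" "?P xs = g" "?w xs < (1/2) ^ n"
        using approx[OF g(2)] by (auto simp: power_le_one)
      then show ?thesis using chain_in_nbhd[of V xs n] carr one cube by (auto simp: C_def)
    qed
  ultimately show ?thesis by blast
qed

context topological_group
begin

lemma continuous_map_mult:
  assumes "continuous_map X T f" "continuous_map X T g"
  shows "continuous_map X T (\<lambda>x. f x \<otimes> g x)"
proof -
  have "continuous_map X (prod_topology T T) (\<lambda>x. (f x, g x))"
    using assms by (simp add: continuous_map_paired)
  from continuous_map_compose[OF this continuous_mult] show ?thesis
    by (simp add: o_def)
qed

lemma continuous_map_left_mult: "a \<in> carrier G \<Longrightarrow> continuous_map T T (\<lambda>x. a \<otimes> x)"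
  and continuous_map_right_mult: "a \<in> carrier G \<Longrightarrow> continuous_map T T (\<lambda>x. x \<otimes> a)"
  using continuous_map_mult[of T "\<lambda>_. a" "\<lambda>x. x"] continuous_map_mult[of T "\<lambda>x. x" "\<lambda>_. a"]
  by (simp_all add: topspace_eq_carrier)

lemma mult_nbhds:
  assumes "openin T W" "a \<in> carrier G" "b \<in> carrier G" "a \<otimes> b \<in> W"
  shows "\<exists>A B. openin T A \<and> a \<in> A \<and> openin T B \<and> b \<in> B \<and> (\<forall>x \<in> A. \<forall>y \<in> B. x \<otimes> y \<in> W)"
proof -
  have "openin (prod_topology T T) {p \<in> topspace (prod_topology T T). (\<lambda>(x, y). x \<otimes> y) p \<in> W}"
    using continuous_mult assms(1) by (rule openin_continuous_map_preimage)
  moreover have "(a, b) \<in> {p \<in> topspace (prod_topology T T). (\<lambda>(x, y). x \<otimes> y) p \<in> W}"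
    using assms by (simp add: topspace_eq_carrier)
  ultimately obtain A B where "openin T A" "a \<in> A" "openin T B" "b \<in> B"
    "A \<times> B \<subseteq> {p \<in> topspace (prod_topology T T). (\<lambda>(x, y). x \<otimes> y) p \<in> W}"
    unfolding openin_prod_topology_alt by meson
  then show ?thesis by (intro exI[of _ A] exI[of _ B]) auto
qed

lemma symmetric_cube_nbhd:
  assumes "openin T W" "\<one> \<in> W"
  shows "\<exists>V. openin T V \<and> \<one> \<in> V \<and> (\<forall>x \<in> V. inv x \<in> V) \<and>
    (\<forall>x \<in> V. \<forall>y \<in> V. \<forall>z \<in> V. x \<otimes> y \<otimes> z \<in> W)"
proof -
  obtain A B where A: "openin T A" "\<one> \<in> A" "openin T B" "\<one> \<in> B" "\<forall>x \<in> A. \<forall>y \<in> B. x \<otimes> y \<in> W"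
    using mult_nbhds[OF assms(1) one_closed one_closed] assms(2) by force
  obtain C E where C: "openin T C" "\<one> \<in> C" "openin T E" "\<one> \<in> E" "\<forall>x \<in> C. \<forall>y \<in> E. x \<otimes> y \<in> A"
    using mult_nbhds[OF A(1) one_closed one_closed] A(2) by force
  define D where "D = B \<inter> C \<inter> E"
  define V where "V = D \<inter> {x \<in> topspace T. inv x \<in> D}"
  have D: "openin T D" "\<one> \<in> D" using A(3,4) C(1-4) by (auto simp: D_def)
  have "openin T V"
    unfolding V_def by (intro openin_Int D openin_continuous_map_preimage[OF continuous_inv])
  moreover have "\<one> \<in> V" using D by (simp add: V_def topspace_eq_carrier)
  moreover have "\<forall>x \<in> V. inv x \<in> V"
    by (auto simp: V_def topspace_eq_carrier)
  moreover have "\<forall>x \<in> V. \<forall>y \<in> V. \<forall>z \<in> V. x \<otimes> y \<otimes> z \<in> W"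
    using A(5) C(5) by (simp add: V_def D_def)
  ultimately show ?thesis by blast
qed

text \<open>Metrizability supplies the balls of radius \<open>(1/2) ^ n\<close> as a countable base
  at \<open>\<one>\<close>. Dependent choice shrinks them to symmetric neighbourhoods with
  \<open>V (Suc n)\<close> cubed inside \<open>V n\<close>, which form a base as well.\<close>

lemma compatible_length_function:
  assumes "metrizable_space T"
  shows "\<exists>N. length_function N \<and>
    (\<forall>W. openin T W \<and> \<one> \<in> W \<longrightarrow> (\<exists>e>0. {g \<in> carrier G. N g < e} \<subseteq> W)) \<and>
    (\<forall>e>0. \<exists>W. openin T W \<and> \<one> \<in> W \<and> W \<subseteq> {g. N g < e})"
proof -
  obtain M \<rho> where M: "Metric_space M \<rho>" and T: "T = Metric_space.mtopology M \<rho>"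
    using assms unfolding metrizable_space_def by blast
  interpret M: Metric_space M \<rho> by (rule M)
  have Mc: "M = carrier G" using topspace_eq_carrier T by simp
  define P where "P n V \<longleftrightarrow> openin T V \<and> \<one> \<in> V \<and> (\<forall>x \<in> V. inv x \<in> V) \<and>
    V \<subseteq> M.mball \<one> ((1/2) ^ n)" for n :: nat and V
  have step: "\<exists>V'. P n V' \<and> (\<forall>x\<in>V'. \<forall>y\<in>V'. \<forall>z\<in>V'. x \<otimes> y \<otimes> z \<in> V)"
    if V: "openin T V" "\<one> \<in> V" for V n
  proof -
    have "openin T (V \<inter> M.mball \<one> ((1/2) ^ n))" "\<one> \<in> V \<inter> M.mball \<one> ((1/2) ^ n)"
      using V one_closed unfolding Mc[symmetric] T by (auto intro!: openin_Int)
    then obtain V' where V': "openin T V'" "\<one> \<in> V'" "\<forall>x \<in> V'. inv x \<in> V'"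
      "\<forall>x \<in> V'. \<forall>y \<in> V'. \<forall>z \<in> V'. x \<otimes> y \<otimes> z \<in> V \<inter> M.mball \<one> ((1/2) ^ n)"
      using symmetric_cube_nbhd by meson
    have "V' \<subseteq> M.mball \<one> ((1/2) ^ n)"
    proof
      fix x assume x: "x \<in> V'"
      then have "x \<otimes> \<one> \<otimes> \<one> \<in> M.mball \<one> ((1/2) ^ n)" using V'(2,4) by blast
      moreover have "x \<in> carrier G" using x openin_subset[OF V'(1)] topspace_eq_carrier by blast
      ultimately show "x \<in> M.mball \<one> ((1/2) ^ n)" by simp
    qed
    then have "P n V'" using V'(1-3) by (simp add: P_def)
    moreover have "\<forall>x \<in> V'. \<forall>y \<in> V'. \<forall>z \<in> V'. x \<otimes> y \<otimes> z \<in> V" using V'(4) by blast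
    ultimately show ?thesis by blast
  qed
  have "\<exists>f. \<forall>n. P n (f n) \<and> (\<forall>x\<in>f (Suc n). \<forall>y\<in>f (Suc n). \<forall>z\<in>f (Suc n). x \<otimes> y \<otimes> z \<in> f n)"
  proof (rule dependent_nat_choice)
    show "\<exists>V. P 0 V" using step[of "carrier G" 0] openin_topspace[of T] unfolding topspace_eq_carrier by blast
    show "\<exists>y. P (Suc n) y \<and> (\<forall>u\<in>y. \<forall>v\<in>y. \<forall>w\<in>y. u \<otimes> v \<otimes> w \<in> x)" if "P n x" for n x
      using that step[of x "Suc n"] unfolding P_def by blast
  qed
  then obtain V where V: "\<And>n. P n (V n)"
    "\<And>n x y z. \<lbrakk>x \<in> V (Suc n); y \<in> V (Suc n); z \<in> V (Suc n)\<rbrakk> \<Longrightarrow> x \<otimes> y \<otimes> z \<in> V n" by blast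
  have Vc: "V n \<subseteq> carrier G" for n
    using V(1)[of n] openin_subset[of T "V n"] unfolding P_def topspace_eq_carrier by blast
  have V1: "\<one> \<in> V n" "x \<in> V n \<Longrightarrow> inv x \<in> V n" for n x using V(1)[of n] unfolding P_def by auto
  obtain N where N: "length_function N" "\<And>n. V n \<subseteq> {g. N g \<le> (1/2) ^ n}"
    "\<And>n. {g \<in> carrier G. N g < (1/2) ^ n} \<subseteq> V n"
    using length_function_of_nbhds[of V, OF Vc V1(1) V1(2) V(2)] by auto
  show ?thesis
  proof (intro exI[of _ N] conjI allI impI; (elim conjE)?)
    show "length_function N" by (fact N(1))
    show "\<exists>e>0. {g \<in> carrier G. N g < e} \<subseteq> W" if W: "openin T W" "\<one> \<in> W" for W
    proof -
      obtain r where r: "r > 0" "M.mball \<one> r \<subseteq> W" using W unfolding T M.openin_mtopology by blast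
      obtain n where n: "(1/2::real) ^ n < r" using real_arch_pow_inv[OF r(1), of "1/2"] by auto
      have "{g \<in> carrier G. N g < (1/2) ^ n} \<subseteq> V n" by (rule N(3))
      also have "\<dots> \<subseteq> M.mball \<one> r"
        using V(1)[of n] M.mball_subset_concentric[of "(1/2)^n" r] n unfolding P_def by force
      finally show ?thesis using r by (intro exI[of _ "(1/2)^n"]) auto
    qed
    show "\<exists>W. openin T W \<and> \<one> \<in> W \<and> W \<subseteq> {g. N g < e}" if e: "0 < e" for e
    proof -
      obtain n where n: "(1/2::real) ^ n < e" using real_arch_pow_inv[OF e, of "1/2"] by auto
      have "V n \<subseteq> {g. N g < e}" using N(2)[of n] n by fastforce
      then show ?thesis using V(1)[of n] unfolding P_def by blast
    qed
  qed
qed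

text \<open>The metric is the length of \<open>inv g \<otimes> h\<close>. Its balls around
  \<open>x\<close> are left translates of those around \<open>\<one>\<close>, so continuity of left
  translations carries the comparison of topologies from \<open>\<one>\<close> to every
  point.\<close>

theorem birkhoff_kakutani:
  assumes "metrizable_space T"
  shows "\<exists>d. Metric_space (carrier G) d \<and> T = Metric_space.mtopology (carrier G) d \<and>
    (\<forall>g h. d g h \<le> 1) \<and>
    (\<forall>a \<in> carrier G. \<forall>g \<in> carrier G. \<forall>h \<in> carrier G. d (a \<otimes> g) (a \<otimes> h) = d g h)"
proof -
  obtain N where lf: "length_function N" and
    N6: "\<forall>W. openin T W \<and> \<one> \<in> W \<longrightarrow> (\<exists>e>0. {g \<in> carrier G. N g < e} \<subseteq> W)" and
    N7: "\<forall>e>0. \<exists>W. openin T W \<and> \<one> \<in> W \<and> W \<subseteq> {g. N g < e}"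
    using compatible_length_function[OF assms] by blast
  have N: "\<And>g. 0 \<le> N g" "\<And>g. N g \<le> 1" "N \<one> = 0"
    "\<And>g. g \<in> carrier G \<Longrightarrow> N (inv g) = N g"
    "\<And>g h. \<lbrakk>g \<in> carrier G; h \<in> carrier G\<rbrakk> \<Longrightarrow> N (g \<otimes> h) \<le> N g + N h"
    using lf unfolding length_function_def by simp_all
  \<comment> \<open>The value 0 outside the carrier secures nonnegativity and symmetry there, which
    \<open>Metric_space\<close> asks for on the whole type.\<close>
  define d where "d g h = (if g \<in> carrier G \<and> h \<in> carrier G then N (inv g \<otimes> h) else 0)" for g h
  have pos: "g = \<one>" if g: "g \<in> carrier G" "N g = 0" for g
  proof (rule ccontr)
    assume "g \<noteq> \<one>"
    have "\<forall>x\<in>carrier G. \<forall>y\<in>carrier G. x \<noteq> y \<longrightarrow> (\<exists>U. openin T U \<and> x \<in> U \<and> y \<notin> U)"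
      using metrizable_imp_t1_space[OF assms] unfolding t1_space_def topspace_eq_carrier .
    with \<open>g \<noteq> \<one>\<close> g(1) one_closed obtain U where U: "openin T U" "\<one> \<in> U" "g \<notin> U" by metis
    then obtain e where "e > 0" "{g \<in> carrier G. N g < e} \<subseteq> U" using N6 by metis
    then show False using U g by auto
  qed
  have cancel: "inv x \<otimes> (x \<otimes> y) = y" "x \<otimes> (inv x \<otimes> y) = y" if "x \<in> carrier G" "y \<in> carrier G" for x y
    using that by (simp_all add: m_assoc[symmetric])
  have M: "Metric_space (carrier G) d"
  proof
    show "d x y = d y x" for x y
      using N(4)[of "inv x \<otimes> y"] by (cases "x \<in> carrier G \<and> y \<in> carrier G") (auto simp: d_def inv_mult_group)
    show "d x y = 0 \<longleftrightarrow> x = y" if "x \<in> carrier G" "y \<in> carrier G" for x y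
      using pos[of "inv x \<otimes> y"] cancel(2)[OF that] that N(3) by (auto simp: d_def)
    show "d x z \<le> d x y + d y z" if "x \<in> carrier G" "y \<in> carrier G" "z \<in> carrier G" for x y z
    proof -
      have "inv x \<otimes> z = (inv x \<otimes> y) \<otimes> (inv y \<otimes> z)"
        using that by (simp add: m_assoc cancel)
      then show ?thesis using N(5)[of "inv x \<otimes> y" "inv y \<otimes> z"] that by (simp add: d_def)
    qed
  qed (auto simp: d_def N(1))
  interpret Metric_space "carrier G" d by (rule M)
  have "openin T U \<longleftrightarrow> openin mtopology U" for U
  proof
    assume U: "openin T U"
    then have sub: "U \<subseteq> carrier G" using openin_subset topspace_eq_carrier by blast
    moreover have "\<exists>r>0. mball x r \<subseteq> U" if x: "x \<in> U" for x
    proof -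
      have xc: "x \<in> carrier G" using x sub by auto
      have "openin T {y \<in> topspace T. x \<otimes> y \<in> U}"
        by (rule openin_continuous_map_preimage[OF continuous_map_left_mult[OF xc] U])
      then obtain e where e: "e > 0" "{g \<in> carrier G. N g < e} \<subseteq> {y \<in> topspace T. x \<otimes> y \<in> U}"
        using N6[rule_format, of "{y \<in> topspace T. x \<otimes> y \<in> U}"] x xc
        by (auto simp: topspace_eq_carrier)
      have "mball x e \<subseteq> U"
      proof
        fix y assume y: "y \<in> mball x e"
        then have "inv x \<otimes> y \<in> {g \<in> carrier G. N g < e}" using xc by (auto simp: d_def split: if_splits)
        then have "x \<otimes> (inv x \<otimes> y) \<in> U" using e(2) by blast
        then show "y \<in> U" using y cancel by auto
      qed
      then show ?thesis using e by blast
    qed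
    ultimately show "openin mtopology U" by (simp add: openin_mtopology)
  next
    assume U: "openin mtopology U"
    show "openin T U"
    proof (subst openin_subopen, intro ballI)
      fix x assume x: "x \<in> U"
      then obtain r where r: "r > 0" "mball x r \<subseteq> U" and xc: "x \<in> carrier G"
        using U unfolding openin_mtopology by blast
      obtain W where W: "openin T W" "\<one> \<in> W" "W \<subseteq> {g. N g < r}" using N7 r(1) by blast
      let ?W = "{y \<in> topspace T. inv x \<otimes> y \<in> W}"
      have "openin T ?W"
        using xc by (intro openin_continuous_map_preimage[OF continuous_map_left_mult] W) auto
      moreover have "x \<in> ?W" using xc W by (simp add: topspace_eq_carrier)
      moreover have "?W \<subseteq> U"
      proof
        fix y assume "y \<in> ?W"
        then show "y \<in> U" using W(3) r xc by (auto simp: topspace_eq_carrier d_def subset_iff)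
      qed
      ultimately show "\<exists>Ta. openin T Ta \<and> x \<in> Ta \<and> Ta \<subseteq> U" by blast
    qed
  qed
  then have "T = mtopology" by (simp add: topology_eq)
  moreover have "d (a \<otimes> g) (a \<otimes> h) = d g h" if "a \<in> carrier G" "g \<in> carrier G" "h \<in> carrier G" for a g h
  proof -
    have "inv (a \<otimes> g) \<otimes> (a \<otimes> h) = inv g \<otimes> h"
      using that cancel by (simp add: inv_mult_group m_assoc)
    then show ?thesis using that by (simp add: d_def)
  qed
  ultimately show ?thesis using M N(2) by (intro exI[of _ d]) (auto simp: d_def)
qed

section \<open>Completeness of the two-sided uniformity of a Polish group\<close>

lemma two_sided_Cauchy_converges:
  assumes "completely_metrizable_space T"
    and "Metric_space (carrier G) d" and T: "T = Metric_space.mtopology (carrier G) d"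
    and left: "\<And>a g h. \<lbrakk>a \<in> carrier G; g \<in> carrier G; h \<in> carrier G\<rbrakk> \<Longrightarrow> d (a \<otimes> g) (a \<otimes> h) = d g h"
    and \<sigma>: "\<And>i :: nat. \<sigma> i \<in> carrier G"
    and C1: "\<And>e. e > 0 \<Longrightarrow> \<exists>N. \<forall>i\<ge>N. \<forall>j\<ge>N. d (\<sigma> i) (\<sigma> j) < e"
    and C2: "\<And>e. e > 0 \<Longrightarrow> \<exists>N. \<forall>i\<ge>N. \<forall>j\<ge>N. d (inv (\<sigma> i)) (inv (\<sigma> j)) < e"
  shows "\<exists>g \<in> carrier G. limitin T \<sigma> g sequentially"
proof -
  interpret d: Metric_space "carrier G" d by (rule assms)
  obtain M \<rho> where M: "Metric_space M \<rho>" "Metric_space.mcomplete M \<rho>" "T = Metric_space.mtopology M \<rho>"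
    using assms(1) unfolding completely_metrizable_space_def by blast
  interpret \<rho>: Metric_space M \<rho> by (rule M)
  have Mc: "M = carrier G" using topspace_eq_carrier M(3) by simp
  have ball: "\<exists>r>0. d.mball x r \<subseteq> W" if "openin T W" "x \<in> W" for x W
    using that unfolding T d.openin_mtopology by blast
  have cancel: "inv x \<otimes> (x \<otimes> y) = y" "x \<otimes> (inv x \<otimes> y) = y" if "x \<in> carrier G" "y \<in> carrier G" for x y
    using that by (simp_all add: m_assoc[symmetric])
  \<comment> \<open>A point \<open>g\<close> in all \<open>V n\<close>, which exists by Baire, makes \<open>\<sigma> i \<otimes> g\<close> Cauchy for the complete metric.\<close>
  define V where "V n = {g \<in> carrier G. \<exists>N W. openin T W \<and> g \<in> W \<and>
    (\<forall>g' \<in> W. \<forall>i\<ge>N. \<forall>j\<ge>N. \<rho> (\<sigma> i \<otimes> g') (\<sigma> j \<otimes> g') < 1 / Suc n)}" for n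
  have Vopen: "openin T (V n)" for n
  proof (subst openin_subopen, intro ballI)
    fix g assume "g \<in> V n"
    then obtain N W where W: "openin T W" "g \<in> W"
      "\<forall>g' \<in> W. \<forall>i\<ge>N. \<forall>j\<ge>N. \<rho> (\<sigma> i \<otimes> g') (\<sigma> j \<otimes> g') < 1 / Suc n"
      unfolding V_def by blast
    have "W \<subseteq> V n"
      using W openin_subset[OF W(1)] topspace_eq_carrier unfolding V_def by blast
    with W show "\<exists>W. openin T W \<and> g \<in> W \<and> W \<subseteq> V n" by blast
  qed
  have Vdense: "T closure_of V n = M" for n
  proof -
    have "\<exists>g \<in> V n. g \<in> Z" if Z: "openin T Z" "g0 \<in> Z" for g0 Z
    proof -
      have g0: "g0 \<in> carrier G" using Z openin_subset topspace_eq_carrier by blast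
      have "openin T {h \<in> topspace T. h \<otimes> g0 \<in> Z}"
        by (rule openin_continuous_map_preimage[OF continuous_map_right_mult[OF g0] Z(1)])
      moreover have "\<one> \<in> {h \<in> topspace T. h \<otimes> g0 \<in> Z}" using g0 Z by (simp add: topspace_eq_carrier)
      ultimately obtain r where r: "r > 0" "d.mball \<one> r \<subseteq> {h \<in> topspace T. h \<otimes> g0 \<in> Z}"
        using ball[of "{h \<in> topspace T. h \<otimes> g0 \<in> Z}" \<one>] by blast
      obtain N1 where N1: "\<forall>i\<ge>N1. \<forall>j\<ge>N1. d (\<sigma> i) (\<sigma> j) < r" using C1 r(1) by blast
      \<comment> \<open>The point \<open>p\<close> is fixed before \<open>i\<close>: the
        neighbourhood of \<open>\<one>\<close> that \<open>C2\<close> has to reach depends on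
        \<open>p\<close>.\<close>
      define p where "p = \<sigma> N1 \<otimes> g0"
      have p: "p \<in> carrier G" using \<sigma> g0 by (simp add: p_def)
      let ?Q = "\<rho>.mball p (1 / (2 * Suc n))"
      have "openin T ?Q" "\<one> \<otimes> p \<in> ?Q" using p l_one[OF p] unfolding Mc[symmetric] M(3) by auto
      then obtain A B where AB: "openin T A" "\<one> \<in> A" "openin T B" "p \<in> B" "\<forall>x \<in> A. \<forall>y \<in> B. x \<otimes> y \<in> ?Q"
        using mult_nbhds[OF _ one_closed p] by meson
      obtain \<alpha> where \<alpha>: "\<alpha> > 0" "d.mball \<one> \<alpha> \<subseteq> A" using ball[OF AB(1,2)] by blast
      obtain N2 where N2: "\<forall>i\<ge>N2. \<forall>j\<ge>N2. d (inv (\<sigma> i)) (inv (\<sigma> j)) < \<alpha>" using C2 \<alpha>(1) by blast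
      define i where "i = max N1 N2"
      \<comment> \<open>This choice gives \<open>\<sigma> i \<otimes> g = p\<close>. By
        \<open>C1\<close> it is a small left multiple of \<open>g0\<close>, hence still in
        \<open>Z\<close>; by \<open>C2\<close> the later \<open>\<sigma> k\<close> differ from
        \<open>\<sigma> i\<close> by left factors near \<open>\<one>\<close>, so
        \<open>\<sigma> k \<otimes> g'\<close> stays near \<open>p\<close> for all \<open>g'\<close>
        near \<open>g\<close>.\<close>
      define g where "g = inv (\<sigma> i) \<otimes> p"
      have g: "g \<in> carrier G" using p \<sigma> by (simp add: g_def)
      have "d \<one> (inv (\<sigma> i) \<otimes> \<sigma> N1) < r"
        using N1[rule_format, of i N1] left[of "\<sigma> i" \<one> "inv (\<sigma> i) \<otimes> \<sigma> N1"] \<sigma> cancel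
        by (simp add: i_def)
      then have "inv (\<sigma> i) \<otimes> \<sigma> N1 \<in> d.mball \<one> r" using \<sigma> by simp
      then have "(inv (\<sigma> i) \<otimes> \<sigma> N1) \<otimes> g0 \<in> Z" using r(2) by blast
      then have "g \<in> Z" using \<sigma> g0 by (simp add: g_def p_def m_assoc)
      define W where "W = {g' \<in> topspace T. \<sigma> i \<otimes> g' \<in> B}"
      have W: "openin T W" "g \<in> W"
        unfolding W_def using AB(3) apply (rule openin_continuous_map_preimage[OF continuous_map_left_mult[OF \<sigma>]])
        using g AB(4) cancel(2)[OF \<sigma> p] by (simp add: topspace_eq_carrier g_def)
      have Q: "\<sigma> k \<otimes> g' \<in> ?Q" if "g' \<in> W" "k \<ge> i" for g' k
      proof -
        have g': "g' \<in> carrier G" "\<sigma> i \<otimes> g' \<in> B" using that by (auto simp: W_def topspace_eq_carrier)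
        have "d \<one> (\<sigma> k \<otimes> inv (\<sigma> i)) < \<alpha>"
          using N2[rule_format, of k i] left[of "inv (\<sigma> k)" \<one> "\<sigma> k \<otimes> inv (\<sigma> i)"] \<sigma> cancel that(2)
          by (simp add: i_def)
        then have "\<sigma> k \<otimes> inv (\<sigma> i) \<in> A" using \<sigma> by (intro subsetD[OF \<alpha>(2)]) simp
        then have "(\<sigma> k \<otimes> inv (\<sigma> i)) \<otimes> (\<sigma> i \<otimes> g') \<in> ?Q" using AB(5) g'(2) by blast
        moreover have "(\<sigma> k \<otimes> inv (\<sigma> i)) \<otimes> (\<sigma> i \<otimes> g') = \<sigma> k \<otimes> g'"
          using \<sigma> g' cancel by (simp add: m_assoc)
        ultimately show ?thesis by simp
      qed
      have "\<rho> (\<sigma> k \<otimes> g') (\<sigma> l \<otimes> g') < 1 / Suc n" if "g' \<in> W" "k \<ge> i" "l \<ge> i" for g' k l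
      proof -
        have "\<rho> (\<sigma> k \<otimes> g') (\<sigma> l \<otimes> g') \<le> \<rho> p (\<sigma> k \<otimes> g') + \<rho> p (\<sigma> l \<otimes> g')"
          using Q[OF that(1,2)] Q[OF that(1,3)] by (intro \<rho>.triangle'') auto
        also have "\<dots> < 1 / (2 * Suc n) + 1 / (2 * Suc n)"
          using Q[OF that(1,2)] Q[OF that(1,3)] by (intro add_strict_mono) auto
        finally show ?thesis by (simp add: field_simps)
      qed
      then have "g \<in> V n" using W g unfolding V_def by blast
      with \<open>g \<in> Z\<close> show ?thesis by blast
    qed
    then have "topspace T \<subseteq> T closure_of V n"
      unfolding closure_of_def by auto
    then show ?thesis using closure_of_subset_topspace[of T "V n"] topspace_eq_carrier Mc by auto
  qed
  have "T closure_of (\<Inter>(range V)) = M"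
    using Vopen Vdense unfolding M(3) by (intro \<rho>.metric_Baire_category M(2)) auto
  then have "\<Inter>(range V) \<noteq> {}" using Mc by (metis closure_of_empty empty_iff one_closed)
  then obtain g where g: "\<And>n. g \<in> V n" by blast
  then have gc: "g \<in> carrier G" by (auto simp: V_def)
  have "\<rho>.MCauchy (\<lambda>i. \<sigma> i \<otimes> g)"
    unfolding \<rho>.MCauchy_def
  proof (intro conjI allI impI)
    show "range (\<lambda>i. \<sigma> i \<otimes> g) \<subseteq> M" using \<sigma> gc Mc by auto
    fix e :: real assume "e > 0"
    then obtain n where n: "1 / Suc n < e" using nat_approx_posE by blast
    obtain N W where "g \<in> W" "\<forall>g' \<in> W. \<forall>i\<ge>N. \<forall>j\<ge>N. \<rho> (\<sigma> i \<otimes> g') (\<sigma> j \<otimes> g') < 1 / Suc n"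
      using g[of n] unfolding V_def by blast
    then show "\<exists>N. \<forall>n n'. N \<le> n \<longrightarrow> N \<le> n' \<longrightarrow> \<rho> (\<sigma> n \<otimes> g) (\<sigma> n' \<otimes> g) < e"
      using n by (meson less_trans)
  qed
  then obtain k where k: "limitin T (\<lambda>i. \<sigma> i \<otimes> g) k sequentially"
    using M(2,3) unfolding \<rho>.mcomplete_def by blast
  have kc: "k \<in> carrier G" using limitin_topspace[OF k] topspace_eq_carrier by simp
  have "limitin T ((\<lambda>x. x \<otimes> inv g) \<circ> (\<lambda>i. \<sigma> i \<otimes> g)) (k \<otimes> inv g) sequentially"
    by (rule continuous_map_limit[OF continuous_map_right_mult k]) (simp add: gc)
  moreover have "(\<lambda>x. x \<otimes> inv g) \<circ> (\<lambda>i. \<sigma> i \<otimes> g) = \<sigma>"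
    using \<sigma> gc by (auto simp: m_assoc)
  ultimately have "limitin T \<sigma> (k \<otimes> inv g) sequentially" by simp
  moreover have "k \<otimes> inv g \<in> carrier G" using kc gc by simp
  ultimately show ?thesis by blast
qed

end

text \<open>From here on the topology is expressed through \<open>d\<close>. As left translations
  are isometries, continuity of multiplication survives as \<open>right_mult_continuous\<close> at
  \<open>\<one>\<close>; complete metrizability survives as \<open>two_sided_complete\<close>, while
  \<open>d\<close> itself may be incomplete.\<close>

locale left_invariant_polish = group G + Metric_space "carrier G" d for G (structure) and d +
  fixes H :: "'a set"
  assumes left_invariant: "\<lbrakk>a \<in> carrier G; g \<in> carrier G; h \<in> carrier G\<rbrakk> \<Longrightarrow> d (a \<otimes> g) (a \<otimes> h) = d g h"
    and dist_le_1: "d g h \<le> 1"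
    and right_mult_continuous: "\<lbrakk>a \<in> carrier G; 0 < e\<rbrakk> \<Longrightarrow>
      \<exists>\<delta>>0. \<forall>g \<in> carrier G. d g \<one> < \<delta> \<longrightarrow> d (g \<otimes> a) a < e"
    and H: "countable H" "H \<subseteq> carrier G" "\<one> \<in> H"
    and H_dense: "\<lbrakk>g \<in> carrier G; 0 < e\<rbrakk> \<Longrightarrow> \<exists>h \<in> H. d g h < e"
    and two_sided_complete: "\<lbrakk>MCauchy \<sigma>; MCauchy (\<lambda>i. inv (\<sigma> i))\<rbrakk> \<Longrightarrow> \<exists>g. limitin mtopology \<sigma> g sequentially"

lemma (in polish_group) left_invariant_polish:
  "\<exists>d H. left_invariant_polish G d H \<and> T = Metric_space.mtopology (carrier G) d"
proof -
  have met: "metrizable_space T"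
    using completely_metrizable by (rule completely_metrizable_imp_metrizable_space)
  obtain d where d: "Metric_space (carrier G) d" "T = Metric_space.mtopology (carrier G) d"
    "\<forall>g h. d g h \<le> 1"
    "\<forall>a \<in> carrier G. \<forall>g \<in> carrier G. \<forall>h \<in> carrier G. d (a \<otimes> g) (a \<otimes> h) = d g h"
    using birkhoff_kakutani[OF met] by metis
  interpret Metric_space "carrier G" d by (rule d)
  obtain H where H: "countable H" "H \<subseteq> topspace T" "T closure_of H = topspace T"
    using separable unfolding separable_space_def by blast
  have "left_invariant_polish G d (insert \<one> H)"
  proof
    show "d (a \<otimes> g) (a \<otimes> h) = d g h" if "a \<in> carrier G" "g \<in> carrier G" "h \<in> carrier G" for a g h
      using d(4) that by blast
    show "d g h \<le> 1" for g h using d(3) by blast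
    show "countable (insert \<one> H)" using H by simp
    show "insert \<one> H \<subseteq> carrier G" using H topspace_eq_carrier by blast
    show "\<one> \<in> insert \<one> H" by simp
    show "\<exists>h \<in> insert \<one> H. d g h < e" if "g \<in> carrier G" "0 < e" for g e
    proof -
      have "g \<in> mtopology closure_of H" using H(3) that topspace_eq_carrier d(2) by simp
      then show ?thesis using that(2) unfolding metric_closure_of by fastforce
    qed
    show "\<exists>\<delta>>0. \<forall>g \<in> carrier G. d g \<one> < \<delta> \<longrightarrow> d (g \<otimes> a) a < e" if a: "a \<in> carrier G" and e: "0 < e" for a e
    proof -
      have "continuous_map mtopology mtopology (\<lambda>x. x \<otimes> a)"
        using continuous_map_right_mult[OF a] d(2) by simp
      then have "\<forall>b\<in>carrier G. \<forall>\<epsilon>>0. \<exists>\<delta>>0. \<forall>x. x \<in> carrier G \<and> d b x < \<delta> \<longrightarrow> d (b \<otimes> a) (x \<otimes> a) < \<epsilon>"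
        unfolding metric_continuous_map[OF d(1)] by (rule conjunct2)
      from this[rule_format, OF one_closed e] obtain \<delta> where
        "\<delta> > 0" "\<forall>x. x \<in> carrier G \<and> d \<one> x < \<delta> \<longrightarrow> d (\<one> \<otimes> a) (x \<otimes> a) < e" by metis
      then show ?thesis using a commute by (intro exI[of _ \<delta>]) auto
    qed
    show "\<exists>g. limitin mtopology \<sigma> g sequentially" if C: "MCauchy \<sigma>" "MCauchy (\<lambda>i. inv (\<sigma> i))" for \<sigma>
    proof -
      have "\<exists>g \<in> carrier G. limitin T \<sigma> g sequentially"
      proof (rule two_sided_Cauchy_converges[OF completely_metrizable d(1,2)])
        show "d (a \<otimes> g) (a \<otimes> h) = d g h" if "a \<in> carrier G" "g \<in> carrier G" "h \<in> carrier G" for a g h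
          using d(4) that by blast
        show "\<sigma> i \<in> carrier G" for i using C(1) unfolding MCauchy_def by (meson rangeI subsetD)
        show "\<exists>N. \<forall>i\<ge>N. \<forall>j\<ge>N. d (\<sigma> i) (\<sigma> j) < e" if "e > 0" for e
          using C(1) that unfolding MCauchy_def by meson
        show "\<exists>N. \<forall>i\<ge>N. \<forall>j\<ge>N. d (inv (\<sigma> i)) (inv (\<sigma> j)) < e" if "e > 0" for e
          using C(2) that unfolding MCauchy_def by meson
      qed
      then show ?thesis using d(2) by auto
    qed
  qed
  then show ?thesis using d(2) by blast
qed

section \<open>Layered left-invariant metrics\<close>

definition (in group) act :: "'a \<Rightarrow> 'a \<times> nat \<Rightarrow> 'a \<times> nat"
  where "act a x = (a \<otimes> fst x, snd x)"

context left_invariant_polish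
begin

lemma act_simps [simp]: "fst (act a x) = a \<otimes> fst x" "snd (act a x) = snd x" "act a (g, k) = (a \<otimes> g, k)"
  by (simp_all add: act_def)

lemma act_mem [simp]: "a \<in> carrier G \<Longrightarrow> x \<in> carrier G \<times> K \<Longrightarrow> act a x \<in> carrier G \<times> K"
  by (auto simp: act_def)

lemma act_mult: "\<lbrakk>a \<in> carrier G; b \<in> carrier G; x \<in> carrier G \<times> K\<rbrakk> \<Longrightarrow> act a (act b x) = act (a \<otimes> b) x"
  by (auto simp: act_def m_assoc)

lemma act_one [simp]: "x \<in> carrier G \<times> K \<Longrightarrow> act \<one> x = x"
  by (auto simp: act_def)

lemma act_inv [simp]:
  "\<lbrakk>a \<in> carrier G; x \<in> carrier G \<times> K\<rbrakk> \<Longrightarrow> act (inv a) (act a x) = x"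
  "\<lbrakk>a \<in> carrier G; x \<in> carrier G \<times> K\<rbrakk> \<Longrightarrow> act a (act (inv a) x) = x"
  by (auto simp: act_mult)

section \<open>Adding one orbit to an invariant metric on finitely many layers\<close>

text \<open>The last two clauses make every layer uniformly equivalent to \<open>d\<close>;
  invariance allows both to be stated at \<open>\<one>\<close>. The diameter bound 1 is what later
  makes layers recognisable, since marker layers are kept at least 3 apart.\<close>

definition stage :: "nat \<Rightarrow> ('a \<times> nat \<Rightarrow> 'a \<times> nat \<Rightarrow> real) \<Rightarrow> bool"
  where "stage n D \<longleftrightarrow>
    (\<forall>x \<in> carrier G \<times> {..<n}. \<forall>y \<in> carrier G \<times> {..<n}. 0 \<le> D x y \<and> D x y = D y x \<and> (D x y = 0 \<longleftrightarrow> x = y)) \<and>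
    (\<forall>x \<in> carrier G \<times> {..<n}. \<forall>y \<in> carrier G \<times> {..<n}. \<forall>z \<in> carrier G \<times> {..<n}. D x z \<le> D x y + D y z) \<and>
    (\<forall>a \<in> carrier G. \<forall>x \<in> carrier G \<times> {..<n}. \<forall>y \<in> carrier G \<times> {..<n}. D (act a x) (act a y) = D x y) \<and>
    (\<forall>k<n. \<forall>g \<in> carrier G. \<forall>h \<in> carrier G. D (g, k) (h, k) \<le> 1) \<and>
    (\<forall>k<n. \<forall>e>0. \<exists>\<delta>>0. \<forall>g \<in> carrier G. d g \<one> < \<delta> \<longrightarrow> D (g, k) (\<one>, k) < e) \<and>
    (\<forall>k<n. \<forall>e>0. \<exists>\<delta>>0. \<forall>g \<in> carrier G. D (g, k) (\<one>, k) < \<delta> \<longrightarrow> d g \<one> < e)"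

lemma stageD:
  assumes "stage n D"
  shows "\<And>x y. \<lbrakk>x \<in> carrier G \<times> {..<n}; y \<in> carrier G \<times> {..<n}\<rbrakk> \<Longrightarrow> 0 \<le> D x y"
    and "\<And>x y. \<lbrakk>x \<in> carrier G \<times> {..<n}; y \<in> carrier G \<times> {..<n}\<rbrakk> \<Longrightarrow> D x y = D y x"
    and "\<And>x y. \<lbrakk>x \<in> carrier G \<times> {..<n}; y \<in> carrier G \<times> {..<n}\<rbrakk> \<Longrightarrow> D x y = 0 \<longleftrightarrow> x = y"
    and "\<And>x y z. \<lbrakk>x \<in> carrier G \<times> {..<n}; y \<in> carrier G \<times> {..<n}; z \<in> carrier G \<times> {..<n}\<rbrakk>
      \<Longrightarrow> D x z \<le> D x y + D y z"
    and "\<And>a x y. \<lbrakk>a \<in> carrier G; x \<in> carrier G \<times> {..<n}; y \<in> carrier G \<times> {..<n}\<rbrakk>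
      \<Longrightarrow> D (act a x) (act a y) = D x y"
    and "\<And>k g h. \<lbrakk>k < n; g \<in> carrier G; h \<in> carrier G\<rbrakk> \<Longrightarrow> D (g, k) (h, k) \<le> 1"
    and "\<And>k e. \<lbrakk>k < n; 0 < e\<rbrakk> \<Longrightarrow> \<exists>\<delta>>0. \<forall>g \<in> carrier G. d g \<one> < \<delta> \<longrightarrow> D (g, k) (\<one>, k) < e"
    and "\<And>k e. \<lbrakk>k < n; 0 < e\<rbrakk> \<Longrightarrow> \<exists>\<delta>>0. \<forall>g \<in> carrier G. D (g, k) (\<one>, k) < \<delta> \<longrightarrow> d g \<one> < e"
proof -
  note s = assms[unfolded stage_def]
  note s1 = conjunct1[OF s] and s = conjunct2[OF s]
  note s2 = conjunct1[OF s] and s = conjunct2[OF s]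
  note s3 = conjunct1[OF s] and s = conjunct2[OF s]
  note s4 = conjunct1[OF s] and s = conjunct2[OF s]
  note s5 = conjunct1[OF s] and s6 = conjunct2[OF s]
  show "0 \<le> D x y" "D x y = D y x" "D x y = 0 \<longleftrightarrow> x = y"
    if "x \<in> carrier G \<times> {..<n}" "y \<in> carrier G \<times> {..<n}" for x y
  proof -
    note c = s1[THEN bspec, OF that(1), THEN bspec, OF that(2)]
    show "0 \<le> D x y" by (rule conjunct1[OF c])
    show "D x y = D y x" by (rule conjunct1[OF conjunct2[OF c]])
    show "D x y = 0 \<longleftrightarrow> x = y" by (rule conjunct2[OF conjunct2[OF c]])
  qed
  show "D x z \<le> D x y + D y z"
    if "x \<in> carrier G \<times> {..<n}" "y \<in> carrier G \<times> {..<n}" "z \<in> carrier G \<times> {..<n}" for x y z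
    by (rule s2[THEN bspec, OF that(1), THEN bspec, OF that(2), THEN bspec, OF that(3)])
  show "D (act a x) (act a y) = D x y"
    if "a \<in> carrier G" "x \<in> carrier G \<times> {..<n}" "y \<in> carrier G \<times> {..<n}" for a x y
    by (rule s3[THEN bspec, OF that(1), THEN bspec, OF that(2), THEN bspec, OF that(3)])
  show "D (g, k) (h, k) \<le> 1" if "k < n" "g \<in> carrier G" "h \<in> carrier G" for k g h
    using s4 that by simp
  show "\<exists>\<delta>>0. \<forall>g \<in> carrier G. d g \<one> < \<delta> \<longrightarrow> D (g, k) (\<one>, k) < e" if "k < n" "0 < e" for k e
    using s5 that by simp
  show "\<exists>\<delta>>0. \<forall>g \<in> carrier G. D (g, k) (\<one>, k) < \<delta> \<longrightarrow> d g \<one> < e" if "k < n" "0 < e" for k e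
    using s6 that by simp
qed

lemma stage_bounded:
  assumes st: "stage n D"
  shows "\<exists>B. \<forall>x \<in> carrier G \<times> {..<n}. \<forall>y \<in> carrier G \<times> {..<n}. D x y \<le> B"
proof -
  \<comment> \<open>The 2 pays for moving inside a layer to \<open>\<one>\<close> at either end; the
    sum dominates all distances between the finitely many points \<open>(\<one>, k)\<close>.\<close>
  define B where "B = 2 + (\<Sum>p \<in> {..<n} \<times> {..<n}. D (\<one>, fst p) (\<one>, snd p))"
  have "D (g, k) (h, l) \<le> B" if "g \<in> carrier G" "h \<in> carrier G" "k < n" "l < n" for g h k l
  proof -
    have "D (g, k) (h, l) \<le> D (g, k) (\<one>, k) + D (\<one>, k) (h, l)"
      using that by (intro stageD(4)[OF st]) auto
    moreover have "D (\<one>, k) (h, l) \<le> D (\<one>, k) (\<one>, l) + D (\<one>, l) (h, l)"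
      using that by (intro stageD(4)[OF st]) auto
    moreover have "D (g, k) (\<one>, k) \<le> 1" "D (\<one>, l) (h, l) \<le> 1"
      using that by (auto intro!: stageD(6)[OF st])
    moreover have "(\<lambda>p. D (\<one>, fst p) (\<one>, snd p)) (k, l) \<le> (\<Sum>p \<in> {..<n} \<times> {..<n}. D (\<one>, fst p) (\<one>, snd p))"
      using that by (intro member_le_sum) (auto intro!: stageD(1)[OF st])
    ultimately show ?thesis by (simp add: B_def)
  qed
  then show ?thesis by (intro exI[of _ B]) auto
qed

lemma uniform_near_one:
  assumes "finite S" and "\<And>s. s \<in> S \<Longrightarrow> \<exists>\<delta>>0. \<forall>g \<in> carrier G. d g \<one> < \<delta> \<longrightarrow> P s g"
  shows "\<exists>\<delta>>0. \<forall>s \<in> S. \<forall>g \<in> carrier G. d g \<one> < \<delta> \<longrightarrow> P s g"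
  using assms
proof (induction S rule: finite_induct)
  case empty
  then show ?case by (auto intro: exI[of _ 1])
next
  case (insert s S)
  obtain a where a: "a > 0" "\<forall>g \<in> carrier G. d g \<one> < a \<longrightarrow> P s g"
    using insert.prems[OF insertI1] by auto
  obtain b where b: "b > 0" "\<forall>s \<in> S. \<forall>g \<in> carrier G. d g \<one> < b \<longrightarrow> P s g"
    using insert.IH[OF insert.prems[OF insertI2]] by auto
  show ?case by (rule exI[of _ "min a b"]) (use a b in simp)
qed

text \<open>The point \<open>(g, n)\<close> realises the Katetov function \<open>F g\<close>, the
  translate by \<open>g\<close> of the one prescribed. Between new points the triangle inequality
  forces at least the sup distance \<open>E\<close> of these functions, as in the Katetov extension;
  \<open>Q\<close> enlarges it so that the new layer is separated and carries the topology of G. The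
  bound on \<open>D s t\<close> gives \<open>F_sum\<close>, and positive radii keep the new layer at
  distance at least \<open>\<rho>\<close> from the old ones, which leaves room for that
  enlargement.\<close>

lemma stage_extend:
  assumes st: "stage n D" and S: "finite S" "S \<noteq> {}" "S \<subseteq> carrier G \<times> {..<n}"
    and r: "\<And>s. s \<in> S \<Longrightarrow> 0 < r s" "\<And>s t. \<lbrakk>s \<in> S; t \<in> S\<rbrakk> \<Longrightarrow> D s t \<le> r s + r t"
  shows "\<exists>D'. stage (Suc n) D' \<and>
    (\<forall>x \<in> carrier G \<times> {..<n}. \<forall>y \<in> carrier G \<times> {..<n}. D' x y = D x y) \<and>
    (\<forall>x \<in> carrier G \<times> {..<n}. D' (\<one>, n) x = Min ((\<lambda>s. r s + D s x) ` S))"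
proof -
  note D = stageD[OF st]
  let ?P = "carrier G \<times> {..<n}"
  have SP: "s \<in> ?P" if "s \<in> S" for s using that S by blast
  define F where "F g x = Min ((\<lambda>s. r s + D (act g s) x) ` S)" for g x
  have F_le: "F g x \<le> r s + D (act g s) x" if "s \<in> S" for g x s
    unfolding F_def using S that by (intro Min_le) auto
  have F_ex: "\<exists>s \<in> S. F g x = r s + D (act g s) x" for g x
  proof -
    have "F g x \<in> (\<lambda>s. r s + D (act g s) x) ` S" unfolding F_def using S by (intro Min_in) auto
    then show ?thesis by blast
  qed
  define \<rho> where "\<rho> = Min (r ` S)"
  have \<rho>: "0 < \<rho>" using S r by (simp add: \<rho>_def)
  have \<rho>_le: "\<rho> \<le> r s" if "s \<in> S" for s using S that by (simp add: \<rho>_def)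
  have F_pos: "\<rho> \<le> F g x" if "g \<in> carrier G" "x \<in> ?P" for g x
    using F_ex[of g x] \<rho>_le D(1)[OF act_mem[OF that(1) SP] that(2)] by force
  have F_lip: "F g x \<le> D x y + F g y" if "g \<in> carrier G" "x \<in> ?P" "y \<in> ?P" for g x y
  proof -
    obtain s where s: "s \<in> S" "F g y = r s + D (act g s) y" using F_ex by blast
    have "F g x \<le> r s + D (act g s) x" by (rule F_le[OF s(1)])
    also have "D (act g s) x \<le> D (act g s) y + D y x" by (intro D(4) act_mem SP that s)
    finally show ?thesis using s D(2)[OF that(2,3)] by simp
  qed
  have F_sum: "D x y \<le> F g x + F g y" if "g \<in> carrier G" "x \<in> ?P" "y \<in> ?P" for g x y
  proof -
    obtain s where s: "s \<in> S" "F g x = r s + D (act g s) x" using F_ex by blast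
    obtain t where t: "t \<in> S" "F g y = r t + D (act g t) y" using F_ex by blast
    note m = act_mem[OF that(1) SP[OF s(1)]] act_mem[OF that(1) SP[OF t(1)]]
    have "D x y \<le> D x (act g s) + D (act g s) y" by (rule D(4)[OF that(2) m(1) that(3)])
    moreover have "D (act g s) y \<le> D (act g s) (act g t) + D (act g t) y" by (rule D(4)[OF m that(3)])
    moreover have "D (act g s) (act g t) \<le> r s + r t"
      using D(5)[OF that(1) SP[OF s(1)] SP[OF t(1)]] r(2)[OF s(1) t(1)] by simp
    ultimately show ?thesis using s t D(2)[OF that(2) m(1)] by simp
  qed
  have F_act: "F (a \<otimes> g) (act a x) = F g x" if "a \<in> carrier G" "g \<in> carrier G" "x \<in> ?P" for a g x
  proof -
    have "D (act (a \<otimes> g) s) (act a x) = D (act g s) x" if "s \<in> S" for s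
      using D(5)[of a "act g s" x] act_mult[of a g s "{..<n}"] SP[OF that] \<open>a \<in> carrier G\<close> \<open>g \<in> carrier G\<close> \<open>x \<in> ?P\<close>
      by simp
    then show ?thesis unfolding F_def by (metis (no_types, lifting) image_cong)
  qed
  have F_close: "\<bar>F g x - F h x\<bar> \<le> b"
    if "g \<in> carrier G" "h \<in> carrier G" "x \<in> ?P" "\<And>s. s \<in> S \<Longrightarrow> D (act g s) (act h s) \<le> b" for g h x b
  proof -
    have *: "F g x \<le> b + F h x" if "g \<in> carrier G" "h \<in> carrier G" "\<And>s. s \<in> S \<Longrightarrow> D (act g s) (act h s) \<le> b" for g h
    proof -
      obtain s where s: "s \<in> S" "F h x = r s + D (act h s) x" using F_ex by blast
      have "F g x \<le> r s + D (act g s) x" by (rule F_le[OF s(1)])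
      also have "D (act g s) x \<le> D (act g s) (act h s) + D (act h s) x"
        by (rule D(4)[OF act_mem[OF that(1) SP[OF s(1)]] act_mem[OF that(2) SP[OF s(1)]] \<open>x \<in> ?P\<close>])
      finally show ?thesis using s that(3)[OF s(1)] by simp
    qed
    have "D (act h s) (act g s) \<le> b" if "s \<in> S" for s
      using \<open>\<And>s. s \<in> S \<Longrightarrow> D (act g s) (act h s) \<le> b\<close>[OF that]
        D(2)[OF act_mem[OF \<open>h \<in> carrier G\<close> SP[OF that]] act_mem[OF \<open>g \<in> carrier G\<close> SP[OF that]]] by simp
    then show ?thesis using *[of g h] *[of h g] that by (simp add: abs_le_iff)
  qed
  \<comment> \<open>The points \<open>act g s\<close> and \<open>act h s\<close> lie in the same old
    layer, so the diameter bound is inherited by the new one.\<close>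
  have F_1: "\<bar>F g x - F h x\<bar> \<le> 1" if "g \<in> carrier G" "h \<in> carrier G" "x \<in> ?P" for g h x
    using S that by (intro F_close) (auto simp: act_def intro!: D(6))
  define E where "E g h = (SUP x \<in> ?P. \<bar>F g x - F h x\<bar>)" for g h
  have P_ne: "?P \<noteq> {}" using S by blast
  have bdd: "bdd_above ((\<lambda>x. \<bar>F g x - F h x\<bar>) ` ?P)" if "g \<in> carrier G" "h \<in> carrier G" for g h
    using F_1[OF that] by (intro bdd_aboveI2)
  have E_ge: "\<bar>F g x - F h x\<bar> \<le> E g h" if "g \<in> carrier G" "h \<in> carrier G" "x \<in> ?P" for g h x
    unfolding E_def by (rule cSUP_upper[OF that(3) bdd[OF that(1,2)]])
  have E_le: "E g h \<le> b" if "\<And>x. x \<in> ?P \<Longrightarrow> \<bar>F g x - F h x\<bar> \<le> b" for g h b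
    unfolding E_def by (rule cSUP_least[OF P_ne that])
  have E_0: "0 \<le> E g h" if "g \<in> carrier G" "h \<in> carrier G" for g h
  proof -
    obtain x where "x \<in> ?P" using P_ne by blast
    then show ?thesis using E_ge[OF that, of x] by linarith
  qed
  have E_refl: "E g g = 0" if "g \<in> carrier G" for g
    using E_0[OF that that] E_le[of g g 0] by simp
  have E_sym: "E g h = E h g" for g h by (simp add: E_def abs_minus_commute)
  have E_tri: "E g k \<le> E g h + E h k" if "g \<in> carrier G" "h \<in> carrier G" "k \<in> carrier G" for g h k
  proof (rule E_le)
    fix x assume "x \<in> ?P"
    then show "\<bar>F g x - F k x\<bar> \<le> E g h + E h k"
      using E_ge[OF that(1,2), of x] E_ge[OF that(2,3), of x] by linarith
  qed
  have E_act: "E (a \<otimes> g) (a \<otimes> h) = E g h" if "a \<in> carrier G" "g \<in> carrier G" "h \<in> carrier G" for a g h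
  proof (rule antisym)
    show "E g h \<le> E (a \<otimes> g) (a \<otimes> h)"
    proof (rule E_le)
      fix x assume x: "x \<in> ?P"
      have "\<bar>F (a \<otimes> g) (act a x) - F (a \<otimes> h) (act a x)\<bar> \<le> E (a \<otimes> g) (a \<otimes> h)"
        using that x by (intro E_ge act_mem) auto
      then show "\<bar>F g x - F h x\<bar> \<le> E (a \<otimes> g) (a \<otimes> h)" using F_act that x by simp
    qed
    show "E (a \<otimes> g) (a \<otimes> h) \<le> E g h"
    proof (rule E_le)
      fix x assume x: "x \<in> ?P"
      define y where "y = act (inv a) x"
      have y: "y \<in> ?P" "act a y = x" using x that act_mem[of "inv a" x "{..<n}"] act_inv(2)[of a x "{..<n}"] by (auto simp: y_def)
      have "\<bar>F g y - F h y\<bar> \<le> E g h" by (rule E_ge[OF that(2,3) y(1)])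
      then show "\<bar>F (a \<otimes> g) x - F (a \<otimes> h) x\<bar> \<le> E g h"
        using F_act[OF that(1,2) y(1)] F_act[OF that(1,3) y(1)] y(2) by simp
    qed
  qed
  \<comment> \<open>\<open>E\<close> is only a pseudometric; the cap \<open>2 * \<rho>\<close> keeps \<open>Q g h \<le> F g x + F h x\<close>.\<close>
  define Q where "Q g h = max (E g h) (min (d g h) (2 * \<rho>))" for g h
  have Q_0: "0 \<le> Q g h" "Q g h = 0 \<longleftrightarrow> g = h" if "g \<in> carrier G" "h \<in> carrier G" for g h
    using E_0[OF that] E_refl[OF that(1)] zero[OF that] \<rho> nonneg[of g h] by (auto simp: Q_def max_def min_def split: if_splits)
  have Q_sym: "Q g h = Q h g" for g h by (simp add: Q_def E_sym commute)
  have Q_tri: "Q g k \<le> Q g h + Q h k" if "g \<in> carrier G" "h \<in> carrier G" "k \<in> carrier G" for g h k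
  proof -
    have "min (d g k) (2 * \<rho>) \<le> min (d g h) (2 * \<rho>) + min (d h k) (2 * \<rho>)"
      using triangle[OF that] nonneg[of g h] nonneg[of h k] \<rho> by linarith
    then show ?thesis using E_tri[OF that] unfolding Q_def by linarith
  qed
  have Q_F: "F g x \<le> Q g h + F h x" "Q g h \<le> F g x + F h x"
    if "g \<in> carrier G" "h \<in> carrier G" "x \<in> ?P" for g h x
  proof -
    show "F g x \<le> Q g h + F h x" using E_ge[OF that] unfolding Q_def by linarith
    have "E g h \<le> F g x + F h x"
    proof (rule E_le)
      fix y assume y: "y \<in> ?P"
      have "F g y \<le> D y x + F g x" "F h y \<le> D y x + F h x" "D y x \<le> F g y + F g x" "D y x \<le> F h y + F h x"
        using that y by (auto intro!: F_lip F_sum)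
      then show "\<bar>F g y - F h y\<bar> \<le> F g x + F h x" by linarith
    qed
    moreover have "2 * \<rho> \<le> F g x + F h x" using F_pos[OF that(1,3)] F_pos[OF that(2,3)] by simp
    ultimately show "Q g h \<le> F g x + F h x" unfolding Q_def by linarith
  qed
  have Q_1: "Q g h \<le> 1" if "g \<in> carrier G" "h \<in> carrier G" for g h
    using E_le[of g h 1] F_1[OF that] dist_le_1[of g h] unfolding Q_def by auto
  define D' where "D' x y = (if snd x < n then if snd y < n then D x y else F (fst y) x
    else if snd y < n then F (fst x) y else Q (fst x) (fst y))" for x y
  have cases_P: "x \<in> ?P \<or> (\<exists>g \<in> carrier G. x = (g, n))" if "x \<in> carrier G \<times> {..<Suc n}" for x
    using that by (auto simp: less_Suc_eq)
  have D'[simp]: "D' x y = D x y" "D' x (g, n) = F g x" "D' (g, n) y = F g y" "D' (g, n) (h, n) = Q g h"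
    if "x \<in> ?P" "y \<in> ?P" for x y g h using that by (auto simp: D'_def)
  have D'Q[simp]: "D' (g, n) (h, n) = Q g h" for g h by (simp add: D'_def)
  have "stage (Suc n) D'"
    unfolding stage_def
  proof (intro conjI ballI allI impI)
    fix x y assume xy: "x \<in> carrier G \<times> {..<Suc n}" "y \<in> carrier G \<times> {..<Suc n}"
    have F_nonneg: "0 \<le> F g z" if "g \<in> carrier G" "z \<in> ?P" for g z using F_pos[OF that] \<rho> by simp
    show "0 \<le> D' x y"
      using cases_P[OF xy(1)] cases_P[OF xy(2)]
      by (elim disjE bexE) (simp_all add: D(1) F_nonneg Q_0(1))
    show "D' x y = D' y x"
      using cases_P[OF xy(1)] cases_P[OF xy(2)]
      by (elim disjE bexE) (simp_all add: D(2) Q_sym)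
    have pos: "F g z \<noteq> 0" if "g \<in> carrier G" "z \<in> ?P" for g z using F_pos[OF that] \<rho> by auto
    show "D' x y = 0 \<longleftrightarrow> x = y"
      using cases_P[OF xy(1)] cases_P[OF xy(2)]
      by (elim disjE bexE) (auto simp: D(3) Q_0(2) pos)
  next
    fix x y z assume xyz: "x \<in> carrier G \<times> {..<Suc n}" "y \<in> carrier G \<times> {..<Suc n}" "z \<in> carrier G \<times> {..<Suc n}"
    have 1: "F g x \<le> F g y + D y x" if "g \<in> carrier G" "x \<in> ?P" "y \<in> ?P" for g x y
      using F_lip[OF that] D(2)[OF that(2,3)] by simp
    have 2: "F g x \<le> F h x + Q h g" if "g \<in> carrier G" "h \<in> carrier G" "x \<in> ?P" for g h x
      using Q_F(1)[OF that] Q_sym[of g h] by simp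
    show "D' x z \<le> D' x y + D' y z"
      using cases_P[OF xyz(1)] cases_P[OF xyz(2)] cases_P[OF xyz(3)]
      by (elim disjE bexE) (simp_all add: D(4) F_lip F_sum Q_tri Q_F 1 2)
  next
    fix a x y assume a: "a \<in> carrier G" and xy: "x \<in> carrier G \<times> {..<Suc n}" "y \<in> carrier G \<times> {..<Suc n}"
    have Q_act: "Q (a \<otimes> g) (a \<otimes> h) = Q g h" if "g \<in> carrier G" "h \<in> carrier G" for g h
      using E_act[OF a that] left_invariant[OF a that] by (simp add: Q_def)
    show "D' (act a x) (act a y) = D' x y"
      using cases_P[OF xy(1)] cases_P[OF xy(2)]
      by (elim disjE bexE) (simp_all add: a D(5) F_act Q_act)
  next
    fix k g h assume "k < Suc n" "g \<in> carrier G" "h \<in> carrier G"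
    then show "D' (g, k) (h, k) \<le> 1" using D(6) Q_1 by (cases "k = n") auto
  next
    fix k and e :: real assume k: "k < Suc n" and e: "0 < e"
    show "\<exists>\<delta>>0. \<forall>g \<in> carrier G. d g \<one> < \<delta> \<longrightarrow> D' (g, k) (\<one>, k) < e"
    proof (cases "k = n")
      case False
      then show ?thesis using D(7)[of k e] k e by auto
    next
      case True
      \<comment> \<open>Translation by \<open>g\<close> sends \<open>s = (a, l)\<close> to
        \<open>(g \<otimes> a, l)\<close>, so smallness of \<open>d g \<one>\<close> has to pass
        through right multiplication by \<open>a\<close>, which is continuous but not
        isometric.\<close>
      have near: "\<exists>\<delta>>0. \<forall>g \<in> carrier G. d g \<one> < \<delta> \<longrightarrow> D (act g s) s < e/2" if s: "s \<in> S" for s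
      proof -
        obtain a l where al: "s = (a, l)" "a \<in> carrier G" "l < n" using SP[OF s] by auto
        obtain \<delta>1 where \<delta>1: "\<delta>1 > 0" "\<forall>g \<in> carrier G. d g \<one> < \<delta>1 \<longrightarrow> D (g, l) (\<one>, l) < e/2"
          using D(7)[OF al(3), of "e/2"] e by auto
        obtain \<delta> where \<delta>: "\<delta> > 0" "\<forall>g \<in> carrier G. d g \<one> < \<delta> \<longrightarrow> d (g \<otimes> a) a < \<delta>1"
          using right_mult_continuous[OF al(2) \<delta>1(1)] by blast
        have "D (act g s) s < e/2" if g: "g \<in> carrier G" "d g \<one> < \<delta>" for g
        proof -
          have c: "a \<otimes> (inv a \<otimes> (g \<otimes> a)) = g \<otimes> a" using al(2) g(1) by (simp add: m_assoc[symmetric])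
          have "d (inv a \<otimes> (g \<otimes> a)) \<one> = d (g \<otimes> a) a"
            using left_invariant[of a "inv a \<otimes> (g \<otimes> a)" \<one>] c al(2) g(1) by simp
          then have "D (inv a \<otimes> (g \<otimes> a), l) (\<one>, l) < e/2" using \<delta> \<delta>1 g al(2) by simp
          moreover have "D (act a (inv a \<otimes> (g \<otimes> a), l)) (act a (\<one>, l)) = D (inv a \<otimes> (g \<otimes> a), l) (\<one>, l)"
            using al g by (intro D(5)) auto
          ultimately show ?thesis using c al g(1) by simp
        qed
        then show ?thesis using \<delta>(1) by blast
      qed
      obtain \<delta> where \<delta>: "\<delta> > 0"
        "\<forall>s\<in>S. \<forall>g\<in>carrier G. d g \<one> < \<delta> \<longrightarrow> D (act g s) s < e/2"
        using uniform_near_one[OF S(1), of "\<lambda>s g. D (act g s) s < e/2", OF near] by blast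
      have "D' (g, k) (\<one>, k) < e" if g: "g \<in> carrier G" "d g \<one> < min \<delta> e" for g
      proof -
        have "E g \<one> \<le> e/2"
        proof (intro E_le F_close g one_closed)
          fix s assume "s \<in> S"
          then show "D (act g s) (act \<one> s) \<le> e/2" using \<delta>(2) g SP[of s] by (simp add: less_imp_le)
        qed
        then have "Q g \<one> < e" using g(2) e unfolding Q_def by linarith
        then show ?thesis using True by simp
      qed
      then show ?thesis using \<delta> e by (intro exI[of _ "min \<delta> e"]) auto
    qed
  next
    fix k and e :: real assume k: "k < Suc n" and e: "0 < e"
    show "\<exists>\<delta>>0. \<forall>g \<in> carrier G. D' (g, k) (\<one>, k) < \<delta> \<longrightarrow> d g \<one> < e"
    proof (cases "k = n")
      case False
      then show ?thesis using D(8)[of k e] k e by auto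
    next
      case True
      \<comment> \<open>\<open>Q\<close> is at least \<open>min (d g \<one>) (2 * \<rho>)\<close>; a
        value below \<open>2 * \<rho>\<close> therefore bounds \<open>d g \<one>\<close>
        itself.\<close>
      have "d g \<one> < e" if "D' (g, k) (\<one>, k) < min e (2 * \<rho>)" for g
        using that True by (auto simp: Q_def min_def split: if_splits)
      then show ?thesis using e \<rho> by (intro exI[of _ "min e (2 * \<rho>)"]) auto
    qed
  qed
  moreover have "D' (\<one>, n) x = Min ((\<lambda>s. r s + D s x) ` S)" if x: "x \<in> ?P" for x
  proof -
    have "(\<lambda>s. r s + D (act \<one> s) x) ` S = (\<lambda>s. r s + D s x) ` S"
      using act_one[OF SP] by (intro image_cong) simp_all
    then show ?thesis using D'(3)[OF x x] by (simp add: F_def)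
  qed
  ultimately show ?thesis using D'(1) by (intro exI[of _ D']) simp
qed

text \<open>The constant \<open>c\<close> dominates the earlier distances so that distances between distinct marker
  layers lie in disjoint intervals; see \<open>same_max_distance\<close>.\<close>

definition marker_at :: "('a \<times> nat \<Rightarrow> 'a \<times> nat \<Rightarrow> real) \<Rightarrow> nat \<Rightarrow> real \<Rightarrow> ('a \<times> nat) set \<Rightarrow> bool"
  where "marker_at D n c S \<longleftrightarrow> finite S \<and> S \<noteq> {} \<and> S \<subseteq> carrier G \<times> {..<n} \<and>
    (\<forall>x \<in> carrier G \<times> {..<n}. \<forall>y \<in> carrier G \<times> {..<n}. 2 * D x y + 3 \<le> c) \<and>
    (\<forall>x \<in> carrier G \<times> {..<n}. D (\<one>, n) x = Min ((\<lambda>s. c + D s x) ` S))"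

section \<open>Scheduling the layers\<close>

text \<open>\<open>True\<close> requests a marker over the listed points, \<open>False\<close> the
  Katetov function with the listed rational radii. Points from \<open>H\<close> and rational radii
  make the set countable.\<close>

definition tasks :: "(bool \<times> (('a \<times> nat) \<times> rat) list) set"
  where "tasks = UNIV \<times> lists ((H \<times> UNIV) \<times> UNIV)"

text \<open>Keeping only the first component of the decoded pair makes every task recur infinitely
  often: a task whose points are not yet present returns later, and each finite set receives markers
  arbitrarily late.\<close>

definition task :: "nat \<Rightarrow> bool \<times> (('a \<times> nat) \<times> rat) list"
  where "task n = from_nat_into tasks (fst (prod_decode n))"

lemma task_infinitely_often:
  assumes "t \<in> tasks"
  shows "\<exists>n\<ge>N. task n = t"
proof -
  have "countable tasks" unfolding tasks_def using H(1) by (intro countable_SIGMA countable_lists) auto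
  then obtain i where i: "from_nat_into tasks i = t"
    using assms by (metis from_nat_into_to_nat_on)
  have "task (prod_encode (i, N)) = t" by (simp add: task_def i)
  then show ?thesis using le_prod_encode_2[of N i] by blast
qed

definition task_points :: "nat \<Rightarrow> ('a \<times> nat) set"
  where "task_points n = fst ` set (snd (task n))"

definition task_radius :: "nat \<Rightarrow> 'a \<times> nat \<Rightarrow> real"
  where "task_radius n s = of_rat (the (map_of (snd (task n)) s))"

text \<open>At time \<open>n\<close> the layers 0 to \<open>n\<close> exist and layer
  \<open>Suc n\<close> is added, hence the shift in all bounds. The first task is handled at time 0,
  after layer 0 has been put in place.\<close>

definition step :: "nat \<Rightarrow> ('a \<times> nat \<Rightarrow> 'a \<times> nat \<Rightarrow> real) \<Rightarrow> ('a \<times> nat \<Rightarrow> 'a \<times> nat \<Rightarrow> real) \<Rightarrow> bool"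
  where "step n D D' \<longleftrightarrow>
    (\<forall>x \<in> carrier G \<times> {..<Suc n}. \<forall>y \<in> carrier G \<times> {..<Suc n}. D' x y = D x y) \<and>
    (\<not> fst (task n) \<and> task_points n \<noteq> {} \<and> task_points n \<subseteq> carrier G \<times> {..<Suc n} \<and>
      (\<forall>s \<in> task_points n. 0 < task_radius n s) \<and>
      (\<forall>s \<in> task_points n. \<forall>t \<in> task_points n. D s t \<le> task_radius n s + task_radius n t) \<longrightarrow>
      (\<forall>x \<in> carrier G \<times> {..<Suc n}. D' (\<one>, Suc n) x = Min ((\<lambda>s. task_radius n s + D s x) ` task_points n))) \<and>
    (fst (task n) \<longrightarrow> (\<exists>c S. marker_at D' (Suc n) c S \<and>
      (task_points n \<noteq> {} \<and> task_points n \<subseteq> carrier G \<times> {..<Suc n} \<longrightarrow> S = task_points n)))"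

lemma step_exists:
  assumes st: "stage (Suc n) D"
  shows "\<exists>D'. stage (Suc (Suc n)) D' \<and> step n D D'"
proof -
  have fin: "finite (task_points n)" by (simp add: task_points_def)
  show ?thesis
  proof (cases "\<not> fst (task n) \<and> task_points n \<noteq> {} \<and> task_points n \<subseteq> carrier G \<times> {..<Suc n} \<and>
      (\<forall>s \<in> task_points n. 0 < task_radius n s) \<and>
      (\<forall>s \<in> task_points n. \<forall>t \<in> task_points n. D s t \<le> task_radius n s + task_radius n t)")
    case True
    have "\<exists>D'. stage (Suc (Suc n)) D' \<and>
      (\<forall>x \<in> carrier G \<times> {..<Suc n}. \<forall>y \<in> carrier G \<times> {..<Suc n}. D' x y = D x y) \<and>
      (\<forall>x \<in> carrier G \<times> {..<Suc n}. D' (\<one>, Suc n) x = Min ((\<lambda>s. task_radius n s + D s x) ` task_points n))"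
      by (rule stage_extend[OF st fin]) (use True in simp_all)
    then obtain D' where D': "stage (Suc (Suc n)) D'"
      "\<forall>x \<in> carrier G \<times> {..<Suc n}. \<forall>y \<in> carrier G \<times> {..<Suc n}. D' x y = D x y"
      "\<forall>x \<in> carrier G \<times> {..<Suc n}. D' (\<one>, Suc n) x = Min ((\<lambda>s. task_radius n s + D s x) ` task_points n)"
      by blast
    have "step n D D'" unfolding step_def using D'(2,3) True by simp
    then show ?thesis using D'(1) by blast
  next
    case False
    define S where "S = (if task_points n \<noteq> {} \<and> task_points n \<subseteq> carrier G \<times> {..<Suc n} then task_points n else {(\<one>, 0)})"
    have S: "finite S" "S \<noteq> {}" "S \<subseteq> carrier G \<times> {..<Suc n}" using fin by (auto simp: S_def)
    obtain B where B: "\<forall>x \<in> carrier G \<times> {..<Suc n}. \<forall>y \<in> carrier G \<times> {..<Suc n}. D x y \<le> B"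
      using stage_bounded[OF st] by blast
    \<comment> \<open>Twice the bound plus 3 is the requirement of \<open>marker_at\<close>; taking
      \<open>max B 0\<close> makes \<open>c\<close> positive whatever \<open>B\<close> is.\<close>
    define c where "c = 2 * max B 0 + 3"
    have c: "2 * D x y + 3 \<le> c" if "x \<in> carrier G \<times> {..<Suc n}" "y \<in> carrier G \<times> {..<Suc n}" for x y
      using B[THEN bspec, OF that(1), THEN bspec, OF that(2)] by (simp add: c_def)
    have "\<exists>D'. stage (Suc (Suc n)) D' \<and>
      (\<forall>x \<in> carrier G \<times> {..<Suc n}. \<forall>y \<in> carrier G \<times> {..<Suc n}. D' x y = D x y) \<and>
      (\<forall>x \<in> carrier G \<times> {..<Suc n}. D' (\<one>, Suc n) x = Min ((\<lambda>s. c + D s x) ` S))"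
    proof (rule stage_extend[OF st S])
      show "0 < c" by (simp add: c_def)
      show "D s t \<le> c + c" if "s \<in> S" "t \<in> S" for s t
        using c[of s t] S(3) that \<open>0 < c\<close> by (smt (verit) subsetD)
    qed
    then obtain D' where D': "stage (Suc (Suc n)) D'"
      "\<forall>x \<in> carrier G \<times> {..<Suc n}. \<forall>y \<in> carrier G \<times> {..<Suc n}. D' x y = D x y"
      "\<forall>x \<in> carrier G \<times> {..<Suc n}. D' (\<one>, Suc n) x = Min ((\<lambda>s. c + D s x) ` S)"
      by blast
    have eq: "(\<lambda>s. c + D' s x) ` S = (\<lambda>s. c + D s x) ` S" if "x \<in> carrier G \<times> {..<Suc n}" for x
      using D'(2) S(3) that by (intro image_cong) auto
    have "marker_at D' (Suc n) c S"
      unfolding marker_at_def using S c D'(2,3) eq by simp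
    then have "step n D D'"
      unfolding step_def
    proof (intro conjI impI)
      show "\<exists>c S. marker_at D' (Suc n) c S \<and>
        (task_points n \<noteq> {} \<and> task_points n \<subseteq> carrier G \<times> {..<Suc n} \<longrightarrow> S = task_points n)"
        by (intro exI[of _ c] exI[of _ S] conjI impI, fact) (simp add: S_def)
    qed (use D'(2) False in blast)+
    then show ?thesis using D'(1) by blast
  qed
qed

text \<open>The construction starts from G with its own metric \<open>d\<close> as layer 0.\<close>

lemma stage_sequence:
  "\<exists>E. \<forall>n. stage (Suc n) (E n) \<and> step n (E n) (E (Suc n))"
proof (rule dependent_nat_choice)
  have "stage (Suc 0) (\<lambda>x y. d (fst x) (fst y))"
    unfolding stage_def
    using nonneg commute zero triangle left_invariant dist_le_1 by auto
  then show "\<exists>D. stage (Suc 0) D" by blast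
  show "\<exists>D'. stage (Suc (Suc n)) D' \<and> step n D D'" if "stage (Suc n) D" for D n
    using that by (rule step_exists)
qed

end

section \<open>The union of the stages\<close>

text \<open>Layer 0 is put into \<open>M\<close> although it is not a marker: it is the copy of G
  inside F on which group elements are read off. \<open>approx_extension\<close> is only approximate
  because radii are rational, and \<open>marker_exists\<close> allows the marker to be placed beyond
  any given layer \<open>N\<close>.\<close>

locale layered = left_invariant_polish G d H for G (structure) and d and H +
  fixes D :: "'a \<times> nat \<Rightarrow> 'a \<times> nat \<Rightarrow> real" and M :: "nat set"
  assumes D_metric: "Metric_space (carrier G \<times> UNIV) D"
    and D_invariant: "\<lbrakk>a \<in> carrier G; x \<in> carrier G \<times> UNIV; y \<in> carrier G \<times> UNIV\<rbrakk>
      \<Longrightarrow> D (act a x) (act a y) = D x y"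
    and layer_le_1: "\<lbrakk>g \<in> carrier G; h \<in> carrier G\<rbrakk> \<Longrightarrow> D (g, k) (h, k) \<le> 1"
    and layer_continuous: "0 < e \<Longrightarrow> \<exists>\<delta>>0. \<forall>g \<in> carrier G. d g \<one> < \<delta> \<longrightarrow> D (g, k) (\<one>, k) < e"
    and layer_separating: "0 < e \<Longrightarrow> \<exists>\<delta>>0. \<forall>g \<in> carrier G. D (g, k) (\<one>, k) < \<delta> \<longrightarrow> d g \<one> < e"
    and approx_extension: "\<lbrakk>finite A; A \<noteq> {}; A \<subseteq> H \<times> UNIV; \<And>s t. \<lbrakk>s \<in> A; t \<in> A\<rbrakk> \<Longrightarrow> f s \<le> D s t + f t;
      \<And>s t. \<lbrakk>s \<in> A; t \<in> A\<rbrakk> \<Longrightarrow> D s t \<le> f s + f t; 0 < e\<rbrakk> \<Longrightarrow> \<exists>y \<in> H \<times> UNIV. \<forall>s \<in> A. \<bar>D y s - f s\<bar> \<le> e"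
    and zero_marker: "0 \<in> M"
    and marker: "\<lbrakk>n \<in> M; n \<noteq> 0\<rbrakk> \<Longrightarrow> \<exists>c S. marker_at D n c S"
    and marker_exists: "\<lbrakk>finite S; S \<noteq> {}; S \<subseteq> H \<times> UNIV\<rbrakk> \<Longrightarrow>
      \<exists>n\<ge>N. n \<in> M \<and> n \<noteq> 0 \<and> (\<exists>c. marker_at D n c S)"

theorem (in left_invariant_polish) layered_exists: "\<exists>D M. layered G d H D M"
proof -
  obtain E where st: "\<And>n. stage (Suc n) (E n)" and step: "\<And>n. step n (E n) (E (Suc n))"
    using stage_sequence by blast
  note E = stageD[OF st]
  have ext: "E (n + m) x y = E n x y" if "x \<in> carrier G \<times> {..<Suc n}" "y \<in> carrier G \<times> {..<Suc n}" for n m x y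
  proof (induction m)
    case (Suc m)
    have "x \<in> carrier G \<times> {..<Suc (n + m)}" "y \<in> carrier G \<times> {..<Suc (n + m)}" using that by auto
    then have "E (Suc (n + m)) x y = E (n + m) x y" using step[of "n + m"] unfolding step_def by blast
    then show ?case using Suc by simp
  qed simp
  \<comment> \<open>The locale \<open>Metric_space\<close> demands symmetry and nonnegativity on the whole type.\<close>
  define D where "D x y = (if x \<in> carrier G \<times> UNIV \<and> y \<in> carrier G \<times> UNIV
    then E (max (snd x) (snd y)) x y else 0)" for x y
  have DE: "D x y = E n x y" if "x \<in> carrier G \<times> {..<Suc n}" "y \<in> carrier G \<times> {..<Suc n}" for n x y
  proof -
    let ?m = "max (snd x) (snd y)"
    have "E (?m + (n - ?m)) x y = E ?m x y" using that by (intro ext) auto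
    moreover have "?m + (n - ?m) = n" using that by auto
    ultimately show ?thesis using that by (auto simp: D_def)
  qed
  have up: "x \<in> carrier G \<times> {..<Suc n}" if "x \<in> carrier G \<times> UNIV" "snd x \<le> n" for x n
    using that by (auto simp: less_Suc_eq_le)
  have D_metric: "Metric_space (carrier G \<times> UNIV) D"
  proof
    fix x y :: "'a \<times> nat"
    show "0 \<le> D x y"
    proof (cases "x \<in> carrier G \<times> UNIV \<and> y \<in> carrier G \<times> UNIV")
      case True
      define n where "n = max (snd x) (snd y)"
      have xy: "x \<in> carrier G \<times> {..<Suc n}" "y \<in> carrier G \<times> {..<Suc n}"
        using True by (auto intro!: up simp: n_def)
      show ?thesis using DE[OF xy] E(1)[OF xy] by simp
    next
      case False
      show ?thesis unfolding D_def if_not_P[OF False] by simp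
    qed
    show "D x y = D y x"
    proof (cases "x \<in> carrier G \<times> UNIV \<and> y \<in> carrier G \<times> UNIV")
      case True
      define n where "n = max (snd x) (snd y)"
      have xy: "x \<in> carrier G \<times> {..<Suc n}" "y \<in> carrier G \<times> {..<Suc n}"
        using True by (auto intro!: up simp: n_def)
      show ?thesis using DE[OF xy] DE[OF xy(2,1)] E(2)[OF xy] by simp
    next
      case False
      then have F: "\<not> (y \<in> carrier G \<times> UNIV \<and> x \<in> carrier G \<times> UNIV)" by blast
      show ?thesis unfolding D_def if_not_P[OF False] if_not_P[OF F] by simp
    qed
  next
    fix x y :: "'a \<times> nat" assume xy0: "x \<in> carrier G \<times> UNIV" "y \<in> carrier G \<times> UNIV"
    define n where "n = max (snd x) (snd y)"
    have xy: "x \<in> carrier G \<times> {..<Suc n}" "y \<in> carrier G \<times> {..<Suc n}"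
      using xy0 by (auto intro!: up simp: n_def)
    show "D x y = 0 \<longleftrightarrow> x = y" using DE[OF xy] E(3)[OF xy] by simp
  next
    fix x y z :: "'a \<times> nat" assume xyz0: "x \<in> carrier G \<times> UNIV" "y \<in> carrier G \<times> UNIV" "z \<in> carrier G \<times> UNIV"
    define n where "n = max (snd x) (max (snd y) (snd z))"
    have xyz: "x \<in> carrier G \<times> {..<Suc n}" "y \<in> carrier G \<times> {..<Suc n}" "z \<in> carrier G \<times> {..<Suc n}"
      using xyz0 by (auto intro!: up simp: n_def)
    show "D x z \<le> D x y + D y z"
      using DE[OF xyz(1,2)] DE[OF xyz(1,3)] DE[OF xyz(2,3)] E(4)[OF xyz] by simp
  qed
  interpret D: Metric_space "carrier G \<times> UNIV :: ('a \<times> nat) set" D by (rule D_metric)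
  have D_layer: "D (g, k) (h, k) = E k (g, k) (h, k)" if "g \<in> carrier G" "h \<in> carrier G" for g h k
    using that by (intro DE) auto
  define M where "M = insert 0 {Suc n | n. fst (task n)}"
  have mark: "marker_at D (Suc n) c S" if "marker_at (E (Suc n)) (Suc n) c S" for n c S
  proof -
    have D1: "D x y = E (Suc n) x y" if "x \<in> carrier G \<times> {..<Suc n}" "y \<in> carrier G \<times> {..<Suc n}" for x y
      using that by (intro DE) auto
    have D2: "D (\<one>, Suc n) y = E (Suc n) (\<one>, Suc n) y" if "y \<in> carrier G \<times> {..<Suc n}" for y
      using that by (intro DE) auto
    have S: "S \<subseteq> carrier G \<times> {..<Suc n}" using that unfolding marker_at_def by blast
    have "(\<lambda>s. c + D s x) ` S = (\<lambda>s. c + E (Suc n) s x) ` S" if "x \<in> carrier G \<times> {..<Suc n}" for x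
      using that S by (intro image_cong refl) (auto intro!: D1)
    then show ?thesis using that D1 D2 unfolding marker_at_def by simp
  qed
  have task_marker: "\<exists>c S. marker_at D (Suc n) c S \<and>
      (task_points n \<noteq> {} \<and> task_points n \<subseteq> carrier G \<times> {..<Suc n} \<longrightarrow> S = task_points n)"
    if "fst (task n)" for n
    using step[of n] that mark unfolding step_def by blast
  \<comment> \<open>Among the infinitely many occurrences of the task, one comes after all layers
    containing the listed points.\<close>
  have infinitely: "\<exists>n\<ge>N. task n = (b, map (\<lambda>s. (s, q s)) as) \<and> set as \<subseteq> carrier G \<times> {..<Suc n}"
    if "set as \<subseteq> H \<times> UNIV" for N b q as
  proof -
    have t: "(b, map (\<lambda>s. (s, q s)) as) \<in> tasks" using that by (auto simp: tasks_def)
    define N' where "N' = max N (Max (insert 0 (snd ` set as)))"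
    obtain n where n: "n \<ge> N'" "task n = (b, map (\<lambda>s. (s, q s)) as)"
      using task_infinitely_often[OF t] by blast
    have "s \<in> carrier G \<times> {..<Suc n}" if "s \<in> set as" for s
    proof (rule up)
      show "s \<in> carrier G \<times> UNIV" using that \<open>set as \<subseteq> H \<times> UNIV\<close> H(2) by auto
      have "snd s \<le> Max (insert 0 (snd ` set as))" using that by (intro Max_ge) auto
      also have "\<dots> \<le> n" using n(1) unfolding N'_def by linarith
      finally show "snd s \<le> n" .
    qed
    then show ?thesis using n by (intro exI[of _ n]) (auto simp: N'_def)
  qed
  have "layered G d H D M"
  proof
    show "D (act a x) (act a y) = D x y"
      if "a \<in> carrier G" "x \<in> carrier G \<times> UNIV" "y \<in> carrier G \<times> UNIV" for a x y
    proof -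
      define n where "n = max (snd x) (snd y)"
      have xy: "x \<in> carrier G \<times> {..<Suc n}" "y \<in> carrier G \<times> {..<Suc n}"
        using that by (auto intro!: up simp: n_def)
      show ?thesis
        using DE[OF xy] DE[OF act_mem[OF that(1) xy(1)] act_mem[OF that(1) xy(2)]] E(5)[OF that(1) xy] by simp
    qed
    show "D (g, k) (h, k) \<le> 1" if "g \<in> carrier G" "h \<in> carrier G" for g h k
      using D_layer[OF that] E(6)[of k k] that by simp
    show "\<exists>\<delta>>0. \<forall>g \<in> carrier G. d g \<one> < \<delta> \<longrightarrow> D (g, k) (\<one>, k) < e" if "0 < e" for k e
      using E(7)[of k k e] that D_layer by simp
    show "\<exists>\<delta>>0. \<forall>g \<in> carrier G. D (g, k) (\<one>, k) < \<delta> \<longrightarrow> d g \<one> < e" if "0 < e" for k e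
      using E(8)[of k k e] that D_layer by simp
    show "0 \<in> M" by (simp add: M_def)
    show "\<exists>c S. marker_at D n c S" if "n \<in> M" "n \<noteq> 0" for n
      using that task_marker unfolding M_def by blast
    show "\<exists>n\<ge>N. n \<in> M \<and> n \<noteq> 0 \<and> (\<exists>c. marker_at D n c S)"
      if S: "finite S" "S \<noteq> {}" "S \<subseteq> H \<times> UNIV" for S N
    proof -
      obtain as where as: "set as = S" using finite_list[OF S(1)] by blast
      obtain n where n: "n \<ge> N" "task n = (True, map (\<lambda>s. (s, 0)) as)" "set as \<subseteq> carrier G \<times> {..<Suc n}"
        using infinitely[of as N True "\<lambda>_. 0"] S(3) as by blast
      have tp: "task_points n = S" using n(2) as by (auto simp: task_points_def image_image)
      obtain c S' where c: "marker_at D (Suc n) c S'"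
        "task_points n \<noteq> {} \<and> task_points n \<subseteq> carrier G \<times> {..<Suc n} \<longrightarrow> S' = task_points n"
        using task_marker[of n] n(2) by auto
      have "S' = S" using c(2) tp S(2) n(3) as by simp
      with c(1) have "marker_at D (Suc n) c S" by simp
      moreover have "Suc n \<in> M" using n(2) by (simp add: M_def)
      ultimately show ?thesis using n(1) by (intro exI[of _ "Suc n"]) auto
    qed
    show "\<exists>y \<in> H \<times> UNIV. \<forall>s \<in> A. \<bar>D y s - f s\<bar> \<le> e"
      if A: "finite A" "A \<noteq> {}" "A \<subseteq> H \<times> UNIV"
        and f: "\<And>s t. \<lbrakk>s \<in> A; t \<in> A\<rbrakk> \<Longrightarrow> f s \<le> D s t + f t"
          "\<And>s t. \<lbrakk>s \<in> A; t \<in> A\<rbrakk> \<Longrightarrow> D s t \<le> f s + f t" and e: "0 < e" for A f e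
    proof -
      obtain as where as: "set as = A" using finite_list[OF A(1)] by blast
      \<comment> \<open>Rounding upwards preserves \<open>D s t \<le> f s + f t\<close> and makes
        the radii positive. Rounding may break the Lipschitz condition, but the minimum over the
        support restores it.\<close>
      have "\<forall>s. \<exists>q :: rat. f s < of_rat q \<and> of_rat q < f s + e" using e by (intro allI of_rat_dense) simp
      then obtain q :: "'a \<times> nat \<Rightarrow> rat" where q: "\<And>s. f s < of_rat (q s)" "\<And>s. of_rat (q s) < f s + e" by metis
      obtain n where n: "task n = (False, map (\<lambda>s. (s, q s)) as)" "set as \<subseteq> carrier G \<times> {..<Suc n}"
        using infinitely[of as 0 False q] A(3) as by blast
      have AP: "s \<in> carrier G \<times> {..<Suc n}" if "s \<in> A" for s using n(2) as that by blast
      have tp: "task_points n = A" using n(1) as by (simp add: task_points_def image_image)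
      have tr: "task_radius n s = of_rat (q s)" if "s \<in> A" for s
        using n(1) as that by (simp add: task_radius_def map_of_map_restrict)
      have f0: "0 \<le> f s" if "s \<in> A" for s
      proof -
        have "D s s = 0" using D.mdist_zero AP[OF that] by auto
        then show ?thesis using f(2)[OF that that] by simp
      qed
      have "D (\<one>, Suc n) x = Min ((\<lambda>s. task_radius n s + E n s x) ` A)" if "x \<in> A" for x
      proof -
        have pre: "\<not> fst (task n) \<and> task_points n \<noteq> {} \<and> task_points n \<subseteq> carrier G \<times> {..<Suc n} \<and>
          (\<forall>s \<in> task_points n. 0 < task_radius n s) \<and>
          (\<forall>s \<in> task_points n. \<forall>t \<in> task_points n. E n s t \<le> task_radius n s + task_radius n t)"
        proof (intro conjI ballI)
          show "\<not> fst (task n)" using n(1) by simp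
          show "task_points n \<noteq> {}" using tp A(2) by simp
          show "task_points n \<subseteq> carrier G \<times> {..<Suc n}" using tp AP by blast
          show "0 < task_radius n s" if "s \<in> task_points n" for s
            using that tr[of s] f0[of s] q(1)[of s] unfolding tp by linarith
          show "E n s t \<le> task_radius n s + task_radius n t" if "s \<in> task_points n" "t \<in> task_points n" for s t
            using that f(2)[of s t] DE[OF AP AP, of s t] q(1)[of s] q(1)[of t] unfolding tp by (simp add: tr)
        qed
        then have all: "\<forall>x \<in> carrier G \<times> {..<Suc n}. E (Suc n) (\<one>, Suc n) x = Min ((\<lambda>s. task_radius n s + E n s x) ` task_points n)"
          using step[of n] unfolding step_def by blast
        have "D (\<one>, Suc n) x = E (Suc n) (\<one>, Suc n) x"
          using AP[OF that] by (intro DE) auto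
        also note all[THEN bspec, OF AP[OF that]]
        finally show ?thesis unfolding tp .
      qed
      moreover have "(\<lambda>s. task_radius n s + E n s x) ` A = (\<lambda>s. of_rat (q s) + D s x) ` A" if "x \<in> A" for x
        using that by (intro image_cong refl) (simp add: tr DE[OF AP AP])
      ultimately have Dx: "D (\<one>, Suc n) x = Min ((\<lambda>s. of_rat (q s) + D s x) ` A)" if "x \<in> A" for x
        using that by simp
      have "\<bar>D (\<one>, Suc n) x - f x\<bar> \<le> e" if x: "x \<in> A" for x
      proof -
        have "D (\<one>, Suc n) x \<le> of_rat (q x) + D x x"
          unfolding Dx[OF x] using A(1) x by (intro Min_le) auto
        moreover have "D x x = 0" using D.mdist_zero AP[OF x] by auto
        \<comment> \<open>Each term \<open>q s + D s x\<close> exceeds \<open>f s + D s x\<close>,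
          which is at least \<open>f x\<close> by the Lipschitz condition. The term
          \<open>s = x\<close> gave the upper bound.\<close>
        moreover have "f x \<le> D (\<one>, Suc n) x"
          unfolding Dx[OF x]
        proof (rule Min.boundedI)
          fix b assume "b \<in> (\<lambda>s. of_rat (q s) + D s x) ` A"
          then obtain s where s: "s \<in> A" "b = of_rat (q s) + D s x" by blast
          then show "f x \<le> b" using f(1)[OF x s(1)] q(1)[of s] D.commute[of x s] by linarith
        qed (use A in auto)
        ultimately show ?thesis using q(2)[of x] by linarith
      qed
      then show ?thesis using H(3) by (intro bexI[of _ "(\<one>, Suc n)"]) auto
    qed
  qed
  then show ?thesis by blast
qed

section \<open>Dense isometric embeddings into finitely injective spaces\<close>

text \<open>If \<open>f\<close> vanishes at some point of \<open>A\<close>, that point already has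
  the prescribed distances. Otherwise adjoining an abstract point at distances \<open>f\<close>
  gives a finite metric space, to which finite injectivity applies.\<close>

lemma finitely_injective_one_point:
  assumes X: "finitely_injective X" and A: "finite A" "A \<subseteq> mspace X"
    and f: "\<And>a b. \<lbrakk>a \<in> A; b \<in> A\<rbrakk> \<Longrightarrow> f a \<le> mdist X a b + f b"
      "\<And>a b. \<lbrakk>a \<in> A; b \<in> A\<rbrakk> \<Longrightarrow> mdist X a b \<le> f a + f b"
  shows "\<exists>p \<in> mspace X. \<forall>a \<in> A. mdist X p a = f a"
proof (cases "\<exists>a \<in> A. f a = 0")
  case True
  then obtain a where a: "a \<in> A" "f a = 0" by blast
  have "mdist X a b = f b" if "b \<in> A" for b
    using f(1)[OF that a(1)] f(2)[OF a(1) that] a(2) mdist_commute[of X a b] by simp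
  then show ?thesis using a A by blast
next
  case False
  have f0: "0 < f a" if "a \<in> A" for a
  proof -
    have "0 \<le> f a" using f(2)[OF that that] mdist_nonneg[of X a a] by linarith
    moreover have "f a \<noteq> 0" using False that by blast
    ultimately show ?thesis by simp
  qed
  define N where "N = insert None (Some ` A)"
  \<comment> \<open>\<open>None\<close> is the new point. The absolute values secure nonnegativity
    on the whole option type; on \<open>A\<close> they equal \<open>f\<close>.\<close>
  define \<rho> where "\<rho> x y = (case x of
      None \<Rightarrow> (case y of None \<Rightarrow> 0 | Some b \<Rightarrow> \<bar>f b\<bar>)
    | Some a \<Rightarrow> (case y of None \<Rightarrow> \<bar>f a\<bar> | Some b \<Rightarrow> mdist X a b))" for x y
  have \<rho>: "\<rho> None None = 0" "\<rho> None (Some b) = \<bar>f b\<bar>" "\<rho> (Some b) None = \<bar>f b\<bar>"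
    "\<rho> (Some a) (Some b) = mdist X a b" for a b by (simp_all add: \<rho>_def)
  have M: "Metric_space N \<rho>"
  proof
    show "0 \<le> \<rho> x y" for x y by (cases x; cases y) (simp_all add: \<rho>)
    show "\<rho> x y = \<rho> y x" for x y by (cases x; cases y) (simp_all add: \<rho> mdist_commute)
    show "\<rho> x y = 0 \<longleftrightarrow> x = y" if "x \<in> N" "y \<in> N" for x y
    proof (cases x; cases y)
      fix a b assume xy: "x = Some a" "y = Some b"
      then have "a \<in> mspace X" "b \<in> mspace X" using that A(2) by (auto simp: N_def)
      then show ?thesis using xy by (simp add: \<rho>)
    qed (use that f0 in \<open>force simp: N_def \<rho>\<close>)+
    show "\<rho> x z \<le> \<rho> x y + \<rho> y z" if xyz: "x \<in> N" "y \<in> N" "z \<in> N" for x y z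
    proof -
      have f1: "f a \<le> mdist X b a + f b" if "a \<in> A" "b \<in> A" for a b
        using f(1)[OF that] mdist_commute[of X a b] by simp
      have tri: "mdist X a c \<le> mdist X a b + mdist X b c" if "a \<in> A" "b \<in> A" "c \<in> A" for a b c
        using that A(2) by (intro mdist_triangle) auto
      have ab: "\<bar>f a\<bar> = f a" "0 \<le> f a" if "a \<in> A" for a using f0[OF that] by simp_all
      consider "x = None" | a where "x = Some a" "a \<in> A" using xyz by (auto simp: N_def)
      moreover consider "y = None" | b where "y = Some b" "b \<in> A" using xyz by (auto simp: N_def)
      moreover consider "z = None" | c where "z = Some c" "c \<in> A" using xyz by (auto simp: N_def)
      ultimately show ?thesis
        using f(1) f(2) f1 tri ab by (smt (verit) \<rho>)
    qed
  qed
  interpret N: Metric_space N \<rho> by (rule M)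
  define L where "L = metric (N, \<rho>)"
  have L: "mspace L = N" "mdist L = \<rho>" by (simp_all add: L_def)
  have fin: "finite (mspace L)" "Some ` A \<subseteq> mspace L" using A by (auto simp: L N_def)
  have "isometric_map (submetric L (Some ` A)) X the"
    using A by (auto simp: isometric_map_def L \<rho>)
  from finitely_injective_extension[OF X fin this] obtain g where
    g: "isometric_map L X g" "\<forall>x \<in> Some ` A. g x = the x" by blast
  have "g None \<in> mspace X" using g(1) by (auto simp: isometric_map_def L N_def)
  moreover have "mdist X (g None) a = f a" if "a \<in> A" for a
  proof -
    have "\<rho> None (Some a) = mdist X (g None) (g (Some a))"
      using g(1) that by (auto simp: isometric_map_def L N_def)
    then show ?thesis using g(2) that f0[OF that] by (simp add: \<rho>)
  qed
  ultimately show ?thesis by blast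
qed

text \<open>The source is a distance function with a set, unlike in \<open>isometric_map\<close>, so
  one function can be restricted to growing finite sets.\<close>

definition partial_isometry :: "('a \<Rightarrow> 'a \<Rightarrow> real) \<Rightarrow> 'b metric \<Rightarrow> 'a set \<Rightarrow> ('a \<Rightarrow> 'b) \<Rightarrow> bool"
  where "partial_isometry D X A e \<longleftrightarrow>
    (\<forall>a \<in> A. e a \<in> mspace X) \<and> (\<forall>a \<in> A. \<forall>b \<in> A. mdist X (e a) (e b) = D a b)"

lemma partial_isometryD:
  assumes "partial_isometry D X A e"
  shows "\<And>a. a \<in> A \<Longrightarrow> e a \<in> mspace X" "\<And>a b. \<lbrakk>a \<in> A; b \<in> A\<rbrakk> \<Longrightarrow> mdist X (e a) (e b) = D a b"
  using assms by (auto simp: partial_isometry_def)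

lemma partial_isometry_insert:
  assumes "partial_isometry D X A e" and "y \<notin> A" "D y y = 0"
    and "p \<in> mspace X" "\<And>a. a \<in> A \<Longrightarrow> mdist X p (e a) = D y a" "\<And>a. a \<in> A \<Longrightarrow> D a y = D y a"
  shows "partial_isometry D X (insert y A) (e(y := p))"
proof -
  have sym: "mdist X (e a) p = D a y" if "a \<in> A" for a
    using assms(5,6)[OF that] mdist_commute[of X "e a" p] by simp
  have e: "e a \<in> mspace X" "\<And>b. b \<in> A \<Longrightarrow> mdist X (e a) (e b) = D a b" if "a \<in> A" for a
    using partial_isometryD[OF assms(1)] that by simp_all
  have ne: "a \<noteq> y" if "a \<in> A" for a using assms(2) that by blast
  have "mdist X p p = 0" using assms(4) by simp
  then show ?thesis
    unfolding partial_isometry_def ball_simps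
    using assms(3,4,5) sym e ne by simp
qed

context Metric_space
begin

lemma partial_isometry_inj_on:
  assumes "partial_isometry d X A e" "A \<subseteq> M"
  shows "inj_on e A"
proof (rule inj_onI)
  fix a b assume ab: "a \<in> A" "b \<in> A" "e a = e b"
  have "d a b = mdist X (e a) (e b)" using partial_isometryD(2)[OF assms(1) ab(1,2)] by simp
  also have "\<dots> = 0" using ab partial_isometryD(1)[OF assms(1)] by simp
  finally show "a = b" using ab(1,2) assms(2) by (meson subsetD zero)
qed

lemma partial_isometry_forth:
  assumes X: "finitely_injective X" and A: "finite A" "A \<subseteq> M" and e: "partial_isometry d X A e" and y: "y \<in> M"
  shows "\<exists>e'. partial_isometry d X (insert y A) e' \<and> (\<forall>a \<in> A. e' a = e a)"
proof (cases "y \<in> A")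
  case True
  then show ?thesis using e by (intro exI[of _ e]) (simp add: insert_absorb)
next
  case False
  have inj: "inj_on e A" by (rule partial_isometry_inj_on[OF e A(2)])
  have AM: "a \<in> M" if "a \<in> A" for a using that A by blast
  have "\<exists>p \<in> mspace X. \<forall>q \<in> e ` A. mdist X p q = d y (inv_into A e q)"
  proof (rule finitely_injective_one_point[OF X])
    show "finite (e ` A)" "e ` A \<subseteq> mspace X" using A partial_isometryD(1)[OF e] by auto
    fix p q assume "p \<in> e ` A" "q \<in> e ` A"
    then obtain a b where ab: "a \<in> A" "b \<in> A" "p = e a" "q = e b" by blast
    show "d y (inv_into A e p) \<le> mdist X p q + d y (inv_into A e q)"
      using ab inj partial_isometryD(2)[OF e ab(1,2)] triangle[OF y AM[OF ab(2)] AM[OF ab(1)]] commute[of a b]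
      by simp
    show "mdist X p q \<le> d y (inv_into A e p) + d y (inv_into A e q)"
      using ab inj partial_isometryD(2)[OF e ab(1,2)] triangle[OF AM[OF ab(1)] y AM[OF ab(2)]] commute[of a y]
      by simp
  qed
  then obtain p where p: "p \<in> mspace X" "\<And>a. a \<in> A \<Longrightarrow> mdist X p (e a) = d y a"
    using inj by auto
  have "partial_isometry d X (insert y A) (e(y := p))"
    by (rule partial_isometry_insert[OF e False _ p]) (use y commute in simp_all)
  then show ?thesis using False by (intro exI[of _ "e(y := p)"]) auto
qed

lemma partial_isometry_back:
  assumes X: "finitely_injective X" and A: "finite A" "A \<subseteq> M" "A \<noteq> {}" and e: "partial_isometry d X A e"
    and u: "u \<in> mspace X" and y: "y \<in> M" and close: "\<And>a. a \<in> A \<Longrightarrow> \<bar>d y a - mdist X u (e a)\<bar> \<le> \<epsilon>"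
  shows "\<exists>e'. partial_isometry d X (insert y A) e' \<and> (\<forall>a \<in> A. e' a = e a) \<and>
    (\<exists>a \<in> insert y A. mdist X (e' a) u \<le> \<epsilon>)"
proof (cases "y \<in> A \<or> u \<in> e ` A")
  case True
  obtain a where a: "a \<in> A" using A by blast
  have \<epsilon>: "0 \<le> \<epsilon>" using close[OF a] by linarith
  obtain e' where e': "partial_isometry d X (insert y A) e'" "\<forall>a \<in> A. e' a = e a"
    using partial_isometry_forth[OF X A(1,2) e y] by blast
  have "\<exists>a \<in> insert y A. mdist X (e' a) u \<le> \<epsilon>"
    using True
  proof
    \<comment> \<open>Taking \<open>a = y\<close> in \<open>close\<close>, with
      \<open>d y y = 0\<close>, shows that the image of \<open>y\<close> is already within
      \<open>\<epsilon>\<close> of \<open>u\<close>.\<close>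
    assume "y \<in> A"
    then show ?thesis using close[of y] y e'(2) mdist_commute[of X u "e y"] by (intro bexI[of _ y]) auto
  next
    assume "u \<in> e ` A"
    then obtain b where "b \<in> A" "u = e b" by blast
    then show ?thesis using e'(2) \<epsilon> Metric_space.mdist_zero[OF Metric_space_mspace_mdist u] by (intro bexI[of _ b]) auto
  qed
  then show ?thesis using e' by blast
next
  case False
  then have yA: "y \<notin> A" and uA: "\<And>a. a \<in> A \<Longrightarrow> e a \<noteq> u" by auto
  have inj: "inj_on e A" by (rule partial_isometry_inj_on[OF e A(2)])
  have AM: "a \<in> M" if "a \<in> A" for a using that A by blast
  have eX: "e a \<in> mspace X" if "a \<in> A" for a using partial_isometryD(1)[OF e that] .
  \<comment> \<open>\<open>m\<close> is the least distance to \<open>u\<close> that a point with the distances \<open>d y a\<close> to \<open>e a\<close> can have.\<close>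
  define m where "m = Max ((\<lambda>a. \<bar>d y a - mdist X u (e a)\<bar>) ` A)"
  have m_ge: "\<bar>d y a - mdist X u (e a)\<bar> \<le> m" if "a \<in> A" for a
    unfolding m_def using A that by (intro Max_ge) auto
  have m_le: "m \<le> b" if "\<And>a. a \<in> A \<Longrightarrow> \<bar>d y a - mdist X u (e a)\<bar> \<le> b" for b
    unfolding m_def using A that by (intro Max.boundedI) auto
  have m0: "0 \<le> m" using m_ge A(3) by (metis abs_ge_zero all_not_in_conv order_trans)
  define F where "F p = (if p = u then m else d y (inv_into A e p))" for p
  have Fu: "F u = m" and Fe: "F (e a) = d y a" if "a \<in> A" for a
    using uA that inj by (auto simp: F_def)
  have ym: "m \<le> mdist X u (e a) + d y a" if a: "a \<in> A" for a
  proof (rule m_le)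
    fix b assume b: "b \<in> A"
    have "d y b \<le> d y a + d a b" "d a b \<le> d y a + d y b"
      using triangle[OF y AM[OF a] AM[OF b]] triangle''[OF AM[OF a] y AM[OF b]] by simp_all
    moreover have "mdist X u (e b) \<le> mdist X u (e a) + mdist X (e a) (e b)"
      "mdist X (e a) (e b) \<le> mdist X (e a) u + mdist X u (e b)"
      using mdist_triangle[OF u eX[OF a] eX[OF b]] mdist_triangle[OF eX[OF a] u eX[OF b]] by simp_all
    ultimately show "\<bar>d y b - mdist X u (e b)\<bar> \<le> mdist X u (e a) + d y a"
      using partial_isometryD(2)[OF e a b] mdist_commute[of X u "e a"] by linarith
  qed
  have "\<exists>p \<in> mspace X. \<forall>q \<in> insert u (e ` A). mdist X p q = F q"
  proof (rule finitely_injective_one_point[OF X])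
    show "finite (insert u (e ` A))" "insert u (e ` A) \<subseteq> mspace X" using A eX u by auto
    have *: "F p \<le> mdist X p q + F q \<and> mdist X p q \<le> F p + F q"
      if pq: "p \<in> insert u (e ` A)" "q \<in> insert u (e ` A)" for p q
    proof -
      consider "p = u" "q = u" | a where "a \<in> A" "p = u" "q = e a" | a where "a \<in> A" "p = e a" "q = u"
        | a b where "a \<in> A" "b \<in> A" "p = e a" "q = e b" using pq by blast
      then show ?thesis
      proof cases
        case 1
        then show ?thesis
          using m0 Metric_space.mdist_zero[OF Metric_space_mspace_mdist u] by (simp add: F_def)
      next
        case (2 a)
        then show ?thesis using Fu Fe[of a] ym[of a] m_ge[of a] by (auto simp: F_def)
      next
        case (3 a)
        then show ?thesis using Fe[of a] ym[of a] m_ge[of a] mdist_commute[of X u "e a"] by (auto simp: F_def)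
      next
        case (4 a b)
        have "d y a \<le> d a b + d y b" "d a b \<le> d y a + d y b"
          using triangle[OF y AM[OF 4(2)] AM[OF 4(1)]] triangle''[OF AM[OF 4(1)] y AM[OF 4(2)]] commute[of a b]
          by simp_all
        then show ?thesis using 4 Fe partial_isometryD(2)[OF e 4(1,2)] by simp
      qed
    qed
    show "F p \<le> mdist X p q + F q" "mdist X p q \<le> F p + F q"
      if "p \<in> insert u (e ` A)" "q \<in> insert u (e ` A)" for p q using *[OF that] by simp_all
  qed
  then obtain p where p: "p \<in> mspace X" "\<forall>q \<in> insert u (e ` A). mdist X p q = F q" by blast
  have pe: "mdist X p (e a) = d y a" if "a \<in> A" for a using p(2) Fe[OF that] that by simp
  have "partial_isometry d X (insert y A) (e(y := p))"
    by (rule partial_isometry_insert[OF e yA _ p(1) pe]) (use y commute in simp_all)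
  moreover have "mdist X p u \<le> \<epsilon>" using p(2) m_le[of \<epsilon>] close by (simp add: F_def)
  ultimately show ?thesis using yA by (intro exI[of _ "e(y := p)"]) auto
qed

text \<open>Step \<open>n\<close> puts the \<open>n\<close>-th point of M into the domain and brings
  the image within \<open>1 / Suc n\<close> of a point of a countable dense set. The points of M
  required by \<open>partial_isometry_back\<close> are supplied by \<open>approx\<close>, applied to
  the distances from \<open>u n\<close>.\<close>

theorem dense_isometric_embedding:
  assumes X: "finitely_injective X" "separable_space (mtopology_of X)" and M: "countable M" "M \<noteq> {}"
    and approx: "\<And>A f e. \<lbrakk>finite A; A \<noteq> {}; A \<subseteq> M; \<And>s t. \<lbrakk>s \<in> A; t \<in> A\<rbrakk> \<Longrightarrow> f s \<le> d s t + f t;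
      \<And>s t. \<lbrakk>s \<in> A; t \<in> A\<rbrakk> \<Longrightarrow> d s t \<le> f s + f t; (0::real) < e\<rbrakk> \<Longrightarrow> \<exists>y \<in> M. \<forall>s \<in> A. \<bar>d y s - f s\<bar> \<le> e"
  shows "\<exists>e. partial_isometry d X M e \<and> (\<forall>u \<in> mspace X. \<forall>\<epsilon>>0. \<exists>y \<in> M. mdist X u (e y) < \<epsilon>)"
proof -
  interpret X: Metric_space "mspace X" "mdist X" by simp
  obtain C where C: "countable C" "C \<subseteq> mspace X" "mtopology_of X closure_of C = mspace X"
    using X(2) unfolding separable_space_def by auto
  obtain p0 where p0: "p0 \<in> mspace X"
    using finitely_injective_one_point[OF X(1), of "{}" "\<lambda>_. 0"] by auto
  have C0: "C \<noteq> {}" using C(3) p0 by auto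
  \<comment> \<open>Each point of \<open>C\<close> occurs at arbitrarily large \<open>n\<close>, so
    that it is approached with tolerances \<open>1 / Suc n\<close> tending to 0.\<close>
  define u where "u n = from_nat_into C (fst (prod_decode n))" for n
  define z where "z = from_nat_into M"
  have uX: "u n \<in> mspace X" for n using from_nat_into[OF C0] C(2) by (auto simp: u_def)
  have zM: "z n \<in> M" for n using from_nat_into[OF M(2)] by (simp add: z_def)
  define P where "P s \<longleftrightarrow> finite (fst s) \<and> fst s \<noteq> {} \<and> fst s \<subseteq> M \<and> partial_isometry d X (fst s) (snd s)"
    for s :: "'a set \<times> ('a \<Rightarrow> 'b)"
  define R where "R n s s' \<longleftrightarrow> fst s \<subseteq> fst s' \<and> (\<forall>a \<in> fst s. snd s' a = snd s a) \<and> z n \<in> fst s' \<and>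
    (\<exists>y \<in> fst s'. mdist X (snd s' y) (u n) \<le> 1 / Suc n)" for n and s s' :: "'a set \<times> ('a \<Rightarrow> 'b)"
  have "\<exists>f. \<forall>n. P (f n) \<and> R n (f n) (f (Suc n))"
  proof (rule dependent_nat_choice)
    have "P ({z 0}, \<lambda>_. p0)" using zM p0 by (simp add: P_def partial_isometry_def)
    then show "\<exists>s. P s" by blast
    fix s n assume s: "P s"
    define A where "A = fst s"
    have A: "finite A" "A \<subseteq> M" "A \<noteq> {}" "partial_isometry d X A (snd s)" using s by (auto simp: P_def A_def)
    obtain e1 where e1: "partial_isometry d X (insert (z n) A) e1" "\<forall>a \<in> A. e1 a = snd s a"
      using partial_isometry_forth[OF X(1) A(1,2,4) zM] by blast
    let ?B = "insert (z n) A"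
    have B: "finite ?B" "?B \<subseteq> M" "?B \<noteq> {}" using A zM by auto
    have eX: "e1 b \<in> mspace X" if "b \<in> ?B" for b using partial_isometryD(1)[OF e1(1) that] .
    have "\<exists>y \<in> M. \<forall>b \<in> ?B. \<bar>d y b - mdist X (u n) (e1 b)\<bar> \<le> 1 / Suc n"
    proof (rule approx[OF B(1,3,2)])
      fix b c assume bc: "b \<in> ?B" "c \<in> ?B"
      show "mdist X (u n) (e1 b) \<le> d b c + mdist X (u n) (e1 c)"
        using mdist_triangle[OF uX[of n] eX[OF bc(2)] eX[OF bc(1)]] partial_isometryD(2)[OF e1(1) bc(2,1)]
          commute[of b c] by linarith
      show "d b c \<le> mdist X (u n) (e1 b) + mdist X (u n) (e1 c)"
        using mdist_triangle[OF eX[OF bc(1)] uX[of n] eX[OF bc(2)]] partial_isometryD(2)[OF e1(1) bc]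
          mdist_commute[of X "e1 b" "u n"] by linarith
    qed simp
    then obtain y where y: "y \<in> M" "\<And>b. b \<in> ?B \<Longrightarrow> \<bar>d y b - mdist X (u n) (e1 b)\<bar> \<le> 1 / Suc n" by blast
    obtain e2 where e2: "partial_isometry d X (insert y ?B) e2" "\<forall>a \<in> ?B. e2 a = e1 a"
      "\<exists>a \<in> insert y ?B. mdist X (e2 a) (u n) \<le> 1 / Suc n"
      using partial_isometry_back[OF X(1) B e1(1) uX y] by blast
    have "P (insert y ?B, e2)" using e2(1) B y(1) by (simp add: P_def)
    moreover have "R n s (insert y ?B, e2)" using e2 e1(2) by (auto simp: R_def A_def)
    ultimately show "\<exists>s'. P s' \<and> R n s s'" by blast
  qed
  then obtain f where fP: "\<And>n. P (f n)" and fR: "\<And>n. R n (f n) (f (Suc n))" by blast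
  have mono: "fst (f n) \<subseteq> fst (f (n + m)) \<and> (\<forall>a \<in> fst (f n). snd (f (n + m)) a = snd (f n) a)" for n m
  proof (induction m)
    case (Suc m)
    then show ?case using fR[of "n + m"] unfolding R_def by (auto simp: subset_iff)
  qed simp
  have mono': "fst (f n) \<subseteq> fst (f k)" "a \<in> fst (f n) \<Longrightarrow> snd (f k) a = snd (f n) a" if "n \<le> k" for n k a
    using mono[of n "k - n"] that by auto
  \<comment> \<open>\<open>R n\<close> speaks about the state after step \<open>n\<close>, hence the
    \<open>Suc\<close>.\<close>
  define idx where "idx y = Suc (to_nat_on M y)" for y
  have idx: "y \<in> fst (f (idx y))" if "y \<in> M" for y
    using fR[of "to_nat_on M y"] that M(1) by (simp add: R_def idx_def z_def)
  define e where "e y = snd (f (idx y)) y" for y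
  have e_eq: "e y = snd (f n) y" if "y \<in> fst (f n)" for y n
  proof -
    have yM: "y \<in> M" using fP[of n] that by (auto simp: P_def)
    show ?thesis
      using mono'(2)[of n "max n (idx y)" y] mono'(2)[of "idx y" "max n (idx y)" y] idx[OF yM] that
      by (simp add: e_def)
  qed
  have "partial_isometry d X M e"
    unfolding partial_isometry_def
  proof (intro conjI ballI)
    fix a assume a: "a \<in> M"
    show "e a \<in> mspace X"
      using idx[OF a] fP[of "idx a"] by (auto simp: P_def e_def partial_isometry_def)
    fix b assume b: "b \<in> M"
    define k where "k = max (idx a) (idx b)"
    have ab: "a \<in> fst (f k)" "b \<in> fst (f k)"
      using idx[OF a] idx[OF b] mono'(1)[of "idx a" k] mono'(1)[of "idx b" k] by (auto simp: k_def)
    have "partial_isometry d X (fst (f k)) (snd (f k))" using fP[of k] by (simp add: P_def)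
    from partial_isometryD(2)[OF this ab] show "mdist X (e a) (e b) = d a b"
      using e_eq[OF ab(1)] e_eq[OF ab(2)] by simp
  qed
  moreover have "\<exists>y \<in> M. mdist X p (e y) < \<epsilon>" if p: "p \<in> mspace X" and \<epsilon>: "\<epsilon> > 0" for p \<epsilon>
  proof -
    have "p \<in> X.mtopology closure_of C" using C(3) p by (simp add: mtopology_of_def)
    then obtain c where c: "c \<in> C" "mdist X p c < \<epsilon>/2"
      using \<epsilon> unfolding X.metric_closure_of by (force dest: spec[of _ "\<epsilon>/2"])
    obtain N where N: "1 / Suc N < \<epsilon>/2" using nat_approx_posE[of "\<epsilon>/2"] \<epsilon> by auto
    define n where "n = prod_encode (to_nat_on C c, N)"
    have un: "u n = c" using c(1) C(1) by (simp add: u_def n_def)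
    have "N \<le> n" unfolding n_def by (rule le_prod_encode_2)
    then have n: "1 / Suc n < \<epsilon>/2" using N by (smt (verit) frac_le of_nat_0_less_iff of_nat_mono Suc_le_mono zero_less_Suc)
    obtain y where y: "y \<in> fst (f (Suc n))" "mdist X (snd (f (Suc n)) y) c \<le> 1 / Suc n"
      using fR[of n] un by (auto simp: R_def)
    have yM: "y \<in> M" using fP[of "Suc n"] y(1) by (auto simp: P_def)
    have ey: "e y = snd (f (Suc n)) y" by (rule e_eq[OF y(1)])
    have "e y \<in> mspace X" using \<open>partial_isometry d X M e\<close> yM by (simp add: partial_isometry_def)
    then have "mdist X p (e y) \<le> mdist X p c + mdist X c (e y)"
      using p c(1) C(2) by (intro mdist_triangle) auto
    then show ?thesis using c(2) y(2) n ey yM mdist_commute[of X c "e y"] by (intro bexI[of _ y]) auto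
  qed
  ultimately show ?thesis by blast
qed

lemma partial_isometry_extend_dense:
  assumes e: "partial_isometry d X Y e" and Y: "Y \<subseteq> M" and X: "mcomplete_of X"
    and dense: "\<And>x \<epsilon>. \<lbrakk>x \<in> M; 0 < \<epsilon>\<rbrakk> \<Longrightarrow> \<exists>y \<in> Y. d x y < \<epsilon>"
  shows "\<exists>e'. partial_isometry d X M e' \<and> (\<forall>y \<in> Y. e' y = e y)"
proof -
  interpret X: Metric_space "mspace X" "mdist X" by simp
  have YM: "y \<in> M" if "y \<in> Y" for y using that Y by blast
  note eD = partial_isometryD[OF e]
  have "\<exists>p \<in> mspace X. \<forall>\<epsilon>>0. \<exists>y \<in> Y. d x y < \<epsilon> \<and> mdist X p (e y) < \<epsilon>" if x: "x \<in> M" for x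
  proof -
    have "\<forall>n. \<exists>y \<in> Y. d x y < 1 / Suc n" using dense[OF x] by simp
    then obtain y where y: "\<And>n. y n \<in> Y" "\<And>n. d x (y n) < 1 / Suc n" by metis
    have small: "\<exists>N. \<forall>n\<ge>N. 1 / Suc n < \<epsilon>" if "\<epsilon> > 0" for \<epsilon> :: real
    proof -
      obtain N where N: "1 / Suc N < \<epsilon>" using nat_approx_posE[OF \<open>\<epsilon> > 0\<close>] by auto
      have "1 / Suc n < \<epsilon>" if "n \<ge> N" for n
      proof -
        have "1 / Suc n \<le> 1 / real (Suc N)" using that by (intro divide_left_mono) auto
        then show ?thesis using N by linarith
      qed
      then show ?thesis by blast
    qed
    have "X.MCauchy (\<lambda>n. e (y n))"
      unfolding X.MCauchy_def
    proof (intro conjI allI impI)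
      show "range (\<lambda>n. e (y n)) \<subseteq> mspace X" using eD(1) y(1) by auto
      fix \<epsilon> :: real assume "\<epsilon> > 0"
      then obtain N where N: "\<forall>n\<ge>N. 1 / Suc n < \<epsilon>/2" using small[of "\<epsilon>/2"] by auto
      have "mdist X (e (y n)) (e (y m)) < \<epsilon>" if "N \<le> n" "N \<le> m" for n m
      proof -
        have "d (y n) (y m) \<le> d x (y n) + d x (y m)"
          using triangle''[OF YM[OF y(1)] x YM[OF y(1)]] by simp
        then show ?thesis using y(2)[of n] y(2)[of m] N that eD(2)[OF y(1) y(1)]
          by (smt (verit) field_sum_of_halves)
      qed
      then show "\<exists>N. \<forall>n n'. N \<le> n \<longrightarrow> N \<le> n' \<longrightarrow> mdist X (e (y n)) (e (y n')) < \<epsilon>" by blast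
    qed
    then obtain p where p: "limitin X.mtopology (\<lambda>n. e (y n)) p sequentially"
      using X unfolding mcomplete_of_def X.mcomplete_def by blast
    have pX: "p \<in> mspace X" using X.limitin_mspace[OF p] .
    have "\<exists>y \<in> Y. d x y < \<epsilon> \<and> mdist X p (e y) < \<epsilon>" if \<epsilon>: "\<epsilon> > 0" for \<epsilon>
    proof -
      obtain N1 where N1: "\<forall>n\<ge>N1. 1 / Suc n < \<epsilon>" using small[OF \<epsilon>] by blast
      obtain N2 where N2: "\<forall>n\<ge>N2. mdist X (e (y n)) p < \<epsilon>"
        using p \<epsilon> unfolding X.limit_metric_sequentially by blast
      let ?n = "max N1 N2"
      have "d x (y ?n) < \<epsilon>" using y(2)[of ?n] N1 by (smt (verit) max.cobounded1)
      moreover have "mdist X p (e (y ?n)) < \<epsilon>" using N2 mdist_commute[of X p] by simp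
      ultimately show ?thesis using y(1) by blast
    qed
    then show ?thesis using pX by blast
  qed
  then obtain e' where e': "\<And>x. x \<in> M \<Longrightarrow> e' x \<in> mspace X"
    "\<And>x \<epsilon>. \<lbrakk>x \<in> M; \<epsilon> > 0\<rbrakk> \<Longrightarrow> \<exists>y \<in> Y. d x y < \<epsilon> \<and> mdist X (e' x) (e y) < \<epsilon>" by metis
  have "mdist X (e' x) (e' x') = d x x'" if x: "x \<in> M" "x' \<in> M" for x x'
  proof -
    have "\<bar>mdist X (e' x) (e' x') - d x x'\<bar> \<le> 0 + \<epsilon>" if \<epsilon>: "\<epsilon> > 0" for \<epsilon>
    proof -
      obtain y where y: "y \<in> Y" "d x y < \<epsilon>/4" "mdist X (e' x) (e y) < \<epsilon>/4" using e'(2)[OF x(1), of "\<epsilon>/4"] \<epsilon> by auto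
      obtain y' where y': "y' \<in> Y" "d x' y' < \<epsilon>/4" "mdist X (e' x') (e y') < \<epsilon>/4" using e'(2)[OF x(2), of "\<epsilon>/4"] \<epsilon> by auto
      have "\<bar>d x x' - d y y'\<bar> \<le> d x y + d x' y'"
        using triangle[OF x(1) YM[OF y(1)] x(2)] triangle[OF YM[OF y(1)] YM[OF y'(1)] x(2)]
          triangle[OF YM[OF y(1)] x(1) YM[OF y'(1)]] triangle[OF x(1) x(2) YM[OF y'(1)]]
          commute[of x y] commute[of x' y'] by linarith
      moreover have "\<bar>mdist X (e' x) (e' x') - mdist X (e y) (e y')\<bar> \<le> mdist X (e' x) (e y) + mdist X (e' x') (e y')"
        using mdist_triangle[OF e'(1)[OF x(1)] eD(1)[OF y(1)] e'(1)[OF x(2)]]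
          mdist_triangle[OF eD(1)[OF y(1)] eD(1)[OF y'(1)] e'(1)[OF x(2)]]
          mdist_triangle[OF eD(1)[OF y(1)] e'(1)[OF x(1)] eD(1)[OF y'(1)]]
          mdist_triangle[OF e'(1)[OF x(1)] e'(1)[OF x(2)] eD(1)[OF y'(1)]]
          mdist_commute[of X "e' x" "e y"] mdist_commute[of X "e' x'" "e y'"] by linarith
      ultimately show ?thesis using eD(2)[OF y(1) y'(1)] y y' by linarith
    qed
    then have "\<bar>mdist X (e' x) (e' x') - d x x'\<bar> \<le> 0" by (rule field_le_epsilon)
    then show ?thesis by simp
  qed
  moreover have "e' y = e y" if y: "y \<in> Y" for y
  proof -
    have "mdist X (e' y) (e y) \<le> 0 + \<epsilon>" if \<epsilon>: "\<epsilon> > 0" for \<epsilon>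
    proof -
      obtain w where w: "w \<in> Y" "d y w < \<epsilon>/2" "mdist X (e' y) (e w) < \<epsilon>/2"
        using e'(2)[OF YM[OF y], of "\<epsilon>/2"] \<epsilon> by auto
      have "mdist X (e' y) (e y) \<le> mdist X (e' y) (e w) + mdist X (e w) (e y)"
        using e'(1)[OF YM[OF y]] eD(1) w y by (intro mdist_triangle) auto
      then show ?thesis using eD(2)[OF w(1) y] w commute[of w y] by simp
    qed
    then have "mdist X (e' y) (e y) \<le> 0" by (rule field_le_epsilon)
    then have "mdist X (e' y) (e y) = 0" using mdist_nonneg[of X "e' y" "e y"] by linarith
    then show ?thesis
      using Metric_space.zero[OF Metric_space_mspace_mdist e'(1)[OF YM[OF y]] eD(1)[OF y]] by simp
  qed
  ultimately show ?thesis using e'(1) unfolding partial_isometry_def by (intro exI[of _ e']) simp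
qed

end

section \<open>The action on the Urysohn space\<close>

context layered
begin

sublocale DM: Metric_space "carrier G \<times> (UNIV :: nat set)" D
  by (rule D_metric)

lemma D_translate:
  assumes "g \<in> carrier G" "h \<in> carrier G"
  shows "D (g, k) (h, l) = D (inv h \<otimes> g, k) (\<one>, l)"
  using D_invariant[of "inv h" "(g, k)" "(h, l)"] assms by simp

lemma d_translate:
  assumes "g \<in> carrier G" "h \<in> carrier G"
  shows "d (inv h \<otimes> g) \<one> = d g h"
  using left_invariant[of "inv h" g h] assms by simp

lemma layer_near:
  assumes "0 < e"
  shows "\<exists>\<delta>>0. \<forall>g \<in> carrier G. \<forall>h \<in> carrier G. d g h < \<delta> \<longrightarrow> D (g, k) (h, k) < e"
proof -
  obtain \<delta> where \<delta>: "\<delta> > 0" "\<forall>g \<in> carrier G. d g \<one> < \<delta> \<longrightarrow> D (g, k) (\<one>, k) < e"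
    using layer_continuous[OF assms] by blast
  have "D (g, k) (h, k) < e" if "g \<in> carrier G" "h \<in> carrier G" "d g h < \<delta>" for g h
    using \<delta>(2)[THEN bspec, of "inv h \<otimes> g"] that d_translate[OF that(1,2)] D_translate[OF that(1,2)] by simp
  then show ?thesis using \<delta>(1) by blast
qed

lemma near_layer:
  assumes "0 < e"
  shows "\<exists>\<delta>>0. \<forall>g \<in> carrier G. \<forall>h \<in> carrier G. D (g, k) (h, k) < \<delta> \<longrightarrow> d g h < e"
proof -
  obtain \<delta> where \<delta>: "\<delta> > 0" "\<forall>g \<in> carrier G. D (g, k) (\<one>, k) < \<delta> \<longrightarrow> d g \<one> < e"
    using layer_separating[OF assms] by blast
  have "d g h < e" if "g \<in> carrier G" "h \<in> carrier G" "D (g, k) (h, k) < \<delta>" for g h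
    using \<delta>(2)[THEN bspec, of "inv h \<otimes> g"] that d_translate[OF that(1,2)] D_translate[OF that(1,2)] by simp
  then show ?thesis using \<delta>(1) by blast
qed

lemma layer_dense:
  assumes "x \<in> carrier G \<times> UNIV" "0 < e"
  shows "\<exists>y \<in> H. D x (y, snd x) < e"
proof -
  obtain g k where x: "x = (g, k)" "g \<in> carrier G" using assms(1) by blast
  obtain \<delta> where \<delta>: "\<delta> > 0" "\<forall>g \<in> carrier G. \<forall>h \<in> carrier G. d g h < \<delta> \<longrightarrow> D (g, k) (h, k) < e"
    using layer_near[OF assms(2)] by blast
  obtain y where y: "y \<in> H" "d g y < \<delta>" using H_dense[OF x(2) \<delta>(1)] by blast
  then have "D (g, k) (y, k) < e" using \<delta>(2) x(2) H(2) by blast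
  then show ?thesis using y(1) x(1) by auto
qed

text \<open>Translation by \<open>inv g\<close> moves \<open>(g, n)\<close> to
  \<open>(\<one>, n)\<close> and stays within the earlier layers, where the minimum formula of the
  marker is known.\<close>

lemma marker_dist:
  assumes m: "marker_at D n c S" and g: "g \<in> carrier G" and x: "x \<in> carrier G \<times> {..<n}"
  shows "s \<in> S \<Longrightarrow> D (g, n) x \<le> c + D (act g s) x"
    and "\<exists>s \<in> S. D (g, n) x = c + D (act g s) x"
proof -
  have S: "finite S" "S \<noteq> {}" "S \<subseteq> carrier G \<times> {..<n}" using m unfolding marker_at_def by simp_all
  have y: "act (inv g) x \<in> carrier G \<times> {..<n}" using x g by simp
  have xU: "x \<in> carrier G \<times> UNIV" using x by auto
  have "D (g, n) x = D (act (inv g) (g, n)) (act (inv g) x)"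
    using D_invariant[of "inv g" "(g, n)" x] g xU by simp
  also have "\<dots> = Min ((\<lambda>s. c + D s (act (inv g) x)) ` S)"
  proof -
    have "\<forall>x \<in> carrier G \<times> {..<n}. D (\<one>, n) x = Min ((\<lambda>s. c + D s x) ` S)"
      using m unfolding marker_at_def by (elim conjE)
    from this[THEN bspec, OF y] show ?thesis using g by simp
  qed
  also have "(\<lambda>s. c + D s (act (inv g) x)) ` S = (\<lambda>s. c + D (act g s) x) ` S"
  proof (rule image_cong[OF refl])
    fix s assume "s \<in> S"
    then have s: "s \<in> carrier G \<times> UNIV" using S(3) by auto
    have "D (act g s) (act g (act (inv g) x)) = D s (act (inv g) x)"
      using g s xU by (intro D_invariant) auto
    then show "c + D s (act (inv g) x) = c + D (act g s) x" using act_inv(2)[OF g xU] by simp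
  qed
  finally have eq: "D (g, n) x = Min ((\<lambda>s. c + D (act g s) x) ` S)" .
  show "D (g, n) x \<le> c + D (act g s) x" if "s \<in> S"
    unfolding eq using S that by (intro Min_le) auto
  have "D (g, n) x \<in> (\<lambda>s. c + D (act g s) x) ` S"
    unfolding eq using S by (intro Min_in) auto
  then show "\<exists>s \<in> S. D (g, n) x = c + D (act g s) x" by blast
qed

end

locale realized = layered G d H D M for G (structure) and d H D M +
  fixes U :: "'u metric" and e :: "'a \<times> nat \<Rightarrow> 'u"
  assumes U_complete: "mcomplete_of U"
    and e_isometry: "partial_isometry D U (carrier G \<times> UNIV) e"
    and e_dense: "\<lbrakk>u \<in> mspace U; 0 < \<epsilon>\<rbrakk> \<Longrightarrow> \<exists>x \<in> carrier G \<times> UNIV. mdist U u (e x) < \<epsilon>"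

text \<open>The back-and-forth needs a countable source and is run on
  \<open>H \<times> UNIV\<close>. Its image is already dense; completeness of U extends the
  embedding to all of G in every layer.\<close>

lemma (in layered) realized_exists:
  assumes "urysohn_space U"
  shows "\<exists>e. realized G d H D M U e"
proof -
  have U: "mcomplete_of U" "separable_space (mtopology_of U)" "finitely_injective U"
    using assms unfolding urysohn_space_def by simp_all
  have HG: "H \<times> UNIV \<subseteq> carrier G \<times> (UNIV :: nat set)" using H(2) by auto
  interpret HM: Metric_space "H \<times> (UNIV :: nat set)" D by (rule DM.subspace[OF HG])
  have "\<exists>e0. partial_isometry D U (H \<times> (UNIV :: nat set)) e0 \<and>
    (\<forall>u \<in> mspace U. \<forall>\<epsilon>>0. \<exists>y \<in> H \<times> UNIV. mdist U u (e0 y) < \<epsilon>)"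
  proof (rule HM.dense_isometric_embedding[OF U(3,2)])
    show "countable (H \<times> (UNIV :: nat set))" using H(1) by simp
    show "H \<times> (UNIV :: nat set) \<noteq> {}" using H(3) by auto
  qed (rule approx_extension)
  then obtain e0 where e0: "partial_isometry D U (H \<times> (UNIV :: nat set)) e0"
    "\<forall>u \<in> mspace U. \<forall>\<epsilon>>0. \<exists>y \<in> H \<times> UNIV. mdist U u (e0 y) < \<epsilon>" by blast
  have "\<exists>e. partial_isometry D U (carrier G \<times> UNIV) e \<and> (\<forall>y \<in> H \<times> UNIV. e y = e0 y)"
  proof (rule DM.partial_isometry_extend_dense[OF e0(1) HG U(1)])
    fix x :: "'a \<times> nat" and \<epsilon> :: real assume x: "x \<in> carrier G \<times> UNIV" "0 < \<epsilon>"
    obtain y where "y \<in> H" "D x (y, snd x) < \<epsilon>" using layer_dense[OF x] by blast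
    then show "\<exists>y \<in> H \<times> UNIV. D x y < \<epsilon>" by (intro bexI[of _ "(y, snd x)"]) auto
  qed
  then obtain e where e: "partial_isometry D U (carrier G \<times> UNIV) e" "\<forall>y \<in> H \<times> UNIV. e y = e0 y"
    by blast
  have "realized G d H D M U e"
  proof
    show "mcomplete_of U" "partial_isometry D U (carrier G \<times> UNIV) e" by (fact U(1) e(1))+
    fix u and \<epsilon> :: real assume u: "u \<in> mspace U" "0 < \<epsilon>"
    obtain y where y: "y \<in> H \<times> (UNIV :: nat set)" "mdist U u (e0 y) < \<epsilon>" using e0(2) u by blast
    then have "mdist U u (e y) < \<epsilon>" using e(2)[THEN bspec, OF y(1)] by simp
    then show "\<exists>x \<in> carrier G \<times> UNIV. mdist U u (e x) < \<epsilon>" using y(1) HG by blast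
  qed
  then show ?thesis by blast
qed

context realized
begin

sublocale V: Metric_space "mspace U" "mdist U"
  by simp

lemma e_mem [simp]: "x \<in> carrier G \<times> UNIV \<Longrightarrow> e x \<in> mspace U"
  using partial_isometryD(1)[OF e_isometry] .

lemma e_dist [simp]: "\<lbrakk>x \<in> carrier G \<times> UNIV; y \<in> carrier G \<times> UNIV\<rbrakk> \<Longrightarrow> mdist U (e x) (e y) = D x y"
  using partial_isometryD(2)[OF e_isometry] .

lemma e_inj: "inj_on e (carrier G \<times> UNIV)"
  by (rule DM.partial_isometry_inj_on[OF e_isometry]) simp

lemma isometries_agree:
  assumes f: "partial_isometry (mdist U) U (mspace U) f" "partial_isometry (mdist U) U (mspace U) f'"
    and Y: "Y \<subseteq> mspace U" and p: "p \<in> mspace U" "\<And>\<epsilon>. \<epsilon> > 0 \<Longrightarrow> \<exists>q \<in> Y. mdist U p q < \<epsilon>"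
    and agree: "\<And>q. q \<in> Y \<Longrightarrow> f q = f' q"
  shows "f p = f' p"
proof -
  note F = partial_isometryD[OF f(1)] and F' = partial_isometryD[OF f(2)]
  have "mdist U (f p) (f' p) \<le> 0 + \<epsilon>" if \<epsilon>: "\<epsilon> > 0" for \<epsilon>
  proof -
    obtain q where q: "q \<in> Y" "mdist U p q < \<epsilon>/2" using p(2)[of "\<epsilon>/2"] \<epsilon> by auto
    have qV: "q \<in> mspace U" using q(1) Y by blast
    have "mdist U (f p) (f' p) \<le> mdist U (f p) (f q) + mdist U (f' q) (f' p)"
      using V.triangle[OF F(1)[OF p(1)] F(1)[OF qV] F'(1)[OF p(1)]] agree[OF q(1)] by simp
    also have "\<dots> = mdist U p q + mdist U q p" using F(2)[OF p(1) qV] F'(2)[OF qV p(1)] by simp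
    finally show ?thesis using q(2) V.commute[of p q] by simp
  qed
  then have "mdist U (f p) (f' p) \<le> 0" by (rule field_le_epsilon)
  then have "mdist U (f p) (f' p) = 0" using V.nonneg[of "f p" "f' p"] by linarith
  then show ?thesis using V.zero[OF F(1)[OF p(1)] F'(1)[OF p(1)]] by simp
qed

lemma action_exists:
  assumes g: "g \<in> carrier G"
  shows "\<exists>f. partial_isometry (mdist U) U (mspace U) f \<and> (\<forall>x \<in> carrier G \<times> UNIV. f (e x) = e (act g x))"
proof -
  let ?X = "carrier G \<times> (UNIV :: nat set)"
  define f0 where "f0 p = e (act g (inv_into ?X e p))" for p
  have f0: "f0 (e x) = e (act g x)" if "x \<in> ?X" for x using e_inj that by (simp add: f0_def)
  have "partial_isometry (mdist U) U (e ` ?X) f0"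
    unfolding partial_isometry_def
  proof (intro conjI ballI)
    fix p assume "p \<in> e ` ?X"
    then obtain x where x: "x \<in> ?X" "p = e x" by blast
    show "f0 p \<in> mspace U" unfolding x(2) f0[OF x(1)] by (intro e_mem act_mem g x)
    fix q assume "q \<in> e ` ?X"
    then obtain y where y: "y \<in> ?X" "q = e y" by blast
    show "mdist U (f0 p) (f0 q) = mdist U p q"
      unfolding x(2) y(2) f0[OF x(1)] f0[OF y(1)]
      using e_dist[OF act_mem[OF g x(1)] act_mem[OF g y(1)]] e_dist[OF x(1) y(1)] D_invariant[OF g x(1) y(1)]
      by simp
  qed
  moreover have "e ` ?X \<subseteq> mspace U" by (rule image_subsetI) (rule e_mem)
  moreover have "\<exists>p \<in> e ` ?X. mdist U u p < \<epsilon>" if "u \<in> mspace U" "0 < \<epsilon>" for u \<epsilon>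
    using e_dense[OF that] by blast
  ultimately have "\<exists>f. partial_isometry (mdist U) U (mspace U) f \<and> (\<forall>p \<in> e ` ?X. f p = f0 p)"
    by (intro V.partial_isometry_extend_dense[OF _ _ U_complete])
  then obtain f where f: "partial_isometry (mdist U) U (mspace U) f" "\<forall>p \<in> e ` ?X. f p = f0 p" by blast
  have "f (e x) = e (act g x)" if "x \<in> ?X" for x using f(2)[THEN bspec, OF imageI[OF that]] f0[OF that] by simp
  then show ?thesis using f(1) by blast
qed

text \<open>Density of the image of \<open>e\<close> determines the isometry on
  \<open>mspace U\<close>, and the restriction makes \<open>\<alpha> g\<close> extensional, as
  \<open>Iso U\<close> demands.\<close>

definition \<alpha> :: "'a \<Rightarrow> 'u \<Rightarrow> 'u"
  where "\<alpha> g = restrict (SOME f. partial_isometry (mdist U) U (mspace U) f \<and>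
    (\<forall>x \<in> carrier G \<times> UNIV. f (e x) = e (act g x))) (mspace U)"

lemma \<alpha>_isometry: "g \<in> carrier G \<Longrightarrow> partial_isometry (mdist U) U (mspace U) (\<alpha> g)"
  and \<alpha>_e: "\<lbrakk>g \<in> carrier G; x \<in> carrier G \<times> UNIV\<rbrakk> \<Longrightarrow> \<alpha> g (e x) = e (act g x)"
proof -
  assume g: "g \<in> carrier G"
  let ?f = "SOME f. partial_isometry (mdist U) U (mspace U) f \<and> (\<forall>x \<in> carrier G \<times> UNIV. f (e x) = e (act g x))"
  have f: "partial_isometry (mdist U) U (mspace U) ?f" "\<forall>x \<in> carrier G \<times> UNIV. ?f (e x) = e (act g x)"
    using someI_ex[OF action_exists[OF g]] by blast+
  show "partial_isometry (mdist U) U (mspace U) (\<alpha> g)"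
    using f(1) unfolding \<alpha>_def partial_isometry_def by simp
  assume x: "x \<in> carrier G \<times> UNIV"
  show "\<alpha> g (e x) = e (act g x)"
    using f(2)[THEN bspec, OF x] e_mem[OF x] unfolding \<alpha>_def by simp
qed

lemma \<alpha>_mem: "\<lbrakk>g \<in> carrier G; p \<in> mspace U\<rbrakk> \<Longrightarrow> \<alpha> g p \<in> mspace U"
  by (rule partial_isometryD(1)[OF \<alpha>_isometry])

lemma \<alpha>_dist: "\<lbrakk>g \<in> carrier G; p \<in> mspace U; q \<in> mspace U\<rbrakk> \<Longrightarrow> mdist U (\<alpha> g p) (\<alpha> g q) = mdist U p q"
  by (rule partial_isometryD(2)[OF \<alpha>_isometry])

lemma partial_isometry_e_eqI:
  assumes "partial_isometry (mdist U) U (mspace U) f" "partial_isometry (mdist U) U (mspace U) f'"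
    and "\<And>x. x \<in> carrier G \<times> UNIV \<Longrightarrow> f (e x) = f' (e x)" and "p \<in> mspace U"
  shows "f p = f' p"
proof (rule isometries_agree[OF assms(1,2) _ assms(4)])
  show "e ` (carrier G \<times> UNIV) \<subseteq> mspace U" by (rule image_subsetI) (rule e_mem)
  show "\<exists>q \<in> e ` (carrier G \<times> UNIV). mdist U p q < \<epsilon>" if "\<epsilon> > 0" for \<epsilon>
    using e_dense[OF assms(4) that] by blast
  show "f q = f' q" if "q \<in> e ` (carrier G \<times> UNIV)" for q using that assms(3) by blast
qed

lemma \<alpha>_mult:
  assumes "g \<in> carrier G" "h \<in> carrier G" "p \<in> mspace U"
  shows "\<alpha> g (\<alpha> h p) = \<alpha> (g \<otimes> h) p"
proof (rule partial_isometry_e_eqI[of "\<lambda>p. \<alpha> g (\<alpha> h p)"])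
  show "partial_isometry (mdist U) U (mspace U) (\<lambda>p. \<alpha> g (\<alpha> h p))"
    unfolding partial_isometry_def using assms by (simp add: \<alpha>_mem \<alpha>_dist)
  show "partial_isometry (mdist U) U (mspace U) (\<alpha> (g \<otimes> h))" using assms by (simp add: \<alpha>_isometry)
  show "\<alpha> g (\<alpha> h (e x)) = \<alpha> (g \<otimes> h) (e x)" if x: "x \<in> carrier G \<times> UNIV" for x
    using \<alpha>_e[OF assms(2) x] \<alpha>_e[OF assms(1) act_mem[OF assms(2) x]] \<alpha>_e[OF m_closed[OF assms(1,2)] x]
      act_mult[OF assms(1,2) x] by simp
qed (fact assms)

lemma \<alpha>_one: "p \<in> mspace U \<Longrightarrow> \<alpha> \<one> p = p"
proof (rule partial_isometry_e_eqI[of "\<alpha> \<one>" "\<lambda>p. p"])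
  show "partial_isometry (mdist U) U (mspace U) (\<alpha> \<one>)" by (simp add: \<alpha>_isometry)
  show "partial_isometry (mdist U) U (mspace U) (\<lambda>p. p)" by (simp add: partial_isometry_def)
  show "\<alpha> \<one> (e x) = e x" if "x \<in> carrier G \<times> UNIV" for x
    using \<alpha>_e[OF one_closed that] act_one[OF that] by simp
qed

lemma \<alpha>_inv: "\<lbrakk>g \<in> carrier G; p \<in> mspace U\<rbrakk> \<Longrightarrow> \<alpha> g (\<alpha> (inv g) p) = p"
  using \<alpha>_mult[of g "inv g" p] \<alpha>_one by simp

section \<open>The closed set of markers\<close>

definition F :: "'u set"
  where "F = mtopology_of U closure_of (e ` (carrier G \<times> M))"

lemma F_iff: "p \<in> F \<longleftrightarrow> p \<in> mspace U \<and> (\<forall>\<epsilon>>0. \<exists>x \<in> carrier G \<times> M. mdist U p (e x) < \<epsilon>)"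
proof -
  have "F = {p \<in> mspace U. \<forall>\<epsilon>>0. \<exists>q \<in> e ` (carrier G \<times> M). q \<in> V.mball p \<epsilon>}"
    unfolding F_def mtopology_of_def V.metric_closure_of ..
  moreover have "(\<exists>q \<in> e ` (carrier G \<times> M). q \<in> V.mball p \<epsilon>) \<longleftrightarrow> (\<exists>x \<in> carrier G \<times> M. mdist U p (e x) < \<epsilon>)"
    if "p \<in> mspace U" for \<epsilon>
    using that by (auto simp: e_mem)
  ultimately show ?thesis by auto
qed

lemma F_closed: "closedin (mtopology_of U) F"
  unfolding F_def by simp

lemma F_subset: "F \<subseteq> mspace U"
  using F_iff by blast

lemma e_F: "\<lbrakk>g \<in> carrier G; m \<in> M\<rbrakk> \<Longrightarrow> e (g, m) \<in> F"
  unfolding F_iff using V.mdist_zero[of "e (g, m)"] by (intro conjI allI impI bexI[of _ "(g, m)"]) auto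

lemma \<alpha>_F:
  assumes g: "g \<in> carrier G" and p: "p \<in> F"
  shows "\<alpha> g p \<in> F"
  unfolding F_iff
proof (intro conjI allI impI)
  have pV: "p \<in> mspace U" using p F_subset by blast
  then show "\<alpha> g p \<in> mspace U" using g by (simp add: \<alpha>_mem)
  fix \<epsilon> :: real assume "\<epsilon> > 0"
  then obtain x where x: "x \<in> carrier G \<times> M" "mdist U p (e x) < \<epsilon>" using p unfolding F_iff by blast
  have xU: "x \<in> carrier G \<times> UNIV" using x(1) by auto
  have "mdist U (\<alpha> g p) (e (act g x)) < \<epsilon>"
    using \<alpha>_dist[OF g pV e_mem[OF xU]] \<alpha>_e[OF g xU] x(2) by simp
  then show "\<exists>x \<in> carrier G \<times> M. mdist U (\<alpha> g p) (e x) < \<epsilon>"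
    using act_mem[OF g x(1)] by (intro bexI[of _ "act g x"])
qed

lemma \<alpha>_image_F: "g \<in> carrier G \<Longrightarrow> \<alpha> g ` F = F"
proof
  assume g: "g \<in> carrier G"
  show "\<alpha> g ` F \<subseteq> F" using \<alpha>_F[OF g] by blast
  show "F \<subseteq> \<alpha> g ` F"
  proof
    fix p assume p: "p \<in> F"
    have "\<alpha> (inv g) p \<in> F" using g p by (simp add: \<alpha>_F)
    moreover have "p = \<alpha> g (\<alpha> (inv g) p)" using \<alpha>_inv[OF g] p F_subset by auto
    ultimately show "p \<in> \<alpha> g ` F" by blast
  qed
qed

lemma \<alpha>_image: "g \<in> carrier G \<Longrightarrow> \<alpha> g ` mspace U = mspace U"
proof
  assume g: "g \<in> carrier G"
  show "\<alpha> g ` mspace U \<subseteq> mspace U" using \<alpha>_mem[OF g] by blast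
  show "mspace U \<subseteq> \<alpha> g ` mspace U"
  proof
    fix p assume p: "p \<in> mspace U"
    have "\<alpha> (inv g) p \<in> mspace U" using g p by (simp add: \<alpha>_mem)
    moreover have "p = \<alpha> g (\<alpha> (inv g) p)" using \<alpha>_inv[OF g p] by simp
    ultimately show "p \<in> \<alpha> g ` mspace U" by blast
  qed
qed

text \<open>For \<open>p\<close> near \<open>e (a, k)\<close> and \<open>q\<close> near
  \<open>e (b, l)\<close>, a marker over \<open>(a, k)\<close> has distance \<open>c\<close> to the
  first point and \<open>c + D (a, k) (b, l)\<close> to the second. Equal distances to
  \<open>p\<close> and \<open>q\<close> cancel \<open>c\<close> and make
  \<open>D (a, k) (b, l)\<close> small.\<close>

lemma F_determines:
  assumes p: "p \<in> mspace U" and q: "q \<in> mspace U" and eq: "\<And>x. x \<in> F \<Longrightarrow> mdist U x p = mdist U x q"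
  shows "p = q"
proof -
  have "mdist U p q \<le> 0 + \<epsilon>" if \<epsilon>: "\<epsilon> > 0" for \<epsilon>
  proof -
    have near: "\<exists>h \<in> H. \<exists>k. mdist U u (e (h, k)) < \<epsilon>/8" if u: "u \<in> mspace U" for u
    proof -
      obtain x where x: "x \<in> carrier G \<times> UNIV" "mdist U u (e x) < \<epsilon>/16" using e_dense[OF u, of "\<epsilon>/16"] \<epsilon> by auto
      obtain y where y: "y \<in> H" "D x (y, snd x) < \<epsilon>/16" using layer_dense[OF x(1), of "\<epsilon>/16"] \<epsilon> by auto
      have yU: "(y, snd x) \<in> carrier G \<times> UNIV" using y(1) H(2) by auto
      have "mdist U u (e (y, snd x)) < \<epsilon>/8"
        using V.triangle[OF u e_mem[OF x(1)] e_mem[OF yU]] e_dist[OF x(1) yU] x(2) y(2) by linarith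
      then show ?thesis using y(1) by blast
    qed
    obtain a k where a: "a \<in> H" "mdist U p (e (a, k)) < \<epsilon>/8" using near[OF p] by blast
    obtain b l where b: "b \<in> H" "mdist U q (e (b, l)) < \<epsilon>/8" using near[OF q] by blast
    have ab: "(a, k) \<in> carrier G \<times> UNIV" "(b, l) \<in> carrier G \<times> UNIV" using a(1) b(1) H(2) by auto
    \<comment> \<open>The marker formula covers earlier layers only, so the marker must come after
      the layers of both points.\<close>
    obtain n c where n: "n \<ge> Suc (max k l)" "n \<in> M" "marker_at D n c {(a, k)}"
      using marker_exists[of "{(a, k)}" "Suc (max k l)"] a(1) by auto
    have abn: "(a, k) \<in> carrier G \<times> {..<n}" "(b, l) \<in> carrier G \<times> {..<n}" using ab n(1) by auto
    have n1: "(\<one>, n) \<in> carrier G \<times> UNIV" by simp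
    have "D (\<one>, n) (a, k) = c + D (a, k) (a, k)" "D (\<one>, n) (b, l) = c + D (a, k) (b, l)"
      using marker_dist(2)[OF n(3) one_closed abn(1)] marker_dist(2)[OF n(3) one_closed abn(2)] ab by simp_all
    then have Dn: "D (\<one>, n) (a, k) = c" "D (\<one>, n) (b, l) = c + D (a, k) (b, l)"
      using DM.mdist_zero[OF ab(1)] by simp_all
    have "mdist U (e (\<one>, n)) p = mdist U (e (\<one>, n)) q" using eq[OF e_F[OF one_closed n(2)]] .
    moreover have "mdist U (e (\<one>, n)) p \<le> mdist U (e (\<one>, n)) (e (a, k)) + mdist U p (e (a, k))"
      using V.triangle'[OF e_mem[OF n1] e_mem[OF ab(1)] p] V.triangle[OF e_mem[OF n1] e_mem[OF ab(1)] p] V.commute[of p] by simp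
    moreover have "mdist U (e (\<one>, n)) (e (b, l)) \<le> mdist U (e (\<one>, n)) q + mdist U q (e (b, l))"
      by (rule V.triangle[OF e_mem[OF n1] q e_mem[OF ab(2)]])
    moreover have "mdist U p q \<le> mdist U p (e (a, k)) + mdist U (e (a, k)) q"
      by (rule V.triangle[OF p e_mem[OF ab(1)] q])
    moreover have "mdist U (e (a, k)) q \<le> mdist U (e (a, k)) (e (b, l)) + mdist U q (e (b, l))"
      using V.triangle[OF e_mem[OF ab(1)] e_mem[OF ab(2)] q] V.commute[of q "e (b, l)"] by linarith
    ultimately show ?thesis
      using a(2) b(2) Dn \<epsilon> e_dist[OF n1 ab(1)] e_dist[OF n1 ab(2)] e_dist[OF ab] by linarith
  qed
  then have "mdist U p q \<le> 0" by (rule field_le_epsilon)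
  then have "mdist U p q = 0" using V.nonneg[of p q] by linarith
  then show ?thesis using V.zero[OF p q] by simp
qed

subsection \<open>Rigidity of the set of markers\<close>

definition mc :: "nat \<Rightarrow> real"
  where "mc n = (SOME c. \<exists>S. marker_at D n c S)"

lemma mc:
  assumes "n \<in> M" "n \<noteq> 0"
  shows "\<exists>S. marker_at D n (mc n) S"
  unfolding mc_def using someI_ex[OF marker[OF assms]] .

lemma mc_stage:
  assumes "n \<in> M" "n \<noteq> 0" "x \<in> carrier G \<times> {..<n}" "y \<in> carrier G \<times> {..<n}"
  shows "2 * D x y + 3 \<le> mc n"
proof -
  obtain S where "marker_at D n (mc n) S" using mc[OF assms(1,2)] by blast
  then have "\<forall>x \<in> carrier G \<times> {..<n}. \<forall>y \<in> carrier G \<times> {..<n}. 2 * D x y + 3 \<le> mc n"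
    unfolding marker_at_def by (elim conjE)
  from this[THEN bspec, OF assms(3), THEN bspec, OF assms(4)] show ?thesis .
qed

text \<open>The marker adds to \<open>mc n\<close> a distance \<open>r\<close> between earlier
  points, and \<open>2 * r + 3 \<le> mc n\<close>. Distances from layer \<open>n\<close> to earlier
  ones thus stay below 3/2 of \<open>mc n\<close>, whereas \<open>mc_mono\<close> more than doubles
  the constant from one marker layer to the next.\<close>

lemma mc_bounds:
  assumes n: "n \<in> M" "k < n" and gh: "g \<in> carrier G" "h \<in> carrier G"
  shows "mc n \<le> D (g, n) (h, k)" "2 * D (g, n) (h, k) \<le> 3 * mc n - 3"
proof -
  have n0: "n \<noteq> 0" using n(2) by simp
  obtain S where S: "marker_at D n (mc n) S" using mc[OF n(1) n0] by blast
  have hk: "(h, k) \<in> carrier G \<times> {..<n}" using gh n(2) by simp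
  obtain s where s: "s \<in> S" "D (g, n) (h, k) = mc n + D (act g s) (h, k)"
    using marker_dist(2)[OF S gh(1) hk] by blast
  have "S \<subseteq> carrier G \<times> {..<n}" using S unfolding marker_at_def by (elim conjE)
  then have "act g s \<in> carrier G \<times> {..<n}" using s(1) gh(1) by (intro act_mem) auto
  from mc_stage[OF n(1) n0 this hk] DM.nonneg[of "act g s" "(h, k)"] s(2)
  show "mc n \<le> D (g, n) (h, k)" "2 * D (g, n) (h, k) \<le> 3 * mc n - 3" by linarith+
qed

lemma mc_ge_3:
  assumes "n \<in> M" "n \<noteq> 0"
  shows "3 \<le> mc n"
proof -
  have "(\<one>, 0) \<in> carrier G \<times> {..<n}" using assms(2) by simp
  from mc_stage[OF assms this this] DM.nonneg[of "(\<one>, 0)" "(\<one>, 0)"] show ?thesis by linarith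
qed

text \<open>Layer \<open>m\<close> is at distance at least \<open>mc m\<close> from layer 0, and
  \<open>mc n\<close> exceeds twice every distance occurring before stage \<open>n\<close>.\<close>

lemma mc_mono:
  assumes "m \<in> M" "m \<noteq> 0" "n \<in> M" "m < n"
  shows "2 * mc m + 3 \<le> mc n"
proof -
  have "(\<one>, m) \<in> carrier G \<times> {..<n}" "(\<one>, 0) \<in> carrier G \<times> {..<n}" using assms by auto
  from mc_stage[OF assms(3) _ this] mc_bounds(1)[OF assms(1) _ one_closed one_closed, of 0] assms(2,4)
  show ?thesis by linarith
qed

lemma layers_apart:
  assumes "k \<in> M" "l \<in> M" "k \<noteq> l" "g \<in> carrier G" "h \<in> carrier G"
  shows "3 \<le> D (g, k) (h, l)"
proof (cases "k < l")
  case True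
  then have "3 \<le> mc l" using mc_ge_3[OF assms(2)] by simp
  then show ?thesis using mc_bounds(1)[OF assms(2) True assms(5,4)] DM.commute[of "(g, k)" "(h, l)"] by linarith
next
  case False
  then have lk: "l < k" using assms(3) by simp
  then have "3 \<le> mc k" using mc_ge_3[OF assms(1)] by simp
  then show ?thesis using mc_bounds(1)[OF assms(1) lk assms(4,5)] by linarith
qed

text \<open>Points of F may be limits outside the image of \<open>e\<close>, so layers are
  recognised by proximity. With layers of diameter at most 1 and mutual distance at least 3, the
  radius 1/4 makes the layer unique.\<close>

definition at_layer :: "'u \<Rightarrow> nat \<Rightarrow> bool"
  where "at_layer p m \<longleftrightarrow> m \<in> M \<and> p \<in> mspace U \<and> (\<exists>g \<in> carrier G. mdist U p (e (g, m)) < 1/4)"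

lemma at_layer_M: "at_layer p m \<Longrightarrow> m \<in> M"
  by (simp add: at_layer_def)

lemma at_layer_exists:
  assumes "p \<in> F"
  shows "\<exists>m. at_layer p m"
proof -
  have pV: "p \<in> mspace U" and "\<forall>\<epsilon>>0. \<exists>x \<in> carrier G \<times> M. mdist U p (e x) < \<epsilon>"
    using assms unfolding F_iff by simp_all
  then obtain x where x: "x \<in> carrier G \<times> M" "mdist U p (e x) < 1/4"
    by (meson divide_pos_pos zero_less_numeral zero_less_one)
  then have "at_layer p (snd x)" using pV unfolding at_layer_def by auto
  then show ?thesis by blast
qed

lemma dist_perturb:
  assumes "p \<in> mspace U" "q \<in> mspace U" "x \<in> carrier G \<times> UNIV" "y \<in> carrier G \<times> UNIV"
  shows "\<bar>mdist U p q - D x y\<bar> \<le> mdist U p (e x) + mdist U q (e y)"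
  using V.triangle[OF assms(1) e_mem[OF assms(3)] assms(2)]
    V.triangle[OF e_mem[OF assms(3)] e_mem[OF assms(4)] assms(2)]
    V.triangle[OF e_mem[OF assms(3)] assms(1) e_mem[OF assms(4)]]
    V.triangle[OF assms(1,2) e_mem[OF assms(4)]]
    V.commute[of p "e x"] V.commute[of q "e y"] e_dist[OF assms(3,4)]
  by linarith

lemma at_layer_dist:
  assumes "at_layer p k" "at_layer q l"
  shows "\<exists>g \<in> carrier G. \<exists>h \<in> carrier G. \<bar>mdist U p q - D (g, k) (h, l)\<bar> < 1/2"
proof -
  obtain g where g: "g \<in> carrier G" "mdist U p (e (g, k)) < 1/4" "p \<in> mspace U"
    using assms(1) unfolding at_layer_def by blast
  obtain h where h: "h \<in> carrier G" "mdist U q (e (h, l)) < 1/4" "q \<in> mspace U"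
    using assms(2) unfolding at_layer_def by blast
  have "(g, k) \<in> carrier G \<times> UNIV" "(h, l) \<in> carrier G \<times> UNIV" using g h by simp_all
  from dist_perturb[OF g(3) h(3) this] g(2) h(2) have "\<bar>mdist U p q - D (g, k) (h, l)\<bar> < 1/2" by linarith
  then show ?thesis using g(1) h(1) by blast
qed

text \<open>The diameter 1 plus two errors of 1/4. Against the bound \<open>3 - 1/2\<close> for
  different layers this leaves the gap from 3/2 to 5/2, by which an isometry can tell whether two
  points share a layer.\<close>

lemma at_layer_same:
  assumes "at_layer p k" "at_layer q k"
  shows "mdist U p q < 3/2"
proof -
  obtain g h where gh: "g \<in> carrier G" "h \<in> carrier G" "\<bar>mdist U p q - D (g, k) (h, k)\<bar> < 1/2"
    using at_layer_dist[OF assms] by blast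
  then show ?thesis using layer_le_1[OF gh(1,2), of k] by linarith
qed

lemma at_layer_distinct:
  assumes "at_layer p k" "at_layer q l" "k \<noteq> l"
  shows "5/2 < mdist U p q"
proof -
  obtain g h where gh: "g \<in> carrier G" "h \<in> carrier G" "\<bar>mdist U p q - D (g, k) (h, l)\<bar> < 1/2"
    using at_layer_dist[OF assms(1,2)] by blast
  then show ?thesis using layers_apart[OF at_layer_M[OF assms(1)] at_layer_M[OF assms(2)] assms(3) gh(1,2)] by linarith
qed

lemma at_layer_less:
  assumes "at_layer p k" "at_layer q n" "k < n"
  shows "mc n - 1/2 < mdist U p q" "2 * mdist U p q < 3 * mc n - 2"
proof -
  obtain h g where gh: "h \<in> carrier G" "g \<in> carrier G" "\<bar>mdist U p q - D (h, k) (g, n)\<bar> < 1/2"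
    using at_layer_dist[OF assms(1,2)] by blast
  from mc_bounds[OF at_layer_M[OF assms(2)] assms(3) gh(2,1)] gh(3) DM.commute[of "(h, k)" "(g, n)"]
  show "mc n - 1/2 < mdist U p q" "2 * mdist U p q < 3 * mc n - 2" by linarith+
qed

lemma at_layer_unique:
  assumes "at_layer p k" "at_layer p l"
  shows "k = l"
proof (rule ccontr)
  assume "k \<noteq> l"
  from at_layer_distinct[OF assms this] show False
    using assms(1) V.mdist_zero[of p] unfolding at_layer_def by simp
qed

lemma at_layer_e:
  assumes "g \<in> carrier G" "m \<in> M"
  shows "at_layer (e (g, m)) m"
proof -
  have x: "(g, m) \<in> carrier G \<times> UNIV" using assms by simp
  show ?thesis
    unfolding at_layer_def using V.mdist_zero[OF e_mem[OF x]] e_mem[OF x] assms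
    by (intro conjI bexI[of _ g]) auto
qed

lemma approx_in_layer:
  assumes p: "p \<in> F" "at_layer p m" and \<epsilon>: "0 < \<epsilon>"
  shows "\<exists>g \<in> carrier G. mdist U p (e (g, m)) < \<epsilon>"
proof -
  have pV: "p \<in> mspace U" and all: "\<forall>\<epsilon>>0. \<exists>x \<in> carrier G \<times> M. mdist U p (e x) < \<epsilon>"
    using p(1) unfolding F_iff by simp_all
  have "\<exists>x \<in> carrier G \<times> M. mdist U p (e x) < min \<epsilon> (1/4)" by (rule all[rule_format]) (use \<epsilon> in simp)
  then obtain g l where x: "g \<in> carrier G" "l \<in> M" "mdist U p (e (g, l)) < min \<epsilon> (1/4)" by blast
  then have "at_layer p l" using pV unfolding at_layer_def by auto
  then have "l = m" using at_layer_unique p(2) by blast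
  then show ?thesis using x by auto
qed

lemma same_max_distance:
  assumes "at_layer p k" "at_layer q l" "k \<noteq> l" "at_layer p' k'" "at_layer q' l'" "k' \<noteq> l'"
    and eq: "mdist U p q = mdist U p' q'"
  shows "max k l = max k' l'"
proof -
  have bounds: "mc (max k l) - 1/2 < mdist U p q \<and> 2 * mdist U p q < 3 * mc (max k l) - 2 \<and> max k l \<in> M \<and> max k l \<noteq> 0"
    if "at_layer p k" "at_layer q l" "k \<noteq> l" for p q k l
  proof (cases "k < l")
    case True
    then show ?thesis using at_layer_less[OF that(1,2) True] at_layer_M[OF that(2)] by (simp add: max_def)
  next
    case False
    then have "l < k" using that(3) by simp
    then show ?thesis using at_layer_less[OF that(2,1)] at_layer_M[OF that(1)] V.commute[of p q] by (simp add: max_def)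
  qed
  \<comment> \<open>By \<open>mc_mono\<close>, \<open>mc n - 1/2\<close> would be at least
    \<open>2 * mc m + 5/2\<close>, well above the upper bound of 3/2 of \<open>mc m\<close> for the
    same distance.\<close>
  have no: "\<not> m < n" if "m \<in> M" "m \<noteq> 0" "n \<in> M" "2 * mdist U p q < 3 * mc m - 2" "mc n - 1/2 < mdist U p q" for m n
  proof
    assume "m < n"
    from mc_mono[OF that(1-3) this] mc_ge_3[OF that(1,2)] that(4,5) show False by linarith
  qed
  note b = bounds[OF assms(1-3)] and b' = bounds[OF assms(4-6)]
  have "\<not> max k l < max k' l'" using no[of "max k l" "max k' l'"] b b' eq by simp
  moreover have "\<not> max k' l' < max k l" using no[of "max k' l'" "max k l"] b b' eq by simp
  ultimately show ?thesis by linarith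
qed

section \<open>Isometries of the marker set come from the group\<close>

text \<open>Values outside F are left free, so the notion applies alike to members of
  \<open>Iso (submetric U F)\<close>, to isometries of U preserving F, and to composites with
  \<open>\<alpha> a\<close>.\<close>

definition F_isometry :: "('u \<Rightarrow> 'u) \<Rightarrow> bool"
  where "F_isometry \<psi> \<longleftrightarrow> \<psi> ` F = F \<and> (\<forall>p \<in> F. \<forall>q \<in> F. mdist U (\<psi> p) (\<psi> q) = mdist U p q)"

lemma F_isometryD:
  assumes "F_isometry \<psi>"
  shows "\<psi> ` F = F" "p \<in> F \<Longrightarrow> \<psi> p \<in> F"
    "\<lbrakk>p \<in> F; q \<in> F\<rbrakk> \<Longrightarrow> mdist U (\<psi> p) (\<psi> q) = mdist U p q"
  using assms unfolding F_isometry_def by blast+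

text \<open>Let \<open>\<sigma> k\<close> be the layer to which the base point of layer
  \<open>k\<close> is moved. The map \<open>\<sigma>\<close> is injective by the gap between same
  and different layers, and it preserves maxima of two indices by \<open>same_max_distance\<close>.
  This fixes large indices; a marker over \<open>(\<one>, m)\<close> then fixes
  \<open>m\<close>.\<close>

lemma F_isometry_layer:
  assumes \<psi>: "F_isometry \<psi>" and p: "p \<in> F" "at_layer p m"
  shows "at_layer (\<psi> p) m"
proof -
  note \<psi>D = F_isometryD[OF \<psi>]
  define \<sigma> where "\<sigma> k = (SOME l. at_layer (\<psi> (e (\<one>, k))) l)" for k
  have eF: "e (\<one>, k) \<in> F" if "k \<in> M" for k using e_F[OF one_closed that] .
  have \<sigma>: "at_layer (\<psi> (e (\<one>, k))) (\<sigma> k)" if "k \<in> M" for k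
    unfolding \<sigma>_def using at_layer_exists[OF \<psi>D(2)[OF eF[OF that]]] by (rule someI_ex)
  have D\<psi>: "mdist U (\<psi> (e (\<one>, k))) (\<psi> (e (\<one>, l))) = mdist U (e (\<one>, k)) (e (\<one>, l))" if "k \<in> M" "l \<in> M" for k l
    using \<psi>D(3)[OF eF[OF that(1)] eF[OF that(2)]] .
  have \<sigma>_inj: "\<sigma> k \<noteq> \<sigma> l" if "k \<in> M" "l \<in> M" "k \<noteq> l" for k l
  proof
    assume eq: "\<sigma> k = \<sigma> l"
    have "mdist U (\<psi> (e (\<one>, k))) (\<psi> (e (\<one>, l))) < 3/2"
      using at_layer_same[OF \<sigma>[OF that(1)]] \<sigma>[OF that(2)] eq by simp
    moreover have "5/2 < mdist U (e (\<one>, k)) (e (\<one>, l))"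
      using at_layer_distinct[OF at_layer_e[OF one_closed that(1)] at_layer_e[OF one_closed that(2)] that(3)] .
    ultimately show False using D\<psi>[OF that(1,2)] by linarith
  qed
  have \<sigma>_max: "max (\<sigma> k) (\<sigma> l) = max k l" if "k \<in> M" "l \<in> M" "k \<noteq> l" for k l
    using same_max_distance[OF \<sigma>[OF that(1)] \<sigma>[OF that(2)] \<sigma>_inj[OF that]
      at_layer_e[OF one_closed that(1)] at_layer_e[OF one_closed that(2)] that(3) D\<psi>[OF that(1,2)]] .
  have \<sigma>_id: "\<sigma> m = m" if m: "m \<in> M" for m
  proof -
    \<comment> \<open>\<open>l\<close> is merely a second index of \<open>M\<close> between
      \<open>m\<close> and \<open>n\<close>. If \<open>n\<close> were moved, preservation of the
      maxima of \<open>m, n\<close> and of \<open>l, n\<close> would give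
      \<open>\<sigma> m = n = \<sigma> l\<close>, against injectivity.\<close>
    obtain c l where l: "l \<ge> Suc m" "l \<in> M" "marker_at D l c {(\<one>, 0)}"
      using marker_exists[of "{(\<one>, 0)}" "Suc m"] H(3) by auto
    obtain c n where n: "n \<ge> Suc l" "n \<in> M" "marker_at D n c {(\<one>, m)}"
      using marker_exists[of "{(\<one>, m)}" "Suc l"] H(3) by auto
    have "\<sigma> n = n"
      using \<sigma>_max[OF m n(2)] \<sigma>_max[OF l(2) n(2)] \<sigma>_inj[OF m l(2)] l(1) n(1)
      by (auto simp: max_def split: if_splits)
    show ?thesis
    proof (rule ccontr)
      assume ne: "\<sigma> m \<noteq> m"
      have mn: "m < n" "m \<noteq> n" using l(1) n(1) by auto
      have \<sigma>mn: "\<sigma> m < n" using \<sigma>_max[OF m n(2) mn(2)] \<sigma>_inj[OF m n(2) mn(2)] \<open>\<sigma> n = n\<close> mn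
        by (auto simp: max_def split: if_splits)
      have \<sigma>M: "\<sigma> m \<in> M" using at_layer_M[OF \<sigma>[OF m]] .
      have "at_layer (\<psi> (e (\<one>, n))) n" using \<sigma>[OF n(2)] \<open>\<sigma> n = n\<close> by simp
      from at_layer_dist[OF this \<sigma>[OF m]] obtain g h where gh: "g \<in> carrier G" "h \<in> carrier G"
        "\<bar>mdist U (\<psi> (e (\<one>, n))) (\<psi> (e (\<one>, m))) - D (g, n) (h, \<sigma> m)\<bar> < 1/2" by blast
      have h\<sigma>: "(h, \<sigma> m) \<in> carrier G \<times> {..<n}" using gh(2) \<sigma>mn by simp
      \<comment> \<open>The marker is at distance exactly \<open>c\<close> from the base point of
        layer \<open>m\<close>, but at distance at least \<open>c + 3\<close> from every other layer
        of \<open>M\<close> before \<open>n\<close>; the error of 1/2 cannot bridge this.\<close>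
      have "D (g, n) (h, \<sigma> m) = c + D (g, m) (h, \<sigma> m)"
        using marker_dist(2)[OF n(3) gh(1) h\<sigma>] gh(1) by simp
      moreover have "3 \<le> D (g, m) (h, \<sigma> m)"
        using layers_apart[OF m \<sigma>M _ gh(1,2)] ne by simp
      moreover have "mdist U (\<psi> (e (\<one>, n))) (\<psi> (e (\<one>, m))) = D (\<one>, n) (\<one>, m)"
        using D\<psi>[OF n(2) m] by simp
      moreover have "D (\<one>, n) (\<one>, m) = c + D (\<one>, m) (\<one>, m)"
        using marker_dist(2)[OF n(3) one_closed, of "(\<one>, m)"] mn(1) by simp
      moreover have "D (\<one>, m) (\<one>, m) = 0" using DM.mdist_zero[of "(\<one>, m)"] by simp
      ultimately show False using gh(3) by linarith
    qed
  qed
  have m: "m \<in> M" using at_layer_M[OF p(2)] .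
  obtain l where l: "at_layer (\<psi> p) l" using at_layer_exists[OF \<psi>D(2)[OF p(1)]] by blast
  have "l = m"
  proof (rule ccontr)
    assume "l \<noteq> m"
    from at_layer_distinct[OF l \<sigma>[OF m]] \<open>l \<noteq> m\<close> \<sigma>_id[OF m]
    have "5/2 < mdist U (\<psi> p) (\<psi> (e (\<one>, m)))" by simp
    moreover have "mdist U p (e (\<one>, m)) < 3/2" using at_layer_same[OF p(2) at_layer_e[OF one_closed m]] .
    ultimately show False using \<psi>D(3)[OF p(1) eF[OF m]] by linarith
  qed
  then show ?thesis using l by simp
qed

lemma F_isometry_approx:
  assumes \<psi>: "F_isometry \<psi>" and m: "m \<in> M" and g: "g \<in> carrier G" and \<epsilon>: "0 < \<epsilon>"
  shows "\<exists>h \<in> carrier G. mdist U (\<psi> (e (g, m))) (e (h, m)) < \<epsilon>"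
  using approx_in_layer[OF F_isometryD(2)[OF \<psi> e_F[OF g m]] F_isometry_layer[OF \<psi> e_F[OF g m] at_layer_e[OF g m]] \<epsilon>] .

text \<open>The point \<open>s\<close> is at distance at most \<open>c\<close> from its marker, so
  its image is near some \<open>(w, m)\<close> with \<open>D (h, n) (w, m) < c + 2 * \<eta>\<close>.
  The minimum there is attained at some \<open>t\<close> in \<open>S\<close> with
  \<open>act h t\<close> within \<open>2 * \<eta>\<close> of \<open>(w, m)\<close>. As the points of
  \<open>S\<close> lie in different layers from \<open>s\<close>, apart from \<open>s\<close>
  itself, \<open>t = s\<close>.\<close>

lemma marker_translate:
  assumes \<psi>: "F_isometry \<psi>" and n: "n \<in> M" "marker_at D n c S" and s: "s \<in> S" "snd s \<in> M"
    and sep: "\<And>t. \<lbrakk>t \<in> S; snd t = snd s\<rbrakk> \<Longrightarrow> t = s" "snd ` S \<subseteq> M"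
    and h: "h \<in> carrier G" "mdist U (\<psi> (e (\<one>, n))) (e (h, n)) < \<eta>" and \<eta>: "\<eta> \<le> 1"
  shows "mdist U (\<psi> (e s)) (e (act h s)) < 4 * \<eta>"
proof -
  have S: "S \<subseteq> carrier G \<times> {..<n}" using n(2) unfolding marker_at_def by (elim conjE)
  obtain a m where am: "s = (a, m)" "a \<in> carrier G" "m < n" using S s(1) by blast
  have mM: "m \<in> M" using s(2) am(1) by simp
  have \<eta>0: "0 < \<eta>" using V.nonneg[of "\<psi> (e (\<one>, n))" "e (h, n)"] h(2) by linarith
  obtain w where w: "w \<in> carrier G" "mdist U (\<psi> (e (a, m))) (e (w, m)) < \<eta>"
    using F_isometry_approx[OF \<psi> mM am(2) \<eta>0] by blast
  have F: "e (\<one>, n) \<in> F" "e (a, m) \<in> F" using e_F n(1) mM am(2) by simp_all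
  have \<psi>V: "\<psi> (e (\<one>, n)) \<in> mspace U" "\<psi> (e (a, m)) \<in> mspace U"
    using F_isometryD(2)[OF \<psi>] F F_subset by blast+
  have x: "(h, n) \<in> carrier G \<times> UNIV" "(w, m) \<in> carrier G \<times> UNIV" "(\<one>, n) \<in> carrier G \<times> UNIV"
    "(a, m) \<in> carrier G \<times> UNIV" using h(1) w(1) am(2) by simp_all
  have "D (\<one>, n) (a, m) \<le> c + D (act \<one> s) (a, m)"
    using marker_dist(1)[OF n(2) one_closed _ s(1), of "(a, m)"] am by simp
  then have "D (\<one>, n) (a, m) \<le> c" using am DM.mdist_zero[OF x(4)] by simp
  moreover have "mdist U (\<psi> (e (\<one>, n))) (\<psi> (e (a, m))) = D (\<one>, n) (a, m)"
    using F_isometryD(3)[OF \<psi> F] e_dist[OF x(3,4)] by simp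
  ultimately have Dc: "D (h, n) (w, m) < c + 2 * \<eta>"
    using dist_perturb[OF \<psi>V x(1,2)] h(2) w(2) by linarith
  obtain t where t: "t \<in> S" "D (h, n) (w, m) = c + D (act h t) (w, m)"
    using marker_dist(2)[OF n(2) h(1), of "(w, m)"] w(1) am(3) by auto
  obtain b l where bl: "t = (b, l)" "b \<in> carrier G" using S t(1) by blast
  \<comment> \<open>Different layers would be at least 3 apart, while \<open>2 * \<eta>\<close> is
    at most 2.\<close>
  have "l = m"
  proof (rule ccontr)
    assume "l \<noteq> m"
    moreover have "l \<in> M" using sep(2) t(1) bl(1) by force
    ultimately have "3 \<le> D (h \<otimes> b, l) (w, m)" using layers_apart mM w(1) h(1) bl(2) by simp
    then show False using t(2) Dc bl(1) \<eta> by simp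
  qed
  then have "t = s" using sep(1)[OF t(1)] bl(1) am(1) by simp
  then have "D (act h s) (w, m) < 2 * \<eta>" using t(2) Dc by simp
  moreover have "act h s \<in> carrier G \<times> UNIV" using am h(1) by simp
  ultimately show ?thesis
    using V.triangle[OF \<psi>V(2) e_mem[OF x(2)] e_mem[of "act h s"]] e_dist[OF x(2), of "act h s"] w(2) am(1)
      DM.commute[of "(w, m)" "act h s"] \<eta>0 by simp
qed

text \<open>One marker over all points \<open>(\<one>, m)\<close> with \<open>m\<close> in
  \<open>P\<close> has a single image, whose group coordinate \<open>h\<close> serves every layer in
  \<open>P\<close> through \<open>marker_translate\<close>.\<close>

lemma F_isometry_common_approx:
  assumes \<psi>: "F_isometry \<psi>" and P: "finite P" "P \<subseteq> M" "P \<noteq> {}" and \<epsilon>: "0 < \<epsilon>"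
  shows "\<exists>h \<in> carrier G. \<forall>m \<in> P. mdist U (\<psi> (e (\<one>, m))) (e (h, m)) < \<epsilon>"
proof -
  let ?S = "Pair \<one> ` P"
  obtain n c where n: "n \<in> M" "marker_at D n c ?S"
    using marker_exists[of ?S 0] P H(3) by blast
  obtain h where h: "h \<in> carrier G" "mdist U (\<psi> (e (\<one>, n))) (e (h, n)) < min 1 (\<epsilon>/4)"
    using F_isometry_approx[OF \<psi> n(1) one_closed, of "min 1 (\<epsilon>/4)"] \<epsilon> by auto
  have "mdist U (\<psi> (e (\<one>, m))) (e (h, m)) < \<epsilon>" if m: "m \<in> P" for m
  proof -
    have "mdist U (\<psi> (e (\<one>, m))) (e (act h (\<one>, m))) < 4 * min 1 (\<epsilon>/4)"
      by (rule marker_translate[OF \<psi> n _ _ _ _ h]) (use m P(2) in auto)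
    then show ?thesis using h(1) by simp
  qed
  then show ?thesis using h(1) by blast
qed

lemma F_isometry_limit:
  assumes \<psi>: "F_isometry \<psi>"
  shows "\<exists>g \<in> carrier G. \<forall>m \<in> M. \<psi> (e (\<one>, m)) = e (g, m)"
proof -
  note \<psi>D = F_isometryD[OF \<psi>]
  have "\<exists>h \<in> carrier G. \<forall>m \<in> insert 0 (M \<inter> {..i}). mdist U (\<psi> (e (\<one>, m))) (e (h, m)) < 1 / Suc i" for i
    by (rule F_isometry_common_approx[OF \<psi>]) (use zero_marker in auto)
  then obtain h where h: "\<And>i. h i \<in> carrier G"
    "\<And>i m. \<lbrakk>m \<in> M; m \<le> i\<rbrakk> \<Longrightarrow> mdist U (\<psi> (e (\<one>, m))) (e (h i, m)) < 1 / Suc i"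
    by (metis (no_types, lifting) IntI atMost_iff insertI2)
  have conv: "\<exists>N. \<forall>i\<ge>N. mdist U (\<psi> (e (\<one>, m))) (e (h i, m)) < \<epsilon>" if m: "m \<in> M" and \<epsilon>: "0 < \<epsilon>" for m \<epsilon>
  proof -
    obtain N where N: "1 / Suc N < \<epsilon>" using nat_approx_posE[OF \<epsilon>] by auto
    have "mdist U (\<psi> (e (\<one>, m))) (e (h i, m)) < \<epsilon>" if i: "i \<ge> max m N" for i
    proof -
      have "1 / Suc i \<le> 1 / real (Suc N)" using i by (intro divide_left_mono) auto
      then show ?thesis using h(2)[OF m, of i] i N by simp
    qed
    then show ?thesis by blast
  qed
  have \<psi>V: "\<psi> (e (a, m)) \<in> mspace U" if "a \<in> carrier G" "m \<in> M" for a m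
    using \<psi>D(2)[OF e_F[OF that]] F_subset by blast
  have C1: "MCauchy h"
    unfolding MCauchy_def
  proof (intro conjI allI impI)
    show "range h \<subseteq> carrier G" using h(1) by (rule image_subsetI)
    fix \<epsilon> :: real assume "0 < \<epsilon>"
    from near_layer[OF this, of 0] obtain \<delta> where \<delta>: "\<delta> > 0"
      "\<forall>g \<in> carrier G. \<forall>h \<in> carrier G. D (g, 0) (h, 0) < \<delta> \<longrightarrow> d g h < \<epsilon>" by blast
    obtain N where N: "\<forall>i\<ge>N. mdist U (\<psi> (e (\<one>, 0))) (e (h i, 0)) < \<delta>/2"
      using conv[OF zero_marker, of "\<delta>/2"] \<delta>(1) by auto
    have "d (h i) (h j) < \<epsilon>" if ij: "N \<le> i" "N \<le> j" for i j
    proof -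
      have x: "(h i, 0) \<in> carrier G \<times> UNIV" "(h j, 0) \<in> carrier G \<times> UNIV" using h(1) by simp_all
      have "mdist U (\<psi> (e (\<one>, 0))) (e (h i, 0)) < \<delta>/2" "mdist U (\<psi> (e (\<one>, 0))) (e (h j, 0)) < \<delta>/2"
        using N ij by simp_all
      then have "D (h i, 0) (h j, 0) < \<delta>"
        using V.triangle''[OF e_mem[OF x(1)] \<psi>V[OF one_closed zero_marker] e_mem[OF x(2)]] e_dist[OF x] by linarith
      then show ?thesis using \<delta>(2) h(1) by blast
    qed
    then show "\<exists>N. \<forall>n n'. N \<le> n \<longrightarrow> N \<le> n' \<longrightarrow> d (h n) (h n') < \<epsilon>" by blast
  qed
  have C2: "MCauchy (\<lambda>i. inv (h i))"
    unfolding MCauchy_def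
  proof (intro conjI allI impI)
    show "range (\<lambda>i. inv (h i)) \<subseteq> carrier G" using h(1) by (intro image_subsetI) simp
    fix \<epsilon> :: real assume "0 < \<epsilon>"
    from near_layer[OF this, of 0] obtain \<delta> where \<delta>: "\<delta> > 0"
      "\<forall>g \<in> carrier G. \<forall>h \<in> carrier G. D (g, 0) (h, 0) < \<delta> \<longrightarrow> d g h < \<epsilon>" by blast
    \<comment> \<open>Each \<open>inv (h i)\<close> will be within \<open>6 * \<eta>\<close> of a
      fixed \<open>y\<close> in layer 0: \<open>2 * \<eta>\<close> from approximating the preimage
      and \<open>4 * \<eta>\<close> from \<open>marker_translate\<close>. Two such errors stay below
      \<open>14 * \<eta>\<close>.\<close>
    define \<eta> where "\<eta> = min 1 (\<delta>/14)"
    have \<eta>: "0 < \<eta>" "\<eta> \<le> 1" "14 * \<eta> \<le> \<delta>" using \<delta>(1) by (simp_all add: \<eta>_def)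
    have e1: "e (\<one>, 0) \<in> F" using e_F[OF one_closed zero_marker] .
    \<comment> \<open>Here surjectivity enters. If the preimage of \<open>e (\<one>, 0)\<close> is
      near \<open>e (y, 0)\<close>, then \<open>h i \<otimes> y\<close> is near
      \<open>\<one>\<close> in layer 0, that is, \<open>inv (h i)\<close> is near
      \<open>y\<close>.\<close>
    obtain p where p: "p \<in> F" "\<psi> p = e (\<one>, 0)" using \<psi>D(1) e1 by (metis imageE)
    have pV: "p \<in> mspace U" using p(1) F_subset by blast
    have p0: "at_layer p 0"
    proof -
      obtain m where m: "at_layer p m" using at_layer_exists[OF p(1)] by blast
      have "m = 0"
        using at_layer_unique[OF F_isometry_layer[OF \<psi> p(1) m]] at_layer_e[OF one_closed zero_marker] p(2) by simp
      then show ?thesis using m by simp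
    qed
    obtain b where b: "b \<in> carrier G" "mdist U p (e (b, 0)) < \<eta>"
      using approx_in_layer[OF p(1) p0 \<eta>(1)] by blast
    \<comment> \<open>The approximating point is moved into \<open>H\<close> because markers are
      available over points of \<open>H\<close>.\<close>
    obtain y where y: "y \<in> H" "D (b, 0) (y, 0) < \<eta>"
      using layer_dense[of "(b, 0)" \<eta>] b(1) \<eta>(1) by auto
    have yG: "y \<in> carrier G" using y(1) H(2) by blast
    have x: "(b, 0) \<in> carrier G \<times> UNIV" "(y, 0) \<in> carrier G \<times> UNIV" "(\<one>, 0) \<in> carrier G \<times> UNIV"
      using b(1) yG by simp_all
    have "mdist U p (e (y, 0)) < 2 * \<eta>"
      using V.triangle[OF pV e_mem[OF x(1)] e_mem[OF x(2)]] e_dist[OF x(1,2)] b(2) y(2) by linarith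
    then have near1: "mdist U (e (\<one>, 0)) (\<psi> (e (y, 0))) < 2 * \<eta>"
      using \<psi>D(3)[OF p(1) e_F[OF yG zero_marker]] p(2) by simp
    obtain n c where n: "n \<in> M" "marker_at D n c {(y, 0)}"
      using marker_exists[of "{(y, 0)}" 0] y(1) by auto
    obtain N where N: "\<forall>i\<ge>N. mdist U (\<psi> (e (\<one>, n))) (e (h i, n)) < \<eta>"
      using conv[OF n(1) \<eta>(1)] by blast
    have close: "D (inv (h i), 0) (y, 0) < 6 * \<eta>" if i: "i \<ge> N" for i
    proof -
      have "mdist U (\<psi> (e (y, 0))) (e (act (h i) (y, 0))) < 4 * \<eta>"
        by (rule marker_translate[OF \<psi> n _ _ _ _ h(1) _ \<eta>(2)]) (use zero_marker N i in auto)
      moreover have hy: "(h i \<otimes> y, 0) \<in> carrier G \<times> UNIV" using h(1) yG by simp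
      ultimately have "D (\<one>, 0) (h i \<otimes> y, 0) < 6 * \<eta>"
        using V.triangle[OF e_mem[OF x(3)] \<psi>V[OF yG zero_marker] e_mem[OF hy]] near1 e_dist[OF x(3) hy] by simp
      moreover have "D (act (h i) (inv (h i), 0)) (act (h i) (y, 0)) = D (inv (h i), 0) (y, 0)"
        using h(1) yG by (intro D_invariant) simp_all
      ultimately show ?thesis using h(1) by simp
    qed
    have "d (inv (h i)) (inv (h j)) < \<epsilon>" if ij: "N \<le> i" "N \<le> j" for i j
    proof -
      have z: "(inv (h i), 0) \<in> carrier G \<times> UNIV" "(inv (h j), 0) \<in> carrier G \<times> UNIV" using h(1) by simp_all
      have "D (inv (h i), 0) (inv (h j), 0) < \<delta>"
        using DM.triangle'[OF z(1) x(2) z(2)] close[OF ij(1)] close[OF ij(2)] \<eta>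
          DM.triangle[OF z(1) x(2) z(2)] DM.commute[of "(inv (h j), 0)" "(y, 0)"] by linarith
      then show ?thesis using \<delta>(2) h(1) by simp
    qed
    then show "\<exists>N. \<forall>n n'. N \<le> n \<longrightarrow> N \<le> n' \<longrightarrow> d (inv (h n)) (inv (h n')) < \<epsilon>" by blast
  qed
  obtain g where g: "limitin mtopology h g sequentially" using two_sided_complete[OF C1 C2] by blast
  have gG: "g \<in> carrier G" using limitin_mspace[OF g] .
  have "\<psi> (e (\<one>, m)) = e (g, m)" if m: "m \<in> M" for m
  proof -
    have x: "(g, m) \<in> carrier G \<times> UNIV" using gG by simp
    have "mdist U (\<psi> (e (\<one>, m))) (e (g, m)) \<le> 0 + \<epsilon>" if \<epsilon>: "0 < \<epsilon>" for \<epsilon>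
    proof -
      obtain N1 where N1: "\<forall>i\<ge>N1. mdist U (\<psi> (e (\<one>, m))) (e (h i, m)) < \<epsilon>/2"
        using conv[OF m, of "\<epsilon>/2"] \<epsilon> by auto
      obtain \<delta> where \<delta>: "\<delta> > 0" "\<forall>g \<in> carrier G. \<forall>h \<in> carrier G. d g h < \<delta> \<longrightarrow> D (g, m) (h, m) < \<epsilon>/2"
        using layer_near[of "\<epsilon>/2" m] \<epsilon> by auto
      obtain N2 where N2: "\<forall>i\<ge>N2. d (h i) g < \<delta>"
        using g \<delta>(1) unfolding limit_metric_sequentially by blast
      define i where "i = max N1 N2"
      have xi: "(h i, m) \<in> carrier G \<times> UNIV" using h(1) by simp
      have "D (h i, m) (g, m) < \<epsilon>/2" using \<delta>(2) h(1) gG N2 by (simp add: i_def)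
      moreover have "mdist U (\<psi> (e (\<one>, m))) (e (h i, m)) < \<epsilon>/2" using N1 by (simp add: i_def)
      ultimately show ?thesis
        using V.triangle[OF \<psi>V[OF one_closed m] e_mem[OF xi] e_mem[OF x]] e_dist[OF xi x] by simp
    qed
    then have "mdist U (\<psi> (e (\<one>, m))) (e (g, m)) \<le> 0" by (rule field_le_epsilon)
    then have "mdist U (\<psi> (e (\<one>, m))) (e (g, m)) = 0" using V.nonneg[of "\<psi> (e (\<one>, m))" "e (g, m)"] by linarith
    then show ?thesis using V.zero[OF \<psi>V[OF one_closed m] e_mem[OF x]] by simp
  qed
  then show ?thesis using gG by blast
qed

text \<open>\<open>F_isometry_limit\<close> speaks about base points only. Markers over single
  points extend the conclusion to the dense set \<open>H\<close> in layer 0, hence to layer 0. For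
  the other layers it is applied again to \<open>\<psi>\<close> composed with
  \<open>\<alpha> a\<close>: the resulting element \<open>b\<close> is the same for all layers, and
  layer 0 identifies it as \<open>g \<otimes> a\<close>.\<close>

theorem F_isometry_rigid:
  assumes \<psi>: "F_isometry \<psi>"
  shows "\<exists>g \<in> carrier G. \<forall>p \<in> F. \<psi> p = \<alpha> g p"
proof -
  note \<psi>D = F_isometryD[OF \<psi>]
  obtain g where g: "g \<in> carrier G" "\<forall>m \<in> M. \<psi> (e (\<one>, m)) = e (g, m)"
    using F_isometry_limit[OF \<psi>] by blast
  have \<psi>V: "\<psi> p \<in> mspace U" if "p \<in> F" for p
    using \<psi>D(2)[OF that] F_subset by blast
  have FV: "p \<in> mspace U" if "p \<in> F" for p using that F_subset by blast
  have ext: "\<psi> p = \<alpha> g p" if p: "p \<in> F" and Y: "Y \<subseteq> F" "\<And>\<epsilon>. \<epsilon> > 0 \<Longrightarrow> \<exists>q \<in> Y. mdist U p q < \<epsilon>"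
    "\<And>q. q \<in> Y \<Longrightarrow> \<psi> q = \<alpha> g q" for p Y
  proof -
    have pV: "\<psi> p \<in> mspace U" "\<alpha> g p \<in> mspace U" using \<psi>V[OF p] \<alpha>_mem[OF g(1) FV[OF p]] .
    have "mdist U (\<psi> p) (\<alpha> g p) \<le> 0 + \<epsilon>" if \<epsilon>: "0 < \<epsilon>" for \<epsilon>
    proof -
      obtain q where q: "q \<in> Y" "mdist U p q < \<epsilon>/2" using Y(2)[of "\<epsilon>/2"] \<epsilon> by auto
      have qF: "q \<in> F" using q(1) Y(1) by blast
      have "mdist U (\<psi> p) (\<alpha> g p) \<le> mdist U (\<psi> p) (\<psi> q) + mdist U (\<alpha> g q) (\<alpha> g p)"
        using V.triangle[OF pV(1) \<psi>V[OF qF] pV(2)] Y(3)[OF q(1)] by simp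
      also have "\<dots> = mdist U p q + mdist U q p"
        using \<psi>D(3)[OF p qF] \<alpha>_dist[OF g(1) FV[OF qF] FV[OF p]] by simp
      finally show ?thesis using q(2) V.commute[of p q] by simp
    qed
    then have "mdist U (\<psi> p) (\<alpha> g p) \<le> 0" by (rule field_le_epsilon)
    then have "mdist U (\<psi> p) (\<alpha> g p) = 0" using V.nonneg[of "\<psi> p" "\<alpha> g p"] by linarith
    then show ?thesis using V.zero[OF pV] by simp
  qed
  have H0: "\<psi> (e (y, 0)) = \<alpha> g (e (y, 0))" if y: "y \<in> H" for y
  proof -
    have yG: "y \<in> carrier G" using y H(2) by blast
    have x: "(y, 0) \<in> carrier G \<times> UNIV" "(g \<otimes> y, 0) \<in> carrier G \<times> UNIV" using yG g(1) by simp_all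
    have \<psi>y: "\<psi> (e (y, 0)) \<in> mspace U" using \<psi>V[OF e_F[OF yG zero_marker]] .
    obtain n c where n: "n \<in> M" "marker_at D n c {(y, 0)}"
      using marker_exists[of "{(y, 0)}" 0] y by auto
    have gn: "(g, n) \<in> carrier G \<times> UNIV" using g(1) by simp
    have "mdist U (\<psi> (e (y, 0))) (e (act g (y, 0))) \<le> 0 + \<epsilon>" if \<epsilon>: "0 < \<epsilon>" for \<epsilon>
    proof -
      \<comment> \<open>The marker point is now moved exactly to \<open>e (g, n)\<close>, so the
        error in \<open>marker_translate\<close> can be chosen arbitrarily small.\<close>
      have "mdist U (\<psi> (e (\<one>, n))) (e (g, n)) < min 1 (\<epsilon>/4)"
        using g(2) n(1) \<epsilon> V.mdist_zero[OF e_mem[OF gn]] by simp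
      then have "mdist U (\<psi> (e (y, 0))) (e (act g (y, 0))) < 4 * min 1 (\<epsilon>/4)"
        by (intro marker_translate[OF \<psi> n _ _ _ _ g(1)]) (use zero_marker in auto)
      then show ?thesis by simp
    qed
    then have "mdist U (\<psi> (e (y, 0))) (e (act g (y, 0))) \<le> 0" by (rule field_le_epsilon)
    then have "mdist U (\<psi> (e (y, 0))) (e (g \<otimes> y, 0)) = 0"
      using V.nonneg[of "\<psi> (e (y, 0))" "e (g \<otimes> y, 0)"] by simp
    then show ?thesis using V.zero[OF \<psi>y e_mem[OF x(2)]] \<alpha>_e[OF g(1) x(1)] by simp
  qed
  have L0: "\<psi> (e (a, 0)) = \<alpha> g (e (a, 0))" if a: "a \<in> carrier G" for a
  proof (rule ext[OF e_F[OF a zero_marker]])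
    show "(\<lambda>y. e (y, 0)) ` H \<subseteq> F" using e_F zero_marker H(2) by blast
    show "\<psi> q = \<alpha> g q" if "q \<in> (\<lambda>y. e (y, 0)) ` H" for q using that H0 by blast
    show "\<exists>q \<in> (\<lambda>y. e (y, 0)) ` H. mdist U (e (a, 0)) q < \<epsilon>" if \<epsilon>: "0 < \<epsilon>" for \<epsilon>
    proof -
      obtain y where y: "y \<in> H" "D (a, 0) (y, 0) < \<epsilon>" using layer_dense[of "(a, 0)" \<epsilon>] a \<epsilon> by auto
      then have "mdist U (e (a, 0)) (e (y, 0)) < \<epsilon>" using e_dist[of "(a, 0)" "(y, 0)"] a H(2) by auto
      then show ?thesis using y(1) by blast
    qed
  qed
  have LM: "\<psi> (e (a, m)) = \<alpha> g (e (a, m))" if a: "a \<in> carrier G" and m: "m \<in> M" for a m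
  proof -
    have "F_isometry (\<lambda>p. \<psi> (\<alpha> a p))"
      unfolding F_isometry_def
    proof (intro conjI ballI)
      have "(\<lambda>p. \<psi> (\<alpha> a p)) ` F = \<psi> ` (\<alpha> a ` F)" by (simp add: image_image)
      then show "(\<lambda>p. \<psi> (\<alpha> a p)) ` F = F" using \<alpha>_image_F[OF a] \<psi>D(1) by simp
      show "mdist U (\<psi> (\<alpha> a p)) (\<psi> (\<alpha> a q)) = mdist U p q" if "p \<in> F" "q \<in> F" for p q
        using \<psi>D(3)[OF \<alpha>_F[OF a that(1)] \<alpha>_F[OF a that(2)]] \<alpha>_dist[OF a FV FV, OF that] by simp
    qed
    from F_isometry_limit[OF this] obtain b where b: "b \<in> carrier G" "\<forall>m \<in> M. \<psi> (\<alpha> a (e (\<one>, m))) = e (b, m)"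
      by blast
    have \<alpha>1: "\<alpha> a (e (\<one>, k)) = e (a, k)" "\<alpha> g (e (a, k)) = e (g \<otimes> a, k)" for k
      using \<alpha>_e[OF a, of "(\<one>, k)"] \<alpha>_e[OF g(1), of "(a, k)"] a by simp_all
    have "e (b, 0) = e (g \<otimes> a, 0)" using b(2) zero_marker L0[OF a] \<alpha>1 by simp
    then have "b = g \<otimes> a" using inj_onD[OF e_inj, of "(b, 0)" "(g \<otimes> a, 0)"] b(1) g(1) a by simp
    then show ?thesis using b(2) m \<alpha>1 by simp
  qed
  have "\<psi> p = \<alpha> g p" if p: "p \<in> F" for p
  proof (rule ext[OF p])
    show "e ` (carrier G \<times> M) \<subseteq> F" using e_F by blast
    show "\<psi> q = \<alpha> g q" if "q \<in> e ` (carrier G \<times> M)" for q using that LM by blast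
    show "\<exists>q \<in> e ` (carrier G \<times> M). mdist U p q < \<epsilon>" if "0 < \<epsilon>" for \<epsilon>
      using p that unfolding F_iff by blast
  qed
  then show ?thesis using g(1) by blast
qed

subsection \<open>Isometry groups\<close>

text \<open>It suffices to move a nearby \<open>e (b, k)\<close>. If \<open>a\<close> is near
  \<open>x\<close>, then \<open>inv x \<otimes> a\<close> is near \<open>\<one>\<close>, and right
  multiplication by \<open>b\<close> is continuous there, so \<open>a \<otimes> b\<close> is near
  \<open>x \<otimes> b\<close>; \<open>layer_near\<close> transfers this to layer
  \<open>k\<close>.\<close>

lemma \<alpha>_continuous:
  assumes p: "p \<in> mspace U"
  shows "continuous_map mtopology (mtopology_of U) (\<lambda>g. \<alpha> g p)"
proof -
  have "\<exists>\<delta>>0. \<forall>x. x \<in> carrier G \<and> d a x < \<delta> \<longrightarrow> mdist U (\<alpha> a p) (\<alpha> x p) < \<epsilon>"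
    if a: "a \<in> carrier G" and \<epsilon>: "0 < \<epsilon>" for a \<epsilon>
  proof -
    obtain b k where bk: "b \<in> carrier G" "mdist U p (e (b, k)) < \<epsilon>/3" using e_dense[OF p, of "\<epsilon>/3"] \<epsilon> by auto
    have y: "(b, k) \<in> carrier G \<times> UNIV" using bk(1) by simp
    obtain \<delta>1 where \<delta>1: "\<delta>1 > 0" "\<forall>g \<in> carrier G. \<forall>h \<in> carrier G. d g h < \<delta>1 \<longrightarrow> D (g, k) (h, k) < \<epsilon>/3"
      using layer_near[of "\<epsilon>/3" k] \<epsilon> by auto
    obtain \<delta> where \<delta>: "\<delta> > 0" "\<forall>g \<in> carrier G. d g \<one> < \<delta> \<longrightarrow> d (g \<otimes> b) b < \<delta>1"
      using right_mult_continuous[OF bk(1) \<delta>1(1)] by blast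
    have "mdist U (\<alpha> a p) (\<alpha> x p) < \<epsilon>" if x: "x \<in> carrier G" "d a x < \<delta>" for x
    proof -
      have "d (inv x \<otimes> a) \<one> < \<delta>" using d_translate[OF a x(1)] x(2) by simp
      then have "d (inv x \<otimes> a \<otimes> b) b < \<delta>1" using \<delta>(2) a x(1) by simp
      moreover have "x \<otimes> (inv x \<otimes> a \<otimes> b) = a \<otimes> b" using a x(1) bk(1) by (simp add: m_assoc[symmetric])
      ultimately have "d (a \<otimes> b) (x \<otimes> b) < \<delta>1"
        using left_invariant[of x "inv x \<otimes> a \<otimes> b" b] a x(1) bk(1) by simp
      then have "D (a \<otimes> b, k) (x \<otimes> b, k) < \<epsilon>/3" using \<delta>1(2) a x(1) bk(1) by simp
      then have "mdist U (\<alpha> a (e (b, k))) (\<alpha> x (e (b, k))) < \<epsilon>/3"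
        using \<alpha>_e[OF a y] \<alpha>_e[OF x(1) y] e_dist[of "(a \<otimes> b, k)" "(x \<otimes> b, k)"] a x(1) bk(1) by simp
      moreover have "mdist U (\<alpha> a p) (\<alpha> a (e (b, k))) < \<epsilon>/3" "mdist U (\<alpha> x p) (\<alpha> x (e (b, k))) < \<epsilon>/3"
        using \<alpha>_dist[OF a p e_mem[OF y]] \<alpha>_dist[OF x(1) p e_mem[OF y]] bk(2) by simp_all
      ultimately show ?thesis
        using V.triangle[OF \<alpha>_mem[OF a p] \<alpha>_mem[OF a e_mem[OF y]] \<alpha>_mem[OF x(1) p]]
          V.triangle[OF \<alpha>_mem[OF a e_mem[OF y]] \<alpha>_mem[OF x(1) e_mem[OF y]] \<alpha>_mem[OF x(1) p]]
          V.commute[of "\<alpha> x p" "\<alpha> x (e (b, k))"] by linarith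
    qed
    then show ?thesis using \<delta>(1) by blast
  qed
  then show ?thesis
    unfolding mtopology_of_def metric_continuous_map[OF V.Metric_space_axioms]
    using \<alpha>_mem p by auto
qed

text \<open>The set \<open>W\<close> will be F or the whole of \<open>mspace U\<close>, so that one
  argument serves both isometry groups.\<close>

definition \<beta> :: "'u set \<Rightarrow> 'a \<Rightarrow> 'u \<Rightarrow> 'u"
  where "\<beta> W g = restrict (\<alpha> g) W"

context
  fixes W :: "'u set"
  assumes W: "W \<subseteq> mspace U" "\<And>g. g \<in> carrier G \<Longrightarrow> \<alpha> g ` W = W" "\<And>g. g \<in> carrier G \<Longrightarrow> e (g, 0) \<in> W"
begin

lemma mspace_W: "mspace (submetric U W) = W"
  using W(1) by (simp add: Int_absorb2)

lemma W_mem: "p \<in> W \<Longrightarrow> p \<in> mspace U"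
  using W(1) by blast

lemma \<alpha>_W: "\<lbrakk>g \<in> carrier G; p \<in> W\<rbrakk> \<Longrightarrow> \<alpha> g p \<in> W"
  using W(2) by blast

lemma \<beta>_Iso:
  assumes g: "g \<in> carrier G"
  shows "\<beta> W g \<in> Iso (submetric U W)"
proof -
  have "\<beta> W g ` W = W" using W(2)[OF g] by (simp add: \<beta>_def)
  moreover have "\<beta> W g \<in> W \<rightarrow> W" using \<alpha>_W[OF g] by (simp add: \<beta>_def)
  moreover have "mdist U x y = mdist U (\<beta> W g x) (\<beta> W g y)" if "x \<in> W" "y \<in> W" for x y
    using \<alpha>_dist[OF g W_mem W_mem, OF that] that by (simp add: \<beta>_def)
  ultimately show ?thesis
    unfolding Iso_def isometry_def isometric_map_def mspace_W mdist_submetric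
    by (simp add: \<beta>_def)
qed

lemma \<beta>_mult:
  assumes g: "g \<in> carrier G" and h: "h \<in> carrier G"
  shows "\<beta> W (g \<otimes> h) = \<beta> W g \<otimes>\<^bsub>Iso_group (submetric U W)\<^esub> \<beta> W h"
proof -
  have B: "\<beta> W g \<in> Bij W" "\<beta> W h \<in> Bij W"
    using \<beta>_Iso[OF g] \<beta>_Iso[OF h] Iso_subset_Bij[of "submetric U W"] unfolding mspace_W by blast+
  have "\<beta> W (g \<otimes> h) = compose W (\<beta> W g) (\<beta> W h)"
  proof
    fix p
    show "\<beta> W (g \<otimes> h) p = compose W (\<beta> W g) (\<beta> W h) p"
      using \<alpha>_mult[OF g h W_mem, of p] \<alpha>_W[OF h, of p]
      by (cases "p \<in> W") (simp_all add: \<beta>_def compose_def)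
  qed
  then show ?thesis unfolding Iso_group_def BijGroup_def mspace_W using B by simp
qed

lemma \<beta>_inj: "inj_on (\<beta> W) (carrier G)"
proof (rule inj_onI)
  fix g h assume gh: "g \<in> carrier G" "h \<in> carrier G" "\<beta> W g = \<beta> W h"
  have "\<alpha> g (e (\<one>, 0)) = \<alpha> h (e (\<one>, 0))"
    using fun_cong[OF gh(3), of "e (\<one>, 0)"] W(3)[OF one_closed] by (simp add: \<beta>_def)
  then have "e (g, 0) = e (h, 0)"
    using \<alpha>_e[OF gh(1), of "(\<one>, 0)"] \<alpha>_e[OF gh(2), of "(\<one>, 0)"] gh by simp
  then show "g = h" using inj_onD[OF e_inj, of "(g, 0)" "(h, 0)"] gh by simp
qed

lemma \<beta>_group_iso: "\<beta> W \<in> Group.iso G (Iso_group (submetric U W) \<lparr>carrier := \<beta> W ` carrier G\<rparr>)"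
  using \<beta>_inj \<beta>_mult by (auto simp: Group.iso_def hom_def bij_betw_def)

text \<open>Openness needs evaluation at the single point \<open>e (\<one>, 0)\<close>: it sends
  \<open>\<beta> W h\<close> to \<open>e (h, 0)\<close>, and by \<open>near_layer\<close> closeness
  in layer 0 implies closeness in G.\<close>

lemma \<beta>_homeomorphic:
  "homeomorphic_map mtopology (subtopology (Iso_topology (submetric U W)) (\<beta> W ` carrier G)) (\<beta> W)"
proof (rule bijective_open_imp_homeomorphic_map)
  let ?Z = "subtopology (Iso_topology (submetric U W)) (\<beta> W ` carrier G)"
  let ?P = "product_topology (\<lambda>_. mtopology_of (submetric U W)) W"
  have sub: "\<beta> W ` carrier G \<subseteq> Iso (submetric U W)" using \<beta>_Iso by blast
  have Z: "?Z = subtopology ?P (\<beta> W ` carrier G)"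
    using sub unfolding Iso_topology_def mspace_W by (simp add: subtopology_subtopology Int_absorb1)
  have "continuous_map mtopology ?P (\<beta> W)"
    unfolding continuous_map_componentwise
  proof (intro conjI ballI)
    show "\<beta> W ` topspace mtopology \<subseteq> extensional W" by (auto simp: \<beta>_def)
    fix p assume p: "p \<in> W"
    have "continuous_map mtopology (mtopology_of U) (\<lambda>g. \<alpha> g p)" by (rule \<alpha>_continuous[OF W_mem[OF p]])
    then have "continuous_map mtopology (mtopology_of (submetric U W)) (\<lambda>g. \<alpha> g p)"
      unfolding mtopology_of_submetric continuous_map_in_subtopology using \<alpha>_W p by auto
    then show "continuous_map mtopology (mtopology_of (submetric U W)) (\<lambda>g. \<beta> W g p)"
      using p by (simp add: \<beta>_def)
  qed
  then show cont: "continuous_map mtopology ?Z (\<beta> W)"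
    unfolding Z continuous_map_in_subtopology by auto
  have PiE: "\<beta> W ` carrier G \<subseteq> topspace ?P"
    using continuous_map_image_subset_topspace[OF \<open>continuous_map mtopology ?P (\<beta> W)\<close>] by simp
  then show "\<beta> W ` topspace mtopology = topspace ?Z"
    unfolding Z by (simp add: Int_absorb1)
  show "inj_on (\<beta> W) (topspace mtopology)" using \<beta>_inj by simp
  show "open_map mtopology ?Z (\<beta> W)"
    unfolding open_map_def
  proof (intro allI impI)
    fix A assume A: "openin mtopology A"
    show "openin ?Z (\<beta> W ` A)"
    proof (subst openin_subopen, intro ballI)
      fix f assume "f \<in> \<beta> W ` A"
      then obtain g where g: "g \<in> A" "f = \<beta> W g" by blast
      obtain r where r: "r > 0" "mball g r \<subseteq> A" using A g(1) unfolding openin_mtopology by blast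
      have gG: "g \<in> carrier G" using A g(1) unfolding openin_mtopology by blast
      obtain \<delta> where \<delta>: "\<delta> > 0" "\<forall>g \<in> carrier G. \<forall>h \<in> carrier G. D (g, 0) (h, 0) < \<delta> \<longrightarrow> d g h < r"
        using near_layer[OF r(1), of 0] by blast
      have eW: "e (\<one>, 0) \<in> W" using W(3)[OF one_closed] .
      have \<beta>e: "\<beta> W h (e (\<one>, 0)) = e (h, 0)" if "h \<in> carrier G" for h
        using \<alpha>_e[OF that, of "(\<one>, 0)"] eW that by (simp add: \<beta>_def)
      have "continuous_map ?P (mtopology_of (submetric U W)) (\<lambda>f. f (e (\<one>, 0)))"
        by (rule continuous_map_product_projection[OF eW])
      then have "continuous_map ?P (mtopology_of U) (\<lambda>f. f (e (\<one>, 0)))"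
        unfolding mtopology_of_submetric continuous_map_in_subtopology by blast
      then have ev: "continuous_map ?Z (mtopology_of U) (\<lambda>f. f (e (\<one>, 0)))"
        unfolding Z by (rule continuous_map_from_subtopology)
      let ?N = "{f \<in> topspace ?Z. f (e (\<one>, 0)) \<in> V.mball (e (g, 0)) \<delta>}"
      have "openin (mtopology_of U) (V.mball (e (g, 0)) \<delta>)" by (simp add: mtopology_of_def)
      from openin_continuous_map_preimage[OF ev this] have "openin ?Z ?N" .
      moreover have "f \<in> ?N"
      proof -
        have x: "(g, 0) \<in> carrier G \<times> UNIV" using gG by simp
        have "f \<in> topspace ?Z" using PiE g gG unfolding Z by auto
        then show ?thesis using \<beta>e[OF gG] g(2) \<delta>(1) e_mem[OF x] by simp
      qed
      moreover have "?N \<subseteq> \<beta> W ` A"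
      proof
        fix k assume k: "k \<in> ?N"
        then have "k \<in> \<beta> W ` carrier G" unfolding Z by simp
        then obtain h where h: "h \<in> carrier G" "k = \<beta> W h" by blast
        have "e (h, 0) \<in> V.mball (e (g, 0)) \<delta>" using k h \<beta>e[OF h(1)] by simp
        then have "D (g, 0) (h, 0) < \<delta>" using e_dist[of "(g, 0)" "(h, 0)"] gG h(1) by simp
        then have "h \<in> mball g r" using \<delta>(2) gG h(1) by simp
        then show "k \<in> \<beta> W ` A" using r(2) h(2) by blast
      qed
      ultimately show "\<exists>N. openin ?Z N \<and> f \<in> N \<and> N \<subseteq> \<beta> W ` A" by blast
    qed
  qed
qed

end

lemma \<beta>_mspace: "\<beta> (mspace U) g = \<alpha> g"
  by (simp add: \<beta>_def \<alpha>_def)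

lemma F_invariant: "F \<subseteq> mspace U" "\<And>g. g \<in> carrier G \<Longrightarrow> \<alpha> g ` F = F" "\<And>g. g \<in> carrier G \<Longrightarrow> e (g, 0) \<in> F"
  by (fact F_subset, erule \<alpha>_image_F, erule e_F[OF _ zero_marker])

lemma U_invariant: "mspace U \<subseteq> mspace U" "\<And>g. g \<in> carrier G \<Longrightarrow> \<alpha> g ` mspace U = mspace U"
    "\<And>g. g \<in> carrier G \<Longrightarrow> e (g, 0) \<in> mspace U"
  by (simp, erule \<alpha>_image, simp)

lemma Iso_F_eq: "Iso (submetric U F) = \<beta> F ` carrier G"
proof
  show "\<beta> F ` carrier G \<subseteq> Iso (submetric U F)" using \<beta>_Iso[OF F_invariant] by blast
  show "Iso (submetric U F) \<subseteq> \<beta> F ` carrier G"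
  proof
    fix f assume "f \<in> Iso (submetric U F)"
    then have f: "f \<in> extensional F" "f ` F = F" "\<forall>x \<in> F. \<forall>y \<in> F. mdist U x y = mdist U (f x) (f y)"
      by (simp_all add: Iso_def isometry_def isometric_map_def Int_absorb2[OF F_subset])
    have "F_isometry f" unfolding F_isometry_def using f(2,3) by simp
    from F_isometry_rigid[OF this] obtain g where g: "g \<in> carrier G" "\<forall>p \<in> F. f p = \<alpha> g p" by blast
    have "f = \<beta> F g"
      by (rule extensionalityI[OF f(1)]) (simp_all add: \<beta>_def g(2))
    then show "f \<in> \<beta> F ` carrier G" using g(1) by blast
  qed
qed

lemma \<alpha>_Iso: "g \<in> carrier G \<Longrightarrow> \<alpha> g \<in> Iso U"
  using \<beta>_Iso[OF U_invariant, of g] by (simp add: \<beta>_mspace)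

text \<open>Every point of F has the form \<open>\<alpha> g y = \<phi> y\<close> with
  \<open>y\<close> in F, so both isometries give \<open>\<phi> p\<close> and
  \<open>\<alpha> g p\<close> the same distances to F; \<open>F_determines\<close> concludes. This
  yields uniqueness of extensions.\<close>

lemma Iso_U_eqI:
  assumes \<phi>: "\<phi> \<in> Iso U" and g: "g \<in> carrier G" and eq: "\<And>p. p \<in> F \<Longrightarrow> \<phi> p = \<alpha> g p"
  shows "\<phi> = \<alpha> g"
proof (rule extensionalityI[of _ "mspace U"])
  show "\<phi> \<in> extensional (mspace U)" "\<alpha> g \<in> extensional (mspace U)"
    using \<phi> \<alpha>_Iso[OF g] unfolding Iso_def by simp_all
  have \<phi>V: "\<phi> p \<in> mspace U" if "p \<in> mspace U" for p
    using \<phi> that unfolding Iso_def isometry_def by blast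
  have \<phi>d: "mdist U (\<phi> p) (\<phi> q) = mdist U p q" if "p \<in> mspace U" "q \<in> mspace U" for p q
    using \<phi> that unfolding Iso_def isometry_def isometric_map_def by simp
  show "\<phi> p = \<alpha> g p" if p: "p \<in> mspace U" for p
  proof (rule F_determines[OF \<phi>V[OF p] \<alpha>_mem[OF g p]])
    fix x assume "x \<in> F"
    then obtain y where y: "y \<in> F" "x = \<alpha> g y" using \<alpha>_image_F[OF g] by blast
    have yV: "y \<in> mspace U" using y(1) F_subset by blast
    show "mdist U x (\<phi> p) = mdist U x (\<alpha> g p)"
      using \<phi>d[OF yV p] \<alpha>_dist[OF g yV p] eq[OF y(1)] y(2) by simp
  qed
qed

lemma Iso_stab_eq: "Iso_stab U F = \<alpha> ` carrier G"
proof
  show "\<alpha> ` carrier G \<subseteq> Iso_stab U F"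
    using \<alpha>_Iso \<alpha>_image_F unfolding Iso_stab_def by blast
  show "Iso_stab U F \<subseteq> \<alpha> ` carrier G"
  proof
    fix \<phi> assume "\<phi> \<in> Iso_stab U F"
    then have \<phi>: "\<phi> \<in> Iso U" "\<phi> ` F = F" unfolding Iso_stab_def by simp_all
    have d: "\<forall>x \<in> mspace U. \<forall>y \<in> mspace U. mdist U x y = mdist U (\<phi> x) (\<phi> y)"
      using \<phi>(1) unfolding Iso_def isometry_def isometric_map_def by simp
    have "mdist U (\<phi> p) (\<phi> q) = mdist U p q" if "p \<in> F" "q \<in> F" for p q
      using d[THEN bspec, OF subsetD[OF F_subset that(1)], THEN bspec, OF subsetD[OF F_subset that(2)]] by simp
    then have "F_isometry \<phi>" unfolding F_isometry_def using \<phi>(2) by simp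
    from F_isometry_rigid[OF this] obtain g where g: "g \<in> carrier G" "\<forall>p \<in> F. \<phi> p = \<alpha> g p" by blast
    have "\<phi> = \<alpha> g" using Iso_U_eqI[OF \<phi>(1) g(1)] g(2) by simp
    then show "\<phi> \<in> \<alpha> ` carrier G" using g(1) by blast
  qed
qed

lemma Iso_F_isomorphic:
  "topologically_isomorphic G mtopology (Iso_group (submetric U F)) (Iso_topology (submetric U F))"
proof -
  have "\<beta> F \<in> Group.iso G (Iso_group (submetric U F))"
    using \<beta>_group_iso[OF F_invariant] unfolding Iso_F_eq[symmetric] by (simp add: Iso_group_def)
  moreover have "homeomorphic_map mtopology (Iso_topology (submetric U F)) (\<beta> F)"
    using \<beta>_homeomorphic[OF F_invariant] unfolding Iso_F_eq[symmetric]
    by (simp add: Iso_topology_def subtopology_subtopology)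
  ultimately show ?thesis unfolding topologically_isomorphic_def by blast
qed

lemma Iso_stab_isomorphic:
  "topologically_isomorphic G mtopology (Iso_stab_group U F) (Iso_stab_topology U F)"
proof -
  have \<beta>\<alpha>: "\<beta> (mspace U) = \<alpha>" using \<beta>_mspace by (rule ext)
  have "\<alpha> \<in> Group.iso G (Iso_stab_group U F)"
    using \<beta>_group_iso[OF U_invariant] unfolding \<beta>\<alpha> Iso_stab_eq[symmetric] Iso_stab_group_def by simp
  moreover have "homeomorphic_map mtopology (Iso_stab_topology U F) \<alpha>"
    using \<beta>_homeomorphic[OF U_invariant] unfolding \<beta>\<alpha> Iso_stab_eq[symmetric] Iso_stab_topology_def by simp
  ultimately show ?thesis unfolding topologically_isomorphic_def by blast
qed

lemma unique_extension:
  assumes "f \<in> Iso (submetric U F)"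
  shows "\<exists>!\<phi>. \<phi> \<in> Iso U \<and> restrict \<phi> F = f"
proof -
  obtain g where g: "g \<in> carrier G" "f = \<beta> F g" using assms unfolding Iso_F_eq by blast
  show ?thesis
  proof (rule ex1I[of _ "\<alpha> g"])
    show "\<alpha> g \<in> Iso U \<and> restrict (\<alpha> g) F = f" using \<alpha>_Iso[OF g(1)] g(2) by (simp add: \<beta>_def)
    fix \<phi> assume \<phi>: "\<phi> \<in> Iso U \<and> restrict \<phi> F = f"
    have "\<phi> p = \<alpha> g p" if "p \<in> F" for p
    proof -
      have "restrict \<phi> F p = restrict (\<alpha> g) F p" using \<phi> g(2) by (simp add: \<beta>_def)
      then show ?thesis using that by simp
    qed
    then show "\<phi> = \<alpha> g" using Iso_U_eqI \<phi> g(1) by blast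
  qed
qed

end

theorem theorem1p1:
  fixes G :: "('g, 'm) monoid_scheme" and T :: "'g topology" and U :: "'u metric"
  assumes "polish_group G T" and "urysohn_space U"
  shows "\<exists>F. closedin (mtopology_of U) F \<and>
    topologically_isomorphic G T (Iso_group (submetric U F)) (Iso_topology (submetric U F)) \<and>
    (\<forall>f \<in> Iso (submetric U F). \<exists>!\<phi>. \<phi> \<in> Iso U \<and> restrict \<phi> F = f) \<and>
    topologically_isomorphic G T (Iso_stab_group U F) (Iso_stab_topology U F)"
proof -
  obtain d H where "left_invariant_polish G d H" and T: "T = Metric_space.mtopology (carrier G) d"
    using polish_group.left_invariant_polish[OF assms(1)] by blast
  then obtain D M where "layered G d H D M"
    using left_invariant_polish.layered_exists by blast
  then obtain e where "realized G d H D M U e"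
    using layered.realized_exists[OF _ assms(2)] by blast
  then interpret realized G d H D M U e .
  show ?thesis
    unfolding T
    using F_closed Iso_F_isomorphic unique_extension Iso_stab_isomorphic by (intro exI[of _ F]) simp
qed

end
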